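(* For any $0<c_0<1$ there exists a constant $c_1>0$, depending only on $c_0$, such that the following holds. Let $n\ge2$ and $r\ge2$ be integers, let $p=(p_1,\dots,p_r)$ be a probability vector, and let $\sigma_1,\dots,\sigma_r$ be independent and uniformly distributed random permutations in $\mathbb S_n$ with associated permutation matrices $M_1,\dots,M_r$. Set $P=\sum_{i=1}^rp_iM_i$, with eigenvalues $1=\lambda_1\ge|\lambda_2|\ge\cdots\ge|\lambda_n|$. Then, with $\rho=\sqrt{\sum_{i=1}^rp_i^2}$ and $d=r^2$, $$\mathbb P\big(|\lambda_2|\ge(1+\varepsilon)\rho\big)\le n^{-c_0},\qquad\text{where }\varepsilon=c_1\frac{\log d}{\sqrt{\log n}}.$$
   Context: The permutation matrix of $\sigma\in\mathbb S_n$ is the $n\times n$ matrix with $(x,y)$ entry $1$ if $\sigma(x)=y$ and $0$ otherwise. A probability vector has non-negative entries summing to $1$. Eigenvalues are complex, counted with algebraic multiplicity, and ordered by non-increasing modulus. *)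

theory Defs
  imports "HOL-Probability.Probability" "Jordan_Normal_Form.Char_Poly"
begin

text \<open>The group \<open>\<S>\<^sub>n\<close> is the set of permutations of \<open>{..<n}\<close>, and all indices
  (rows, columns, and those of the weights and of the permutations) start at 0.\<close>

definition permutation_matrix :: "nat \<Rightarrow> (nat \<Rightarrow> nat) \<Rightarrow> complex mat" where
  "permutation_matrix n \<pi> = mat n n (\<lambda>(x, y). if \<pi> x = y then 1 else 0)"

definition weighted_permutation_matrix ::
    "nat \<Rightarrow> nat \<Rightarrow> (nat \<Rightarrow> real) \<Rightarrow> (nat \<Rightarrow> nat \<Rightarrow> nat) \<Rightarrow> complex mat" where
  "weighted_permutation_matrix n r p \<sigma> =
     mat n n (\<lambda>(x, y). \<Sum>i<r. complex_of_real (p i) * permutation_matrix n (\<sigma> i) $$ (x, y))"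

definition probability_vector :: "nat \<Rightarrow> (nat \<Rightarrow> real) \<Rightarrow> bool" where
  "probability_vector r p \<longleftrightarrow> (\<forall>i<r. 0 \<le> p i) \<and> (\<Sum>i<r. p i) = 1"

text \<open>\<open>\<sigma> 0, \<dots>, \<sigma> (r - 1)\<close> are independent and uniform on \<open>\<S>\<^sub>n\<close>;
  the components with index at least \<open>r\<close> are fixed to the identity and play no role.\<close>

definition random_permutations :: "nat \<Rightarrow> nat \<Rightarrow> (nat \<Rightarrow> nat \<Rightarrow> nat) pmf" where
  "random_permutations n r = Pi_pmf {..<r} id (\<lambda>_. pmf_of_set {\<pi>. \<pi> permutes {..<n}})"

text \<open>The multiset of roots of the characteristic polynomial accounts for algebraic
  multiplicities. Eigenvalues of equal modulus may be ordered in any way, which does not affect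
  the non-increasing list of moduli.\<close>

definition eigenvalue_moduli :: "complex mat \<Rightarrow> real list" where
  "eigenvalue_moduli A = rev (sorted_list_of_multiset (image_mset cmod (proots (char_poly A))))"

text \<open>The modulus of the \<open>k\<close>-th eigenvalue, for \<open>1 \<le> k \<le> n\<close> when \<open>A\<close> is \<open>n\<close> by \<open>n\<close>.\<close>

definition eigenvalue_modulus :: "complex mat \<Rightarrow> nat \<Rightarrow> real" where
  "eigenvalue_modulus A k = eigenvalue_moduli A ! (k - 1)"

lemma length_eigenvalue_moduli:
  assumes "A \<in> carrier_mat n n"
  shows "length (eigenvalue_moduli A) = n"
proof -
  have "length (eigenvalue_moduli A) = size (mset (eigenvalue_moduli A))" by simp
  also have "\<dots> = n"
    unfolding eigenvalue_moduli_def
    using degree_monic_char_poly[OF assms] by (simp del: size_mset add: size_proots_complex)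
  finally show ?thesis .
qed

lemma eigenvalue_modulus_antimono:
  assumes "A \<in> carrier_mat n n" "1 \<le> i" "i \<le> j" "j \<le> n"
  shows "eigenvalue_modulus A j \<le> eigenvalue_modulus A i"
proof -
  have "sorted_wrt (\<ge>) (eigenvalue_moduli A)"
    by (simp add: eigenvalue_moduli_def sorted_wrt_rev)
  then show ?thesis
    using assms length_eigenvalue_moduli[OF assms(1)]
    by (cases "i = j") (auto simp: eigenvalue_modulus_def sorted_wrt_iff_nth_less)
qed

lemma random_permutations_indep:
  "prob_space.indep_vars (measure_pmf (random_permutations n r))
     (\<lambda>_. count_space UNIV) (\<lambda>i \<sigma>. \<sigma> i) {..<r}"
  unfolding random_permutations_def by (rule indep_vars_Pi_pmf) simp

lemma random_permutations_uniform:
  "i < r \<Longrightarrow> map_pmf (\<lambda>\<sigma>. \<sigma> i) (random_permutations n r) = pmf_of_set {\<pi>. \<pi> permutes {..<n}}"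
  by (simp add: random_permutations_def Pi_pmf_component)

end

theory Submission
  imports Defs "Jordan_Normal_Form.Schur_Decomposition" "HOL-Computational_Algebra.Formal_Power_Series"
    "HOL-Real_Asymp.Real_Asymp"
begin

text \<open>
  The mean number of fixed points of a word in the random permutations and their inverses is a
  rational function of \<open>1 / n\<close>, which the polynomial method (Chen, Garza-Vargas, Tropp and van
  Handel) compares with its first order expansion. Let \<open>A = P\<^sup>l (P\<^sup>l)\<^sup>T\<close> with \<open>l\<close> of order
  \<open>ln n / ln r\<close>, and let \<open>H(y) = (1 - (1 - y)\<^sup>M)\<^sup>m\<close> with \<open>M\<close> the inverse of \<open>((1 + \<epsilon>) \<rho>)\<^sup>2\<^sup>l\<close>. This
  polynomial maps the unit interval to itself, is at least \<open>2\<^sup>-\<^sup>m\<close> beyond \<open>1 / M\<close>, and is tiny near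
  the origin. The mean of the trace of \<open>H(A)\<close> on the complement of the constants is \<open>n\<close> times a
  rational function of \<open>1 / n\<close> which is at most 1 in modulus at all large \<open>n\<close>, and whose degree is
  a small power of \<open>n\<close>. By Markov's inequality it is determined, up to a small error, by the two
  leading coefficients. These only see words that freely reduce to the empty word or to a conjugate
  of a proper power, and Haagerup's inequality bounds the weight of such words in the \<open>k\<close>-th power
  of \<open>A\<close> by \<open>((l + 1) \<rho>\<^sup>l)\<^sup>2\<^sup>k\<close> up to polynomial factors, so both coefficients are negligible.

  If \<open>r\<close> exceeds a power of \<open>n\<close>, or if \<open>n\<close> is bounded, then \<open>\<epsilon>\<close> is at least a large multiple of
  \<open>sqrt (ln n)\<close>. In this case the moment of order \<open>ln n\<close> of \<open>P P\<^sup>T\<close> suffices, because words in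
  which some permutation occurs exactly once do not contribute.
\<close>

text \<open>Haagerup's inequality charges a factor l + 1 for each run of l equal signs, not for each
  letter. A factor A therefore costs only (l + 1)^2, which (1 + eps)^(2 l) has to beat. On the other
  hand rho^2 >= 1 / r only gives M <= 2 r^l, so the degree is a small power of n only while l is at
  most a small multiple of ln n / ln r. For such l the product l eps is at least of order sqrt (ln
  n), and the quadratic term of the binomial expansion of (1 + eps)^l already beats l.

  The powers of n add up as follows. A polynomial of degree D in 1 / n has a Taylor remainder of
  order D^12 / n^2, the trace brings a factor n, and dividing by the lower bound 2^(-m) of the
  cutoff costs a small power of n. This leaves n^(-1 + delta) with delta = 1 - c0, whatever the
  exponents of D are, so crude forms of Markov's inequality and crude degree bounds are good enough.
  The dependence on r must not be crude: there may be far more permutations than letters in a word,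
  so the common denominator of the rational functions is arranged to depend on the word length
  alone.\<close>

section \<open>Words and free reduction\<close>

text \<open>The letter \<open>(i, True)\<close> stands for the \<open>i\<close>-th permutation, \<open>(i, False)\<close> for its inverse.\<close>

type_synonym letter = "nat \<times> bool"

definition linv :: "letter \<Rightarrow> letter" where
  "linv a = (fst a, \<not> snd a)"

lemma linv_linv [simp]: "linv (linv a) = a"
  by (simp add: linv_def)

lemma linv_neq [simp]: "linv a \<noteq> a" "a \<noteq> linv a"
  by (auto simp: linv_def prod_eq_iff)

lemma linv_eq_iff [simp]: "linv a = linv b \<longleftrightarrow> a = b"
  by (auto simp: linv_def prod_eq_iff)

lemma linv_eq_swap: "linv a = b \<longleftrightarrow> a = linv b"
  by (auto simp: linv_def prod_eq_iff)

definition inv_word :: "letter list \<Rightarrow> letter list" where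
  "inv_word w = rev (map linv w)"

lemma inv_word_inv_word [simp]: "inv_word (inv_word w) = w"
  by (simp add: inv_word_def rev_map comp_def)

lemma length_inv_word [simp]: "length (inv_word w) = length w"
  by (simp add: inv_word_def)

lemma inv_word_Nil [simp]: "inv_word [] = []"
  by (simp add: inv_word_def)

lemma inv_word_Cons: "inv_word (a # w) = inv_word w @ [linv a]"
  by (simp add: inv_word_def)

fun push :: "letter \<Rightarrow> letter list \<Rightarrow> letter list" where
  "push a [] = [a]"
| "push a (b # w) = (if b = linv a then w else a # b # w)"

definition red :: "letter list \<Rightarrow> letter list" where
  "red w = foldr push w []"

definition reduced :: "letter list \<Rightarrow> bool" where
  "reduced w \<longleftrightarrow> successively (\<lambda>a b. b \<noteq> linv a) w"

lemma red_Nil [simp]: "red [] = []"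
  by (simp add: red_def)

lemma red_Cons [simp]: "red (a # w) = push a (red w)"
  by (simp add: red_def)

lemma reduced_Nil [simp]: "reduced []"
  by (simp add: reduced_def)

lemma reduced_Cons: "reduced (a # w) \<longleftrightarrow> (w = [] \<or> (hd w \<noteq> linv a \<and> reduced w))"
  by (auto simp: reduced_def successively_Cons)

lemma reduced_push: "reduced w \<Longrightarrow> reduced (push a w)"
  by (cases w) (auto simp: reduced_Cons)

lemma reduced_red [simp]: "reduced (red w)"
  by (induction w) (auto intro: reduced_push)

lemma push_linv: "reduced w \<Longrightarrow> push (linv a) (push a w) = w"
  by (cases w; cases "tl w") (auto simp: reduced_Cons)

text \<open>Each \<open>push a\<close> permutes the reduced words, with inverse
  \<open>push (linv a)\<close>: the free group acts on its reduced words. A condition on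
  \<open>red (a # w)\<close> can thus be moved onto \<open>red w\<close>.\<close>

lemma push_eq_iff:
  assumes "reduced g" "reduced h"
  shows "push a h = g \<longleftrightarrow> h = push (linv a) g"
  using push_linv[OF assms(1), of "linv a"] push_linv[OF assms(2), of a] by auto

lemma length_red: "length (red w) \<le> length w"
proof (induction w)
  case (Cons a w)
  have "length (push a v) \<le> Suc (length v)" for v
    by (cases v) auto
  with Cons show ?case
    by (metis (no_types, lifting) Suc_le_mono le_trans length_Cons red_Cons)
qed simp

lemma set_red: "set (red w) \<subseteq> set w"
proof (induction w)
  case (Cons a w)
  have "set (push a v) \<subseteq> insert a (set v)" for v
    by (cases v) auto
  with Cons show ?case
    by fastforce
qed simp

text \<open>Reading a word from its last letter, \<^const>\<open>red\<close> operates a stack; the part of the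
  word read since the content of the stack was last \<open>z\<close> produces whatever lies above \<open>z\<close>.\<close>

lemma red_eq_appendE:
  assumes "red w = y @ z"
  obtains u v where "w = u @ v" "red u = y" "red v = z"
proof -
  have "\<exists>u v. w = u @ v \<and> red u = y \<and> red v = z"
    using assms
  proof (induction w arbitrary: y)
    case Nil
    then show ?case by auto
  next
    case (Cons a w)
    show ?case
    proof (cases y)
      case Nil
      then show ?thesis using Cons.prems by (intro exI[of _ "[]"] exI[of _ "a # w"]) auto
    next
      case (Cons a' y')
      have "reduced (red w)" "reduced (red (a # w))" by (simp_all del: red_Cons)
      \<comment> \<open>Undo the last push. If \<open>a\<close> is the top letter of
        \<open>y\<close>, this push put it there; otherwise the push cancelled a
        \<open>linv a\<close>, so the earlier stack held the longer \<open>linv a # y\<close> above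
        \<open>z\<close>. Hence the induction over arbitrary \<open>y\<close>.\<close>
      then have *: "red w = push (linv a) (y @ z)"
        using Cons.prems push_eq_iff[of "y @ z" "red w" a] by simp
      show ?thesis
      proof (cases "a' = a")
        case True
        then have "red w = y' @ z" using * local.Cons by simp
        from Cons.IH[OF this] obtain u v where uv: "w = u @ v" "red u = y'" "red v = z" by auto
        have "reduced (y @ z)"
          using Cons.prems reduced_red by metis
        then have "push a y' = y"
          using local.Cons True by (cases y') (auto simp: reduced_Cons)
        then show ?thesis using uv
          by (intro exI[of _ "a # u"] exI[of _ v]) auto
      next
        case False
        then have "red w = (linv a # y) @ z" using * local.Cons by simp
        from Cons.IH[OF this] obtain u v where uv: "w = u @ v" "red u = linv a # y" "red v = z" by auto
        then show ?thesis
          by (intro exI[of _ "a # u"] exI[of _ v]) auto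
      qed
    qed
  qed
  then show ?thesis using that by blast
qed

text \<open>The equation is between lists, not just in the free group, so the reduced word can be
  cut literally into \<open>y\<close>, one copy of \<open>v\<close>, the remaining copies and the
  inverse of \<open>y\<close>. Conjugates of proper powers are the nontrivial words whose closed
  walks can wind several times around one cycle.\<close>

definition power_like :: "letter list \<Rightarrow> bool" where
  "power_like w \<longleftrightarrow> red w = [] \<or>
    (\<exists>y v k. v \<noteq> [] \<and> 2 \<le> k \<and> red w = y @ concat (replicate k v) @ inv_word y)"

lemma length_concat_replicate [simp]: "length (concat (replicate k v)) = k * length v"
  by (induction k) auto

text \<open>Uniqueness of roots, needed to apply the Cauchy--Schwarz bound
  \<open>wsum_wsum_red_le\<close> to \<open>v\<close> and its power.\<close>

lemma inj_concat_replicate: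
  assumes "0 < k"
  shows "inj_on (\<lambda>v. concat (replicate k v)) V"
proof (rule inj_onI)
  fix v w :: "'a list"
  assume *: "concat (replicate k v) = concat (replicate k w)"
  then have "k * length v = k * length w"
    using length_concat_replicate by metis
  then have "length v = length w" using assms by simp
  moreover obtain k' where "k = Suc k'" using assms by (cases k) auto
  ultimately show "v = w" using * by simp
qed

text \<open>The expectation of \<open>F\<close> over the words with sign pattern \<open>s\<close> whose indices are
  independent and distributed according to \<open>p\<close>.\<close>

fun wsum :: "(nat \<Rightarrow> real) \<Rightarrow> nat \<Rightarrow> bool list \<Rightarrow> (letter list \<Rightarrow> real) \<Rightarrow> real" where
  "wsum p r [] F = F []"
| "wsum p r (b # s) F = (\<Sum>i<r. p i * wsum p r s (\<lambda>w. F ((i, b) # w)))"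

definition words :: "nat \<Rightarrow> bool list \<Rightarrow> letter list set" where
  "words r s = {w. map snd w = s \<and> fst ` set w \<subseteq> {..<r}}"

lemma words_Cons: "(i, b) # w \<in> words r (b # s) \<longleftrightarrow> i < r \<and> w \<in> words r s"
  by (auto simp: words_def)

lemma length_words: "w \<in> words r s \<Longrightarrow> length w = length s"
  by (auto simp: words_def)

lemma wsum_cong:
  "(\<And>w. w \<in> words r s \<Longrightarrow> F w = G w) \<Longrightarrow> wsum p r s F = wsum p r s G"
proof (induction s arbitrary: F G)
  case (Cons b s)
  have "wsum p r s (\<lambda>w. F ((i, b) # w)) = wsum p r s (\<lambda>w. G ((i, b) # w))" if "i < r" for i
    by (rule Cons.IH) (simp add: Cons.prems words_Cons that)
  then show ?case by simp
qed (simp add: words_def)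

lemma wsum_append: "wsum p r (s @ t) F = wsum p r s (\<lambda>v. wsum p r t (\<lambda>w. F (v @ w)))"
  by (induction s arbitrary: F) auto

lemma wsum_add: "wsum p r s (\<lambda>w. F w + G w) = wsum p r s F + wsum p r s G"
  by (induction s arbitrary: F G) (auto simp: sum.distrib algebra_simps)

lemma wsum_cmult: "wsum p r s (\<lambda>w. c * F w) = c * wsum p r s F"
  by (induction s arbitrary: F) (auto simp: sum_distrib_left algebra_simps)

lemma wsum_cmult_right: "wsum p r s (\<lambda>w. F w * c) = wsum p r s F * c"
  using wsum_cmult[of p r s c F] by (simp add: mult.commute)

lemma wsum_diff: "wsum p r s (\<lambda>w. F w - G w) = wsum p r s F - wsum p r s G"
  using wsum_add[of p r s F "\<lambda>w. - 1 * G w"] wsum_cmult[of p r s "- 1" G] by simp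

lemma wsum_zero [simp]: "wsum p r s (\<lambda>w. 0) = 0"
  by (induction s) auto

lemma wsum_sum: "wsum p r s (\<lambda>w. \<Sum>x\<in>A. F x w) = (\<Sum>x\<in>A. wsum p r s (F x))"
  by (induction A rule: infinite_finite_induct) (auto simp: wsum_add)

lemma wsum_divide: "wsum p r s (\<lambda>w. F w / c) = wsum p r s F / c"
  using wsum_cmult_right[of p r s F "1 / c"] by simp

locale weights =
  fixes p :: "nat \<Rightarrow> real" and r :: nat
  assumes probability_vector: "probability_vector r p"
begin

abbreviation second_modulus :: "nat \<Rightarrow> (nat \<Rightarrow> nat \<Rightarrow> nat) \<Rightarrow> real" where
  "second_modulus n \<sigma> \<equiv> eigenvalue_modulus (weighted_permutation_matrix n r p \<sigma>) 2"

abbreviation tail_prob :: "nat \<Rightarrow> real \<Rightarrow> real" where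
  "tail_prob n \<beta> \<equiv> measure_pmf.prob (random_permutations n r) {\<sigma>. \<beta> \<le> second_modulus n \<sigma>}"

lemma p_nonneg: "i < r \<Longrightarrow> 0 \<le> p i"
  using probability_vector by (simp add: probability_vector_def)

lemma sum_p: "(\<Sum>i<r. p i) = 1"
  using probability_vector by (simp add: probability_vector_def)

lemma wsum_mono:
  "(\<And>w. w \<in> words r s \<Longrightarrow> F w \<le> G w) \<Longrightarrow> wsum p r s F \<le> wsum p r s G"
proof (induction s arbitrary: F G)
  case (Cons b s)
  then show ?case
    by (auto intro!: sum_mono mult_left_mono Cons.IH simp: words_Cons p_nonneg)
qed (simp add: words_def)

lemma wsum_nonneg: "(\<And>w. w \<in> words r s \<Longrightarrow> 0 \<le> F w) \<Longrightarrow> 0 \<le> wsum p r s F"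
  using wsum_mono[of s "\<lambda>_. 0" F] by simp

lemma wsum_abs_le: "\<bar>wsum p r s F\<bar> \<le> wsum p r s (\<lambda>w. \<bar>F w\<bar>)"
proof -
  have "wsum p r s F \<le> wsum p r s (\<lambda>w. \<bar>F w\<bar>)" by (intro wsum_mono) auto
  moreover have "wsum p r s (\<lambda>w. (- 1) * F w) \<le> wsum p r s (\<lambda>w. \<bar>F w\<bar>)"
    by (intro wsum_mono) auto
  ultimately show ?thesis unfolding wsum_cmult by linarith
qed

lemma wsum_const [simp]: "wsum p r s (\<lambda>w. c) = c"
proof (induction s)
  case (Cons b s)
  then show ?case by (simp add: sum_distrib_right[symmetric] sum_p)
qed simp

definition \<rho> :: real where
  "\<rho> = sqrt (\<Sum>i<r. (p i)\<^sup>2)"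

lemma rho_nonneg: "0 \<le> \<rho>"
  unfolding \<rho>_def by (simp add: sum_nonneg)

lemma rho_sq: "\<rho>\<^sup>2 = (\<Sum>i<r. (p i)\<^sup>2)"
  by (simp add: \<rho>_def sum_nonneg)

lemma r_pos: "0 < r"
  using sum_p by (cases r) auto

lemma rho_sq_ge: "1 / real r \<le> \<rho>\<^sup>2"
proof -
  have "(\<Sum>i<r. p i * 1)\<^sup>2 \<le> (\<Sum>i<r. (p i)\<^sup>2) * (\<Sum>i<r. 1\<^sup>2)"
    by (rule Cauchy_Schwarz_ineq_sum)
  then show ?thesis using r_pos by (simp add: sum_p rho_sq field_simps)
qed

lemma rho_pos: "0 < \<rho>"
proof (rule ccontr)
  assume "\<not> 0 < \<rho>"
  then have "\<rho> = 0" using rho_nonneg by simp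
  then show False using rho_sq_ge r_pos by simp
qed

subsection \<open>The convolution operators on the free group\<close>

definition word_ball :: "nat \<Rightarrow> letter list set" where
  "word_ball K = {w. set w \<subseteq> {..<r} \<times> UNIV \<and> length w \<le> K}"

lemma finite_word_ball [simp]: "finite (word_ball K)"
  unfolding word_ball_def by (rule finite_lists_length_le) auto

text \<open>Cutting off at length \<open>K\<close> keeps all sums finite. The radius grows whenever
  a function is evaluated at a longer word, which is harmless because the final bound
  \<open>nrm_red_weight\<close> does not depend on it.\<close>

definition nrm :: "nat \<Rightarrow> (letter list \<Rightarrow> real) \<Rightarrow> real" where
  "nrm K f = L2_set f (word_ball K)"

lemma nrm_nonneg: "0 \<le> nrm K f"
  by (simp add: nrm_def)

lemma nrm_sq: "(nrm K f)\<^sup>2 = (\<Sum>w\<in>word_ball K. (f w)\<^sup>2)"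
  by (simp add: nrm_def L2_set_def sum_nonneg)

lemma nrm_add: "nrm K (\<lambda>w. f w + g w) \<le> nrm K f + nrm K g"
  unfolding nrm_def by (rule L2_set_triangle_ineq)

text \<open>Left multiplication by a random letter either cancels the first letter or becomes a new
  first letter; these are the annihilation and creation operators of the free Fock space.
  \<open>annihilate\<close> need not test whether the longer word is reduced, since
  \<open>red_weight\<close> vanishes where it is not.\<close>

definition annihilate :: "bool \<Rightarrow> (letter list \<Rightarrow> real) \<Rightarrow> letter list \<Rightarrow> real" where
  "annihilate b f g = (\<Sum>i<r. p i * f ((i, \<not> b) # g))"

definition create :: "bool \<Rightarrow> (letter list \<Rightarrow> real) \<Rightarrow> letter list \<Rightarrow> real" where
  "create b f g = (if reduced g \<and> g \<noteq> [] \<and> snd (hd g) = b \<and> fst (hd g) < r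
     then p (fst (hd g)) * f (tl g) else 0)"

definition convolve :: "bool \<Rightarrow> (letter list \<Rightarrow> real) \<Rightarrow> letter list \<Rightarrow> real" where
  "convolve b f g = create b f g + annihilate b f g"

lemma nrm_annihilate: "nrm K (annihilate b f) \<le> \<rho> * nrm (Suc K) f"
proof (rule power2_le_imp_le)
  have "(nrm K (annihilate b f))\<^sup>2 \<le> (\<Sum>g\<in>word_ball K. \<rho>\<^sup>2 * (\<Sum>i<r. (f ((i, \<not> b) # g))\<^sup>2))"
    unfolding nrm_sq annihilate_def rho_sq by (intro sum_mono Cauchy_Schwarz_ineq_sum)
  also have "\<dots> = \<rho>\<^sup>2 * (\<Sum>x\<in>word_ball K \<times> {..<r}. (f ((snd x, \<not> b) # fst x))\<^sup>2)"
    by (simp add: sum_distrib_left sum.cartesian_product case_prod_unfold)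
  also have "(\<Sum>x\<in>word_ball K \<times> {..<r}. (f ((snd x, \<not> b) # fst x))\<^sup>2)
      = (\<Sum>w\<in>(\<lambda>x. (snd x, \<not> b) # fst x) ` (word_ball K \<times> {..<r}). (f w)\<^sup>2)"
    by (subst sum.reindex) (auto simp: inj_on_def)
  also have "\<dots> \<le> (\<Sum>w\<in>word_ball (Suc K). (f w)\<^sup>2)"
    by (intro sum_mono2 finite_word_ball) (auto simp: word_ball_def)
  finally show "(nrm K (annihilate b f))\<^sup>2 \<le> (\<rho> * nrm (Suc K) f)\<^sup>2"
    by (simp add: power_mult_distrib nrm_sq mult_left_mono)
qed (simp add: rho_nonneg nrm_nonneg)

lemma nrm_create: "nrm K (create b f) \<le> \<rho> * nrm K f"
proof (rule power2_le_imp_le)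
  let ?cons = "\<lambda>x. (fst x, b) # snd x"
  have "(nrm K (create b f))\<^sup>2 = (\<Sum>g\<in>word_ball K \<inter> ?cons ` ({..<r} \<times> word_ball K). (create b f g)\<^sup>2)"
    unfolding nrm_sq
  proof (rule sum.mono_neutral_right)
    show "\<forall>g\<in>word_ball K - word_ball K \<inter> ?cons ` ({..<r} \<times> word_ball K). (create b f g)\<^sup>2 = 0"
    proof
      fix g assume g: "g \<in> word_ball K - word_ball K \<inter> ?cons ` ({..<r} \<times> word_ball K)"
      show "(create b f g)\<^sup>2 = 0"
      proof (rule ccontr)
        assume "(create b f g)\<^sup>2 \<noteq> 0"
        then have "g \<noteq> []" "snd (hd g) = b" "fst (hd g) < r"
          by (auto simp: create_def split: if_splits)
        then have "g = ?cons (fst (hd g), tl g)" "(fst (hd g), tl g) \<in> {..<r} \<times> word_ball K"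
          using g by (cases g; force simp: word_ball_def)+
        then have "g \<in> ?cons ` ({..<r} \<times> word_ball K)" by blast
        then show False using g by blast
      qed
    qed
  qed auto
  also have "\<dots> \<le> (\<Sum>g\<in>?cons ` ({..<r} \<times> word_ball K). (create b f g)\<^sup>2)"
    by (rule sum_mono2) auto
  also have "\<dots> = (\<Sum>x\<in>{..<r} \<times> word_ball K. (create b f (?cons x))\<^sup>2)"
    by (subst sum.reindex) (auto simp: inj_on_def)
  also have "\<dots> \<le> (\<Sum>x\<in>{..<r} \<times> word_ball K. (p (fst x))\<^sup>2 * (f (snd x))\<^sup>2)"
    by (intro sum_mono) (auto simp: create_def power_mult_distrib)
  also have "\<dots> = \<rho>\<^sup>2 * (nrm K f)\<^sup>2"
    unfolding rho_sq nrm_sq sum_product by (simp add: sum.cartesian_product case_prod_unfold)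
  finally show "(nrm K (create b f))\<^sup>2 \<le> (\<rho> * nrm K f)\<^sup>2"
    by (simp add: power_mult_distrib)
qed (simp add: rho_nonneg nrm_nonneg)

text \<open>\<open>create b\<close> is supported on words starting with sign \<open>b\<close>, while
  \<open>annihilate b\<close> evaluates at words starting with the opposite sign. This is why runs
  of a single sign are treated together.\<close>

lemma annihilate_create: "annihilate b (create b f) = (\<lambda>_. 0)"
  by (auto simp: annihilate_def create_def fun_eq_iff)

lemma annihilate_add: "annihilate b (\<lambda>g. f g + h g) g = annihilate b f g + annihilate b h g"
  by (simp add: annihilate_def sum.distrib algebra_simps)

lemma annihilate_convolve_pow:
  "annihilate b ((convolve b ^^ j) f) = (annihilate b ^^ Suc j) f"
proof (induction j)
  case (Suc j)
  have "annihilate b ((convolve b ^^ Suc j) f)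
      = annihilate b (\<lambda>g. create b ((convolve b ^^ j) f) g + annihilate b ((convolve b ^^ j) f) g)"
    by (simp add: convolve_def[abs_def])
  also have "\<dots> = annihilate b (annihilate b ((convolve b ^^ j) f))"
    by (rule ext) (simp only: annihilate_add annihilate_create; simp)
  finally show ?case using Suc by simp
qed simp

lemma nrm_annihilate_pow: "nrm K ((annihilate b ^^ j) f) \<le> \<rho> ^ j * nrm (K + j) f"
proof (induction j arbitrary: K)
  case (Suc j)
  have "nrm K ((annihilate b ^^ Suc j) f) \<le> \<rho> * nrm (Suc K) ((annihilate b ^^ j) f)"
    by (simp add: nrm_annihilate)
  also have "\<dots> \<le> \<rho> * (\<rho> ^ j * nrm (Suc K + j) f)"
    by (intro mult_left_mono Suc rho_nonneg)
  finally show ?case by simp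
qed simp

lemma nrm_mono: "K \<le> L \<Longrightarrow> nrm K f \<le> nrm L f"
  unfolding nrm_def L2_set_def
  by (intro real_sqrt_le_mono sum_mono2 finite_word_ball) (auto simp: word_ball_def)

text \<open>Haagerup's inequality for homogeneous positive words. As \<^const>\<open>create\<close> followed by
  \<^const>\<open>annihilate\<close> vanishes, only \<open>j + 1\<close> of the \<open>2\<^sup>j\<close> terms of the power survive.\<close>

lemma nrm_convolve_pow:
  "nrm K ((convolve b ^^ j) f) \<le> real (Suc j) * \<rho> ^ j * nrm (K + j) f"
proof (induction j)
  case (Suc j)
  have "nrm K ((convolve b ^^ Suc j) f)
      = nrm K (\<lambda>g. create b ((convolve b ^^ j) f) g + (annihilate b ^^ Suc j) f g)"
    unfolding annihilate_convolve_pow[symmetric] by (simp add: convolve_def[abs_def])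
  also have "\<dots> \<le> nrm K (create b ((convolve b ^^ j) f)) + nrm K ((annihilate b ^^ Suc j) f)"
    by (rule nrm_add)
  also have "\<dots> \<le> \<rho> * nrm K ((convolve b ^^ j) f) + \<rho> ^ Suc j * nrm (K + Suc j) f"
    by (intro add_mono nrm_create nrm_annihilate_pow)
  also have "\<dots> \<le> \<rho> * (real (Suc j) * \<rho> ^ j * nrm (K + Suc j) f) + \<rho> ^ Suc j * nrm (K + Suc j) f"
    using rho_nonneg nrm_mono[of "K + j" "K + Suc j" f]
    by (intro add_mono mult_left_mono order_trans[OF Suc]) auto
  also have "\<dots> = real (Suc (Suc j)) * \<rho> ^ Suc j * nrm (K + Suc j) f"
    by (simp add: algebra_simps)
  finally show ?case .
qed simp

section \<open>The distribution of the reduced form of a random word\<close>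

definition red_weight :: "bool list \<Rightarrow> letter list \<Rightarrow> real" where
  "red_weight s g = wsum p r s (\<lambda>w. of_bool (red w = g))"

lemma red_weight_not_reduced: "\<not> reduced g \<Longrightarrow> red_weight s g = 0"
proof -
  assume "\<not> reduced g"
  then have "(\<lambda>w. of_bool (red w = g)) = (\<lambda>w. 0 :: real)"
    using reduced_red by (auto simp: fun_eq_iff)
  then show ?thesis by (simp add: red_weight_def)
qed

text \<open>By \<open>push_eq_iff\<close> the new weight at \<open>g\<close> is a mean of old
  weights at \<open>push (i, \<not> b) g\<close>. This push prepends a letter, giving
  \<open>annihilate\<close>, except for the single index that heads \<open>g\<close> with sign
  \<open>b\<close>, where it pops and gives \<open>create\<close>.\<close>

lemma red_weight_Cons: "red_weight (b # s) = convolve b (red_weight s)"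
proof
  fix g
  show "red_weight (b # s) g = convolve b (red_weight s) g"
  proof (cases "reduced g")
    case False
    then have "\<not> reduced (a # g)" for a by (auto simp: reduced_Cons)
    with False show ?thesis
      by (simp add: red_weight_not_reduced convolve_def create_def annihilate_def)
  next
    case True
    have *: "red_weight (b # s) g = (\<Sum>i<r. p i * red_weight s (push (i, \<not> b) g))"
      unfolding red_weight_def by (simp add: push_eq_iff True linv_def)
    show ?thesis
    proof (cases "g \<noteq> [] \<and> snd (hd g) = b \<and> fst (hd g) < r")
      case False
      then have "push (i, \<not> b) g = (i, \<not> b) # g" if "i < r" for i
        using that by (cases g) (auto simp: linv_def)
      with False show ?thesis
        by (auto simp: * convolve_def create_def annihilate_def)
    next
      case True': True
      then obtain i g' where g: "g = (i, b) # g'" and i: "i < r"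
        by (cases g) auto
      \<comment> \<open>\<open>annihilate\<close> sums over all indices, including the one that
        belongs to \<open>create\<close>; its term there is taken at a word that is not reduced, and
        so is 0.\<close>
      have "\<not> reduced ((i, \<not> b) # g)" by (simp add: g reduced_Cons linv_def)
      then have 0: "red_weight s ((i, \<not> b) # g) = 0" by (rule red_weight_not_reduced)
      have "annihilate b (red_weight s) g
          = (\<Sum>j\<in>{..<r}. p j * red_weight s ((j, \<not> b) # g))"
        by (simp add: annihilate_def)
      also have "\<dots> = (\<Sum>j\<in>{..<r} - {i}. p j * red_weight s ((j, \<not> b) # g))"
        using i 0 by (subst sum.remove[of _ i]) auto
      also have "\<dots> = (\<Sum>j\<in>{..<r} - {i}. p j * red_weight s (push (j, \<not> b) g))"
        by (intro sum.cong) (auto simp: g linv_def)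
      finally have "annihilate b (red_weight s) g
        = (\<Sum>j\<in>{..<r} - {i}. p j * red_weight s (push (j, \<not> b) g))" .
      moreover have "create b (red_weight s) g = p i * red_weight s (push (i, \<not> b) g)"
        using True i by (simp add: create_def g linv_def)
      ultimately show ?thesis
        unfolding * convolve_def using i by (subst sum.remove[of _ i]) auto
    qed
  qed
qed

lemma red_weight_replicate: "red_weight (replicate j b @ s) = (convolve b ^^ j) (red_weight s)"
  by (induction j) (auto simp: red_weight_Cons)

section \<open>Haagerup's inequality for words made of runs\<close>

text \<open>Runs may be empty and neighbouring runs may have the same sign, so a cut at any place
  costs exactly one more run.\<close>

inductive runs :: "nat \<Rightarrow> nat \<Rightarrow> bool list \<Rightarrow> bool" for l where
  Nil: "runs l 0 []"
| append: "runs l k s \<Longrightarrow> j \<le> l \<Longrightarrow> runs l (Suc k) (replicate j b @ s)"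

text \<open>Each run contributes its own factor \<open>Suc l\<close>, irrespective of its exact
  length. For the pattern of the k-th power of A there are only 2 k runs, although the word has 2 l
  k letters.\<close>

lemma nrm_red_weight: "runs l k s \<Longrightarrow> nrm K (red_weight s) \<le> real (Suc l) ^ k * \<rho> ^ length s"
proof (induction arbitrary: K rule: runs.induct)
  case Nil
  have "nrm K (red_weight []) ^ 2 = (\<Sum>w\<in>word_ball K. of_bool (w = []))"
    unfolding nrm_sq by (intro sum.cong) (auto simp: red_weight_def)
  also have "\<dots> = 1"
    by (subst sum.remove[of _ "[]"]) (auto simp: word_ball_def[abs_def] intro: finite_word_ball[unfolded word_ball_def])
  finally show ?case using nrm_nonneg[of K "red_weight []"] by (simp add: power2_eq_1_iff)
next
  case (append k s j b)
  have "nrm K (red_weight (replicate j b @ s)) \<le> real (Suc j) * \<rho> ^ j * nrm (K + j) (red_weight s)"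
    unfolding red_weight_replicate by (rule nrm_convolve_pow)
  also have "\<dots> \<le> real (Suc l) * \<rho> ^ j * (real (Suc l) ^ k * \<rho> ^ length s)"
    using append rho_nonneg nrm_nonneg by (intro mult_mono) auto
  finally show ?case by (simp add: power_add algebra_simps)
qed

lemma runs_append_split:
  "runs l k (s @ t) \<Longrightarrow> \<exists>i j. i + j = Suc k \<and> runs l i s \<and> runs l j t"
proof (induction "s @ t" arbitrary: s t rule: runs.induct)
  case Nil
  \<comment> \<open>An empty run brings the total to exactly \<open>Suc k\<close>, even when the cut
    divides no run.\<close>
  have "runs l (Suc 0) (replicate 0 True @ [])" by (intro runs.intros) auto
  then show ?case using Nil runs.Nil[of l] by (intro exI[of _ 0] exI[of _ "Suc 0"]) auto
next
  case (append k u j b s)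
  show ?case
  proof (cases "length s \<le> j")
    case True
    have "s = take (length s) (replicate j b @ u)" and "t = drop (length s) (replicate j b @ u)"
      using append.hyps(4) by simp_all
    then have s: "s = replicate (length s) b" and t: "t = replicate (j - length s) b @ u"
      using True by (simp_all add: min_def)
    have "runs l (Suc 0) (replicate (length s) b @ [])"
      using True append.hyps(3) by (intro runs.intros) auto
    moreover have "runs l (Suc k) t"
      unfolding t using append.hyps by (intro runs.intros) auto
    ultimately show ?thesis using s by (intro exI[of _ "Suc 0"] exI[of _ "Suc k"]) auto
  next
    case False
    have "take j (s @ t) = replicate j b" "drop j (s @ t) = u"
      unfolding append.hyps(4)[symmetric] by simp_all
    with False have s: "s = replicate j b @ drop j s" "u = drop j s @ t"
      using append_take_drop_id[of j s] by simp_all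
    from append.hyps(2)[OF s(2)] obtain i i'
      where i: "i + i' = Suc k" "runs l i (drop j s)" "runs l i' t" by auto
    show ?thesis
      using i append.hyps(3) runs.append[OF i(2), of j b] s(1)
      by (intro exI[of _ "Suc i"] exI[of _ i']) simp
  qed
qed

lemma wsum_red_eq_sum:
  assumes "length s \<le> K"
  shows "wsum p r s (\<lambda>w. F (red w)) = (\<Sum>g\<in>word_ball K. red_weight s g * F g)"
proof -
  have "wsum p r s (\<lambda>w. F (red w)) = wsum p r s (\<lambda>w. \<Sum>g\<in>word_ball K. of_bool (red w = g) * F g)"
  proof (rule wsum_cong)
    fix w assume w: "w \<in> words r s"
    have "red w \<in> word_ball K"
    proof -
      have "fst a < r" if "a \<in> set (red w)" for a
        using that w set_red[of w] by (auto simp: words_def)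
      then show ?thesis
        using length_red[of w] length_words[OF w] assms by (auto simp: word_ball_def)
    qed
    then show "F (red w) = (\<Sum>g\<in>word_ball K. of_bool (red w = g) * F g)"
      by (subst sum.remove[of _ "red w"]) (auto intro!: sum.neutral)
  qed
  then show ?thesis
    by (simp only: wsum_sum wsum_cmult_right red_weight_def)
qed

lemma red_weight_nonneg: "0 \<le> red_weight s g"
  unfolding red_weight_def by (rule wsum_nonneg) auto

text \<open>The two words are independent, so the left side is the sum over \<open>g\<close> in
  \<open>V\<close> of the product of two weights. Cauchy--Schwarz separates them, and injectivity of
  \<open>\<phi>\<close> bounds the reindexed second sum by a full norm.\<close>

lemma wsum_wsum_red_le:
  assumes "inj_on \<phi> V" and "\<And>g. g \<in> V \<Longrightarrow> g \<in> word_ball (length s) \<Longrightarrow> \<phi> g \<in> word_ball L"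
  shows "wsum p r s (\<lambda>v. wsum p r t (\<lambda>w. of_bool (red v \<in> V \<and> red w = \<phi> (red v))))
    \<le> nrm (length s) (red_weight s) * nrm L (red_weight t)"
proof -
  let ?K = "length s"
  have "wsum p r s (\<lambda>v. wsum p r t (\<lambda>w. of_bool (red v \<in> V \<and> red w = \<phi> (red v))))
      = wsum p r s (\<lambda>v. of_bool (red v \<in> V) * red_weight t (\<phi> (red v)))"
    unfolding red_weight_def by (rule wsum_cong) (simp add: of_bool_conj wsum_cmult)
  also have "\<dots> = (\<Sum>g\<in>word_ball ?K. red_weight s g * (of_bool (g \<in> V) * red_weight t (\<phi> g)))"
    using wsum_red_eq_sum[of s ?K "\<lambda>g. of_bool (g \<in> V) * red_weight t (\<phi> g)"] by simp
  also have "\<dots> \<le> nrm ?K (red_weight s) * L2_set (\<lambda>g. of_bool (g \<in> V) * red_weight t (\<phi> g)) (word_ball ?K)"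
    unfolding nrm_def by (rule order_trans[OF _ L2_set_mult_ineq]) (auto intro!: sum_mono simp: red_weight_nonneg)
  also have "L2_set (\<lambda>g. of_bool (g \<in> V) * red_weight t (\<phi> g)) (word_ball ?K) \<le> nrm L (red_weight t)"
    unfolding nrm_def L2_set_def
  proof (rule real_sqrt_le_mono)
    have "(\<Sum>g\<in>word_ball ?K. (of_bool (g \<in> V) * red_weight t (\<phi> g))\<^sup>2)
        = (\<Sum>g\<in>word_ball ?K \<inter> V. (red_weight t (\<phi> g))\<^sup>2)"
      by (rule sum.mono_neutral_cong_right) auto
    also have "\<dots> = (\<Sum>h\<in>\<phi> ` (word_ball ?K \<inter> V). (red_weight t h)\<^sup>2)"
      using assms(1) by (subst sum.reindex) (auto intro: inj_on_subset)
    also have "\<dots> \<le> (\<Sum>h\<in>word_ball L. (red_weight t h)\<^sup>2)"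
      using assms(2) by (intro sum_mono2) auto
    finally show "(\<Sum>g\<in>word_ball ?K. (of_bool (g \<in> V) * red_weight t (\<phi> g))\<^sup>2)
      \<le> (\<Sum>h\<in>word_ball L. (red_weight t h)\<^sup>2)" .
  qed
  finally show ?thesis by (simp add: mult_left_mono nrm_nonneg)
qed

section \<open>Words that reduce to conjugates of proper powers\<close>

definition splits :: "bool list \<Rightarrow> (nat \<times> nat \<times> nat) set" where
  "splits s = {(a, b, c). a + b + c \<le> length s}"

lemma finite_splits: "finite (splits s)"
  by (rule finite_subset[of _ "{..length s} \<times> {..length s} \<times> {..length s}"]) (auto simp: splits_def)

lemma card_splits: "card (splits s) \<le> Suc (length s) ^ 3"
proof -
  have "card (splits s) \<le> card ({..length s} \<times> {..length s} \<times> {..length s})"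
    by (intro card_mono) (auto simp: splits_def)
  then show ?thesis by (simp add: power3_eq_cube card_cartesian_product algebra_simps)
qed

text \<open>Fixing the cut positions and the exponent prepares a union bound. The exponent
  \<open>k\<close> belongs to the third block only; together with the second block the word contains
  the power \<open>Suc k\<close>.\<close>

definition proper_power_at :: "nat \<Rightarrow> nat \<Rightarrow> nat \<Rightarrow> nat \<Rightarrow> letter list \<Rightarrow> bool" where
  "proper_power_at a b c k w \<longleftrightarrow>
    (let w1 = take a w; w2 = take b (drop a w); w3 = take c (drop (a + b) w); w4 = drop (a + b + c) w
     in red w4 = inv_word (red w1) \<and> red w2 \<noteq> [] \<and> red w3 = concat (replicate k (red w2)))"

text \<open>Three applications of \<open>red_eq_appendE\<close> lift the cuts of the reduced word to
  cuts of the word itself. The exponent is at most the length because \<open>v\<close> has at least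
  one letter.\<close>

lemma power_like_imp_proper_power_at:
  assumes "power_like w" "red w \<noteq> []" "w \<in> words r s"
  shows "\<exists>(a, b, c)\<in>splits s. \<exists>k\<in>{1..length s}. proper_power_at a b c k w"
proof -
  obtain y v k where v: "v \<noteq> []" and k: "2 \<le> k"
    and w: "red w = y @ (concat (replicate k v) @ inv_word y)"
    using assms by (auto simp: power_like_def)
  obtain k' where k': "k = Suc k'" "1 \<le> k'" using k by (cases k) auto
  obtain w1 u1 where 1: "w = w1 @ u1" "red w1 = y" "red u1 = concat (replicate k v) @ inv_word y"
    using red_eq_appendE[OF w] by metis
  then have "red u1 = v @ (concat (replicate k' v) @ inv_word y)" using k' by simp
  then obtain w2 u2 where 2: "u1 = w2 @ u2" "red w2 = v" "red u2 = concat (replicate k' v) @ inv_word y"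
    using red_eq_appendE by metis
  obtain w3 w4 where 3: "u2 = w3 @ w4" "red w3 = concat (replicate k' v)" "red w4 = inv_word y"
    using red_eq_appendE[OF 2(3)] by metis
  have "proper_power_at (length w1) (length w2) (length w3) k' w"
    using 1 2 3 v by (simp add: proper_power_at_def)
  moreover have "(length w1, length w2, length w3) \<in> splits s"
    using 1 2 3 length_words[OF assms(3)] by (simp add: splits_def)
  moreover have "k' \<le> length s"
  proof -
    have "k' \<le> k' * length v" using v by (cases v) auto
    also have "\<dots> \<le> length w3" using 3(2) length_red[of w3] by simp
    also have "\<dots> \<le> length s" using 1 2 3 length_words[OF assms(3)] by simp
    finally show ?thesis .
  qed
  ultimately show ?thesis using k'(2) by force
qed

text \<open>The conditions couple block 1 with block 4 and block 2 with block 3, so the weight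
  factors into two independent pairs, each treated by Cauchy--Schwarz. The three cuts account for
  the \<open>m + 3\<close> runs.\<close>

lemma wsum_proper_power_at_le:
  assumes "runs l m s" "(a, b, c) \<in> splits s" "1 \<le> k"
  shows "wsum p r s (\<lambda>w. of_bool (proper_power_at a b c k w)) \<le> real (Suc l) ^ (m + 3) * \<rho> ^ length s"
proof -
  define s1 s2 s3 s4 where s_defs: "s1 = take a s" "s2 = take b (drop a s)"
    "s3 = take c (drop (a + b) s)" "s4 = drop (a + b + c) s"
  have s: "s = s1 @ s2 @ s3 @ s4"
    by (simp add: s_defs) (metis append_take_drop_id drop_drop add.commute)
  have len: "length s1 = a" "length s2 = b" "length s3 = c"
    using assms(2) by (auto simp: s_defs splits_def)
  from assms(1) s runs_append_split[of l m s1 "s2 @ s3 @ s4"] obtain i1 j1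
    where 1: "i1 + j1 = Suc m" "runs l i1 s1" "runs l j1 (s2 @ s3 @ s4)" by auto
  from runs_append_split[OF 1(3)] obtain i2 j2
    where 2: "i2 + j2 = Suc j1" "runs l i2 s2" "runs l j2 (s3 @ s4)" by auto
  from runs_append_split[OF 2(3)] obtain i3 i4
    where 3: "i3 + i4 = Suc j2" "runs l i3 s3" "runs l i4 s4" by auto
  let ?n = "\<lambda>i s. real (Suc l) ^ i * \<rho> ^ length s"
  have "wsum p r s (\<lambda>w. of_bool (proper_power_at a b c k w))
      = wsum p r s1 (\<lambda>w1. wsum p r s2 (\<lambda>w2. wsum p r s3 (\<lambda>w3. wsum p r s4 (\<lambda>w4.
          of_bool (proper_power_at a b c k (w1 @ w2 @ w3 @ w4))))))"
    unfolding s wsum_append ..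
  also have "\<dots> = wsum p r s1 (\<lambda>w1. wsum p r s2 (\<lambda>w2. wsum p r s3 (\<lambda>w3. wsum p r s4 (\<lambda>w4.
      of_bool (red w2 \<in> - {[]} \<and> red w3 = concat (replicate k (red w2)))
        * of_bool (red w1 \<in> UNIV \<and> red w4 = inv_word (red w1))))))"
    by (intro wsum_cong)
      (auto simp: proper_power_at_def Let_def len length_words of_bool_def)
  also have "\<dots> = wsum p r s2 (\<lambda>w2. wsum p r s3 (\<lambda>w3.
        of_bool (red w2 \<in> - {[]} \<and> red w3 = concat (replicate k (red w2)))))
      * wsum p r s1 (\<lambda>w1. wsum p r s4 (\<lambda>w4. of_bool (red w1 \<in> UNIV \<and> red w4 = inv_word (red w1))))"
    by (simp only: wsum_cmult wsum_cmult_right)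
  also have "\<dots> \<le> (nrm (length s2) (red_weight s2) * nrm (k * length s2) (red_weight s3))
      * (nrm (length s1) (red_weight s1) * nrm (length s1) (red_weight s4))"
  proof (intro mult_mono wsum_wsum_red_le wsum_nonneg)
    show "inj_on (\<lambda>v. concat (replicate k v)) (- {[]})"
      using assms(3) by (intro inj_concat_replicate) auto
    show "inj_on inv_word UNIV"
      by (rule inj_on_inverseI[where g = inv_word]) simp
    show "concat (replicate k v) \<in> word_ball (k * length s2)" if "v \<in> word_ball (length s2)" for v
      using that by (auto simp: word_ball_def)
    show "inv_word y \<in> word_ball (length s1)" if "y \<in> word_ball (length s1)" for y
      using that by (auto simp: word_ball_def inv_word_def linv_def)
  qed (simp_all add: nrm_nonneg)
  also have "\<dots> \<le> (?n i2 s2 * ?n i3 s3) * (?n i1 s1 * ?n i4 s4)"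
    using 1 2 3 by (intro mult_mono nrm_red_weight mult_nonneg_nonneg nrm_nonneg)
      (auto simp: rho_nonneg)
  also have "\<dots> = real (Suc l) ^ (i1 + i2 + i3 + i4) * \<rho> ^ length s"
    unfolding s by (simp add: power_add)
  also have "i1 + i2 + i3 + i4 = m + 3" using 1 2 3 by simp
  finally show ?thesis .
qed

text \<open>The letters of a word that freely reduces to \<open>y v\<^sup>k y\<inverse>\<close> split into four blocks
  reducing to \<open>y\<close>, \<open>v\<close>, \<open>v\<^sup>k\<^sup>-\<^sup>1\<close> and \<open>y\<inverse>\<close>, so the Cauchy--Schwarz inequality separates them.\<close>

lemma wsum_power_like_le:
  assumes "runs l m s"
  shows "wsum p r s (\<lambda>w. of_bool (power_like w)) \<le> real (length s + 2) ^ 4 * real (Suc l) ^ (m + 3) * \<rho> ^ length s"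
proof -
  let ?B = "real (Suc l) ^ (m + 3) * \<rho> ^ length s"
  have B0: "0 \<le> ?B" using rho_nonneg by simp
  have "wsum p r s (\<lambda>w. of_bool (power_like w))
      \<le> wsum p r s (\<lambda>w. of_bool (red w = []) +
          (\<Sum>x\<in>splits s \<times> {1..length s}. of_bool (proper_power_at (fst (fst x)) (fst (snd (fst x))) (snd (snd (fst x))) (snd x) w)))"
  proof (rule wsum_mono)
    fix w assume w: "w \<in> words r s"
    let ?P = "\<lambda>x. proper_power_at (fst (fst x)) (fst (snd (fst x))) (snd (snd (fst x))) (snd x) w"
    have fin: "finite (splits s \<times> {1..length s})" by (simp add: finite_splits)
    show "of_bool (power_like w) \<le> of_bool (red w = []) + (\<Sum>x\<in>splits s \<times> {1..length s}. of_bool (?P x) :: real)"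
    proof (cases "power_like w \<and> red w \<noteq> []")
      case True
      then obtain x where x: "x \<in> splits s \<times> {1..length s}" "?P x"
        using power_like_imp_proper_power_at[OF _ _ w] by force
      have "(of_bool (?P x) :: real) \<le> (\<Sum>x\<in>splits s \<times> {1..length s}. of_bool (?P x))"
        by (rule member_le_sum[OF x(1) _ fin]) auto
      then show ?thesis using x(2) True by simp
    next
      case False
      then have "of_bool (power_like w) \<le> (of_bool (red w = []) :: real)" by auto
      moreover have "0 \<le> (\<Sum>x\<in>splits s \<times> {1..length s}. of_bool (?P x) :: real)"
        by (rule sum_nonneg) auto
      ultimately show ?thesis by linarith
    qed
  qed
  also have "\<dots> = red_weight s [] + (\<Sum>x\<in>splits s \<times> {1..length s}.
      wsum p r s (\<lambda>w. of_bool (proper_power_at (fst (fst x)) (fst (snd (fst x))) (snd (snd (fst x))) (snd x) w)))"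
    unfolding wsum_add wsum_sum red_weight_def ..
  also have "\<dots> \<le> ?B + (\<Sum>x\<in>splits s \<times> {1..length s}. ?B)"
  proof (intro add_mono sum_mono wsum_proper_power_at_le[OF assms])
    have "(red_weight s [])\<^sup>2 \<le> (nrm 0 (red_weight s))\<^sup>2"
      unfolding nrm_sq by (rule member_le_sum) (auto simp: word_ball_def)
    then have "red_weight s [] \<le> nrm 0 (red_weight s)"
      by (rule power2_le_imp_le) (rule nrm_nonneg)
    also have "\<dots> \<le> real (Suc l) ^ m * \<rho> ^ length s" by (rule nrm_red_weight[OF assms])
    also have "\<dots> \<le> ?B" using rho_nonneg by (intro mult_right_mono power_increasing) auto
    finally show "red_weight s [] \<le> ?B" .
  qed auto
  also have "\<dots> = (1 + real (card (splits s)) * real (length s)) * ?B"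
    by (simp add: card_cartesian_product algebra_simps)
  also have "\<dots> \<le> (1 + real (Suc (length s) ^ 3) * real (length s)) * ?B"
    using of_nat_mono[OF card_splits[of s], where 'a = real]
    by (intro mult_right_mono add_left_mono B0) auto
  also have "\<dots> \<le> real (length s + 2) ^ 4 * ?B"
  proof (intro mult_right_mono B0)
    define x where "x = real (length s)"
    have "0 \<le> x" by (simp add: x_def)
    then show "1 + real (Suc (length s) ^ 3) * real (length s) \<le> real (length s + 2) ^ 4"
      unfolding of_nat_power of_nat_Suc of_nat_add x_def[symmetric]
      by (simp add: power4_eq_xxxx power3_eq_cube algebra_simps)
  qed
  finally show ?thesis by (simp add: mult.assoc)
qed

end

section \<open>Random permutations\<close>

definition Omega :: "nat \<Rightarrow> nat \<Rightarrow> (nat \<Rightarrow> nat \<Rightarrow> nat) set" where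
  "Omega n r = PiE_dflt {..<r} id (\<lambda>_. {\<pi>. \<pi> permutes {..<n}})"

lemma finite_Omega [simp]: "finite (Omega n r)"
  unfolding Omega_def by (intro finite_PiE_dflt) (auto intro: finite_permutations)

lemma card_Omega: "card (Omega n r) = fact n ^ r"
  unfolding Omega_def by (subst card_PiE_dflt) (auto simp: card_permutations intro: finite_permutations)

lemma random_permutations_eq: "random_permutations n r = pmf_of_set (Omega n r)"
  unfolding random_permutations_def Omega_def
  by (rule Pi_pmf_of_set) (auto intro: finite_permutations permutes_id)

lemma Omega_permutes: "\<sigma> \<in> Omega n r \<Longrightarrow> \<sigma> i permutes {..<n}"
  by (cases "i < r") (auto simp: Omega_def PiE_dflt_def permutes_id)

definition average :: "nat \<Rightarrow> nat \<Rightarrow> ((nat \<Rightarrow> nat \<Rightarrow> nat) \<Rightarrow> real) \<Rightarrow> real" where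
  "average n r f = (\<Sum>\<sigma>\<in>Omega n r. f \<sigma>) / real (card (Omega n r))"

lemma card_Omega_pos: "0 < card (Omega n r)"
  by (simp add: card_Omega)

lemma average_mono: "(\<And>\<sigma>. \<sigma> \<in> Omega n r \<Longrightarrow> f \<sigma> \<le> g \<sigma>) \<Longrightarrow> average n r f \<le> average n r g"
  unfolding average_def by (intro divide_right_mono sum_mono) auto

lemma average_const [simp]: "average n r (\<lambda>_. c) = c"
  using card_Omega_pos[of n r] by (auto simp: average_def)

lemma average_cong: "(\<And>\<sigma>. \<sigma> \<in> Omega n r \<Longrightarrow> f \<sigma> = g \<sigma>) \<Longrightarrow> average n r f = average n r g"
  unfolding average_def by (metis (mono_tags, lifting) sum.cong)

lemma average_cmult: "average n r (\<lambda>\<sigma>. c * f \<sigma>) = c * average n r f"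
  by (simp add: average_def sum_distrib_left)

lemma average_diff: "average n r (\<lambda>\<sigma>. f \<sigma> - g \<sigma>) = average n r f - average n r g"
  by (simp add: average_def sum_subtractf diff_divide_distrib)

lemma average_sum: "average n r (\<lambda>\<sigma>. \<Sum>x\<in>A. f x \<sigma>) = (\<Sum>x\<in>A. average n r (f x))"
  unfolding average_def by (subst sum.swap) (simp add: sum_divide_distrib)

lemma average_wsum:
  "average n r (\<lambda>\<sigma>. wsum p m s (F \<sigma>)) = wsum p m s (\<lambda>w. average n r (\<lambda>\<sigma>. F \<sigma> w))"
  by (induction s arbitrary: F) (simp_all add: average_sum average_cmult)

lemma prob_le_average:
  assumes "\<And>\<sigma>. \<sigma> \<in> Omega n r \<Longrightarrow> 0 \<le> f \<sigma>" "\<And>\<sigma>. \<sigma> \<in> Omega n r \<Longrightarrow> \<sigma> \<in> A \<Longrightarrow> c \<le> f \<sigma>" "0 < c"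
  shows "measure_pmf.prob (random_permutations n r) A \<le> average n r f / c"
proof -
  have ne: "Omega n r \<noteq> {}" using card_Omega_pos[of n r] by auto
  have "real (card (Omega n r \<inter> A)) * c = (\<Sum>\<sigma>\<in>Omega n r \<inter> A. c)" by simp
  also have "\<dots> \<le> (\<Sum>\<sigma>\<in>Omega n r \<inter> A. f \<sigma>)" using assms by (intro sum_mono) auto
  also have "\<dots> \<le> (\<Sum>\<sigma>\<in>Omega n r. f \<sigma>)" using assms by (intro sum_mono2) auto
  finally have "real (card (Omega n r \<inter> A)) \<le> (\<Sum>\<sigma>\<in>Omega n r. f \<sigma>) / c"
    using assms(3) by (simp add: field_simps)
  then have "real (card (Omega n r \<inter> A)) / card (Omega n r)
      \<le> (\<Sum>\<sigma>\<in>Omega n r. f \<sigma>) / c / card (Omega n r)"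
    by (rule divide_right_mono) simp
  then show ?thesis
    using ne by (simp add: random_permutations_eq measure_pmf_of_set average_def mult.commute)
qed

definition lperm :: "(nat \<Rightarrow> nat \<Rightarrow> nat) \<Rightarrow> letter \<Rightarrow> nat \<Rightarrow> nat" where
  "lperm \<sigma> a = (if snd a then \<sigma> (fst a) else inv_into UNIV (\<sigma> (fst a)))"

lemma lperm_permutes: "\<sigma> \<in> Omega n r \<Longrightarrow> lperm \<sigma> a permutes {..<n}"
  by (auto simp: lperm_def Omega_permutes permutes_inv)

lemma lperm_linv: "\<sigma> \<in> Omega n r \<Longrightarrow> lperm \<sigma> (linv a) (lperm \<sigma> a x) = x"
  using Omega_permutes[of \<sigma> n r "fst a"]
  by (auto simp: lperm_def linv_def permutes_inverses)

lemma lperm_linv': "\<sigma> \<in> Omega n r \<Longrightarrow> lperm \<sigma> a (lperm \<sigma> (linv a) x) = x"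
  using lperm_linv[of \<sigma> n r "linv a"] by simp

lemma fold_lperm_less: "\<sigma> \<in> Omega n r \<Longrightarrow> x < n \<Longrightarrow> fold (lperm \<sigma>) w x < n"
proof (induction w arbitrary: x)
  case (Cons a w)
  then show ?case using permutes_in_image[OF lperm_permutes[OF Cons.prems(1), of a], of x] by simp
qed simp

lemma fold_lperm_red: "\<sigma> \<in> Omega n r \<Longrightarrow> fold (lperm \<sigma>) (red w) = fold (lperm \<sigma>) w"
proof (induction w)
  case (Cons a w)
  have "fold (lperm \<sigma>) (push a v) = fold (lperm \<sigma>) (a # v)" for v
    by (cases v) (auto simp: fun_eq_iff lperm_linv[OF Cons.prems])
  with Cons show ?case by simp
qed simp

lemma fold_lperm_inv_word:
  "\<sigma> \<in> Omega n r \<Longrightarrow> fold (lperm \<sigma>) (inv_word w) (fold (lperm \<sigma>) w x) = x"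
  by (induction w arbitrary: x) (auto simp: inv_word_Cons lperm_linv)

definition fixed_points :: "nat \<Rightarrow> (nat \<Rightarrow> nat \<Rightarrow> nat) \<Rightarrow> letter list \<Rightarrow> real" where
  "fixed_points n \<sigma> w = real (card {x \<in> {..<n}. fold (lperm \<sigma>) w x = x})"

lemma fixed_points_red: "\<sigma> \<in> Omega n r \<Longrightarrow> fixed_points n \<sigma> (red w) = fixed_points n \<sigma> w"
  by (simp add: fixed_points_def fold_lperm_red)

lemma fixed_points_conjugate:
  assumes "\<sigma> \<in> Omega n r"
  shows "fixed_points n \<sigma> (y @ z @ inv_word y) = fixed_points n \<sigma> z"
proof -
  let ?f = "fold (lperm \<sigma>)"
  have inv1: "?f (inv_word y) (?f y x) = x" for x
    by (rule fold_lperm_inv_word[OF assms])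
  have inv2: "?f y (?f (inv_word y) x) = x" for x
    using fold_lperm_inv_word[OF assms, of "inv_word y"] by simp
  have "bij_betw (?f y) {x \<in> {..<n}. ?f (y @ z @ inv_word y) x = x} {x \<in> {..<n}. ?f z x = x}"
  proof (rule bij_betw_byWitness[where f' = "?f (inv_word y)"])
    show "?f y ` {x \<in> {..<n}. ?f (y @ z @ inv_word y) x = x} \<subseteq> {x \<in> {..<n}. ?f z x = x}"
      using fold_lperm_less[OF assms] by (auto simp: inv1) (metis inv2)
    show "?f (inv_word y) ` {x \<in> {..<n}. ?f z x = x} \<subseteq> {x \<in> {..<n}. ?f (y @ z @ inv_word y) x = x}"
      using fold_lperm_less[OF assms] by (auto simp: inv2)
  qed (auto simp: inv1 inv2)
  then show ?thesis unfolding fixed_points_def by (simp add: bij_betw_same_card)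
qed

definition cyclically_reduced :: "letter list \<Rightarrow> bool" where
  "cyclically_reduced z \<longleftrightarrow> z \<noteq> [] \<and> reduced z \<and> hd z \<noteq> linv (last z)"

lemma reduced_conjugate:
  assumes "reduced u" "u \<noteq> []"
  shows "\<exists>y z. u = y @ z @ inv_word y \<and> cyclically_reduced z"
  using assms
proof (induction "length u" arbitrary: u rule: less_induct)
  case less
  show ?case
  proof (cases "hd u = linv (last u)")
    case False
    then show ?thesis using less.prems
      by (intro exI[of _ "[]"] exI[of _ u]) (auto simp: cyclically_reduced_def)
  next
    case True
    obtain a t where u: "u = a # t" using less.prems by (cases u) auto
    have "t \<noteq> []" using True u by auto
    then obtain u' b where t: "t = u' @ [b]" by (cases t rule: rev_cases) auto
    have b: "b = linv a" using True u t by (auto simp: linv_eq_swap)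
    have red: "reduced t" using less.prems u by (auto simp: reduced_Cons)
    \<comment> \<open>Otherwise \<open>a\<close> and its inverse would be adjacent in a reduced
      word.\<close>
    have "u' \<noteq> []" using less.prems u t b by (auto simp: reduced_Cons)
    moreover have "reduced u'"
      using red unfolding t reduced_def by (auto simp: successively_append_iff)
    ultimately obtain y z where "u' = y @ z @ inv_word y" "cyclically_reduced z"
      using less.hyps[of u'] u t by auto
    then show ?thesis
      using u t b by (intro exI[of _ "a # y"] exI[of _ z]) (auto simp: inv_word_Cons)
  qed
qed

subsection \<open>Permutations extending a partial injection\<close>

definition partial_injection :: "('a \<times> 'a) set \<Rightarrow> bool" where
  "partial_injection C \<longleftrightarrow> single_valued C \<and> single_valued (C\<inverse>)"

lemma partial_injection_inj_on:
  assumes "partial_injection C"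
  shows "inj_on fst C" "inj_on snd C"
  using assms by (auto simp: partial_injection_def single_valued_def inj_on_def)

text \<open>One extension \<open>g\<close> of \<open>C\<close> is built from any bijection between
  the complements of domain and range. Composing with the inverse of \<open>g\<close> then
  identifies all extensions with the permutations that fix the domain of \<open>C\<close>
  pointwise.\<close>

lemma card_permutations_extending:
  assumes C: "C \<subseteq> S \<times> S" and S: "finite S"
  shows "card {\<pi>. \<pi> permutes S \<and> (\<forall>(a, b)\<in>C. \<pi> a = b)}
    = (if partial_injection C then fact (card S - card C) else 0)"
proof (cases "partial_injection C")
  case False
  have "partial_injection C" if "\<pi> permutes S" "\<forall>(a, b)\<in>C. \<pi> a = b" for \<pi>
  proof -
    have "\<pi> a = b" if "(a, b) \<in> C" for a b
      using that \<open>\<forall>(a, b)\<in>C. \<pi> a = b\<close> by auto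
    then show ?thesis
      using permutes_inj[OF \<open>\<pi> permutes S\<close>]
      unfolding partial_injection_def single_valued_def converse_iff by (metis injD)
  qed
  with False have "{\<pi>. \<pi> permutes S \<and> (\<forall>(a, b)\<in>C. \<pi> a = b)} = {}" by blast
  with False show ?thesis by (simp only: card.empty if_False)
next
  case True
  let ?D = "fst ` C" and ?R = "snd ` C"
  have fin: "finite C" "finite ?D" "finite ?R" using C S finite_subset[of C "S \<times> S"] by auto
  have cards: "card ?D = card C" "card ?R = card C"
    using partial_injection_inj_on[OF True] by (simp_all add: card_image)
  have sub: "?D \<subseteq> S" "?R \<subseteq> S" using C by auto
  have "card (S - ?D) = card (S - ?R)"
    using sub fin cards by (simp add: card_Diff_subset)
  then obtain h where h: "bij_betw h (S - ?D) (S - ?R)"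
    using S by (metis bij_betw_iff_card finite_Diff)
  define g where "g a = (if a \<in> ?D then (THE b. (a, b) \<in> C) else if a \<in> S then h a else a)" for a
  have g_C: "g a = b" if "(a, b) \<in> C" for a b
  proof -
    have "(THE b. (a, b) \<in> C) = b"
      by (rule the_equality) (use True that in \<open>auto simp: partial_injection_def single_valued_def\<close>)
    moreover have "a \<in> ?D" using that by force
    ultimately show ?thesis by (simp add: g_def)
  qed
  have "bij_betw g ?D ?R"
    unfolding bij_betw_def
  proof
    show "inj_on g ?D"
    proof (rule inj_onI)
      fix a a' assume "a \<in> ?D" "a' \<in> ?D" "g a = g a'"
      then obtain b b' where "(a, b) \<in> C" "(a', b') \<in> C" by auto
      moreover from this have "b' = b" using g_C[of a b] g_C[of a' b'] \<open>g a = g a'\<close> by simp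
      ultimately show "a = a'" using True by (auto simp: partial_injection_def single_valued_def)
    qed
    show "g ` ?D = ?R"
    proof
      show "g ` ?D \<subseteq> ?R" using g_C by force
      show "?R \<subseteq> g ` ?D"
      proof
        fix b assume "b \<in> ?R"
        then obtain a where "(a, b) \<in> C" by auto
        then show "b \<in> g ` ?D" using g_C[of a b] by (intro image_eqI[of _ _ a]) force+
      qed
    qed
  qed
  moreover have "bij_betw g (S - ?D) (S - ?R)"
    by (rule bij_betw_cong[THEN iffD1, OF _ h]) (auto simp: g_def)
  ultimately have "bij_betw g (?D \<union> (S - ?D)) (?R \<union> (S - ?R))"
    by (rule bij_betw_combine) auto
  then have "bij_betw g S S"
    using sub by (simp add: Un_absorb1)
  moreover have "g a = a" if "a \<notin> S" for a
    using that sub by (auto simp: g_def)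
  ultimately have g: "g permutes S" by (rule bij_imp_permutes)
  have g_inv: "inv_into UNIV g (g x) = x" "g (inv_into UNIV g x) = x" for x
    using permutes_inverses[OF g] by auto
  have "bij_betw (\<lambda>\<pi>. inv_into UNIV g \<circ> \<pi>) {\<pi>. \<pi> permutes S \<and> (\<forall>(a, b)\<in>C. \<pi> a = b)} {\<pi>. \<pi> permutes (S - ?D)}"
  proof (rule bij_betw_byWitness[where f' = "\<lambda>\<pi>. g \<circ> \<pi>"])
    show "(\<lambda>\<pi>. inv_into UNIV g \<circ> \<pi>) ` {\<pi>. \<pi> permutes S \<and> (\<forall>(a, b)\<in>C. \<pi> a = b)} \<subseteq> {\<pi>. \<pi> permutes (S - ?D)}"
    proof safe
      fix \<pi> assume \<pi>: "\<pi> permutes S" "\<forall>(a, b)\<in>C. \<pi> a = b"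
      have "inv_into UNIV g \<circ> \<pi> permutes S" by (intro permutes_compose \<pi> permutes_inv g)
      moreover have "(inv_into UNIV g \<circ> \<pi>) x = x" if "x \<in> S - (S - ?D)" for x
      proof -
        from that obtain b where b: "(x, b) \<in> C" by auto
        then have "\<pi> x = g x" using \<pi>(2) g_C[OF b] by auto
        then show ?thesis by (simp add: g_inv)
      qed
      ultimately show "inv_into UNIV g \<circ> \<pi> permutes (S - ?D)"
        by (rule permutes_superset)
    qed
    show "(\<lambda>\<pi>. g \<circ> \<pi>) ` {\<pi>. \<pi> permutes (S - ?D)} \<subseteq> {\<pi>. \<pi> permutes S \<and> (\<forall>(a, b)\<in>C. \<pi> a = b)}"
    proof safe
      fix \<pi> assume \<pi>: "\<pi> permutes (S - ?D)"
      show "g \<circ> \<pi> permutes S"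
        by (intro permutes_compose g permutes_subset[OF \<pi>]) auto
      fix a b assume ab: "(a, b) \<in> C"
      then have "\<pi> a = a" using \<pi> by (force simp: permutes_def)
      then show "(g \<circ> \<pi>) a = b" using g_C[OF ab] by simp
    qed
  qed (auto simp: g_inv fun_eq_iff)
  then have "card {\<pi>. \<pi> permutes S \<and> (\<forall>(a, b)\<in>C. \<pi> a = b)} = card {\<pi>. \<pi> permutes (S - ?D)}"
    by (rule bij_betw_same_card)
  also have "\<dots> = fact (card (S - ?D))"
    using S by (simp add: card_permutations)
  finally show ?thesis
    using True sub fin cards by (simp add: card_Diff_subset)
qed

section \<open>Closed walks without backtracking\<close>

locale cyclic_word =
  fixes z :: "letter list" and r :: nat
  assumes cyc: "cyclically_reduced z" and letters: "fst ` set z \<subseteq> {..<r}"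
begin

definition k :: nat where "k = length z"

definition Z :: "nat \<Rightarrow> letter" where "Z t = z ! (t mod k)"

text \<open>A closed walk is stored as its \<open>k\<close> positions. Reading times modulo
  \<open>k\<close> makes the closing step an ordinary step.\<close>

definition per :: "(nat \<Rightarrow> 'v) \<Rightarrow> nat \<Rightarrow> 'v" where "per x t = x (t mod k)"

lemma k_pos: "0 < k"
  using cyc by (simp add: k_def cyclically_reduced_def)

lemma Z_mod [simp]: "Z (t mod k) = Z t"
  by (simp add: Z_def)

lemma per_mod [simp]: "per x (t mod k) = per x t"
  by (simp add: per_def)

lemma Z_add [simp]: "Z (t + k) = Z t"
  by (simp add: Z_def)

lemma per_add [simp]: "per x (t + k) = per x t"
  by (simp add: per_def)

lemma Suc_mod_cong: "s mod k = t mod k \<Longrightarrow> Suc s mod k = Suc t mod k"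
  by (metis mod_Suc_eq)

lemma per_Suc_mod [simp]: "per x (Suc (t mod k)) = per x (Suc t)"
  by (simp add: per_def mod_Suc_eq)

lemma Z_Suc: "Z (Suc t) \<noteq> linv (Z t)"
proof (cases "Suc (t mod k) = k")
  case True
  then have "Suc t mod k = 0" by (simp add: mod_Suc)
  moreover have "t mod k = length z - 1" using True by (simp add: k_def)
  moreover have "hd z = z ! 0" "last z = z ! (length z - 1)"
    using cyc by (simp_all add: cyclically_reduced_def hd_conv_nth last_conv_nth)
  ultimately show ?thesis
    using cyc by (simp add: Z_def cyclically_reduced_def)
next
  case False
  then have "Suc t mod k = Suc (t mod k)" by (simp add: mod_Suc)
  moreover have "Suc (t mod k) < length z"
    using False k_pos by (metis Suc_lessI k_def mod_less_divisor)
  ultimately show ?thesis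
    using cyc by (simp add: Z_def cyclically_reduced_def reduced_def successively_conv_nth)
qed

lemma fst_Z_less: "fst (Z t) < r"
  using letters k_pos by (force simp: Z_def k_def)

section \<open>The graph of a closed walk\<close>

text \<open>These are the values that the walk prescribes for permutation \<open>i\<close>; a letter
  with sign \<open>False\<close> is traversed backwards. Being a set, it counts an edge once however
  often it is used.\<close>

definition edges :: "(nat \<Rightarrow> 'v) \<Rightarrow> nat \<Rightarrow> ('v \<times> 'v) set" where
  "edges x i = {(per x t, per x (Suc t)) | t. Z t = (i, True)}
    \<union> {(per x (Suc t), per x t) | t. Z t = (i, False)}"

definition consistent :: "(nat \<Rightarrow> 'v) \<Rightarrow> bool" where
  "consistent x \<longleftrightarrow> (\<forall>i. partial_injection (edges x i))"

definition num_edges :: "(nat \<Rightarrow> 'v) \<Rightarrow> nat" where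
  "num_edges x = (\<Sum>i<r. card (edges x i))"

definition vertices :: "(nat \<Rightarrow> 'v) \<Rightarrow> 'v set" where
  "vertices x = x ` {..<k}"

lemma finite_vertices [simp]: "finite (vertices x)"
  by (simp add: vertices_def)

lemma per_in_vertices [simp]: "per x t \<in> vertices x"
  using k_pos by (simp add: per_def vertices_def)

lemma vertices_eq: "vertices x = range (per x)"
proof
  show "vertices x \<subseteq> range (per x)"
  proof
    fix a assume "a \<in> vertices x"
    then obtain t where "t < k" "a = x t" by (auto simp: vertices_def)
    then have "a = per x t" by (simp add: per_def)
    then show "a \<in> range (per x)" by simp
  qed
qed auto

lemma edges_subset: "edges x i \<subseteq> vertices x \<times> vertices x"
  by (auto simp: edges_def)

lemma finite_edges [simp]: "finite (edges x i)"
  by (rule finite_subset[OF edges_subset]) simp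

text \<open>A half-edge is a vertex together with a letter along which it can be left; each edge
  consists of two of them.\<close>

definition half_edges :: "(nat \<Rightarrow> 'v) \<Rightarrow> ('v \<times> letter) set" where
  "half_edges x = {(per x t, Z t) | t. True} \<union> {(per x (Suc t), linv (Z t)) | t. True}"

lemma half_edges_iff:
  "(a, (i, True)) \<in> half_edges x \<longleftrightarrow> a \<in> fst ` edges x i"
  "(a, (i, False)) \<in> half_edges x \<longleftrightarrow> a \<in> snd ` edges x i"
proof -
  have "fst ` edges x i = {per x t | t. Z t = (i, True)} \<union> {per x (Suc t) | t. Z t = (i, False)}"
    "snd ` edges x i = {per x (Suc t) | t. Z t = (i, True)} \<union> {per x t | t. Z t = (i, False)}"
    unfolding edges_def image_Un by (auto simp: image_Collect)
  moreover have "(i, b) = linv (Z t) \<longleftrightarrow> Z t = (i, \<not> b)" for t b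
    by (auto simp: linv_def prod_eq_iff)
  ultimately show "(a, (i, True)) \<in> half_edges x \<longleftrightarrow> a \<in> fst ` edges x i"
    "(a, (i, False)) \<in> half_edges x \<longleftrightarrow> a \<in> snd ` edges x i"
    by (auto simp: half_edges_def eq_commute[of "(i, _)" "Z _"])
qed

lemma half_edges_fst_less: "(a, (i, b)) \<in> half_edges x \<Longrightarrow> i < r"
  using fst_Z_less unfolding half_edges_def linv_def by (auto simp: prod_eq_iff)

lemma finite_half_edges [simp]: "finite (half_edges x)"
proof (rule finite_subset)
  show "half_edges x \<subseteq> vertices x \<times> ({..<r} \<times> UNIV)"
    using half_edges_fst_less[of _ _ _ x] by (auto simp: half_edges_def linv_def fst_Z_less prod_eq_iff mem_Times_iff)
qed auto

lemma card_half_edges: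
  assumes "consistent x"
  shows "card (half_edges x) = 2 * num_edges x"
proof -
  define H where "H l = {a. (a, l) \<in> half_edges x}" for l
  have fin: "finite (H l)" for l
    unfolding H_def by (rule finite_subset[of _ "fst ` half_edges x"]) force+
  have "card (half_edges x) = card (prod.swap ` half_edges x)"
    by (rule card_image[symmetric]) simp
  also have "prod.swap ` half_edges x = Sigma ({..<r} \<times> UNIV) H"
    using half_edges_fst_less by (force simp: H_def)
  also have "card \<dots> = (\<Sum>l\<in>{..<r} \<times> UNIV. card (H l))"
    by (rule card_SigmaI) (auto simp: fin)
  also have "\<dots> = (\<Sum>i<r. card (H (i, True)) + card (H (i, False)))"
  proof -
    have "(\<Sum>l\<in>{..<r} \<times> UNIV. card (H l)) = (\<Sum>i<r. \<Sum>b\<in>UNIV. card (H (i, b)))"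
      by (simp add: sum.cartesian_product)
    then show ?thesis by (simp add: UNIV_bool add.commute)
  qed
  also have "\<dots> = (\<Sum>i<r. 2 * card (edges x i))"
  proof (rule sum.cong[OF refl])
    fix i
    have "H (i, True) = fst ` edges x i" "H (i, False) = snd ` edges x i"
      by (auto simp: H_def half_edges_iff)
    then show "card (H (i, True)) + card (H (i, False)) = 2 * card (edges x i)"
      using assms partial_injection_inj_on[of "edges x i"] by (simp add: card_image consistent_def)
  qed
  finally show ?thesis by (simp add: num_edges_def sum_distrib_left)
qed

lemma per_as_Suc: "\<exists>s. per x t = per x (Suc s) \<and> Z t = Z (Suc s)"
  using k_pos per_add[of x t] Z_add[of t] by (intro exI[of _ "t + k - 1"]) auto

lemma half_edges_at:
  "{Z (Suc t), linv (Z t)} \<subseteq> {l. (per x (Suc t), l) \<in> half_edges x}"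
  by (auto simp: half_edges_def)

lemma finite_half_edges_at [simp]: "finite {l. (a, l) \<in> half_edges x}"
  by (rule finite_subset[of _ "snd ` half_edges x"]) force+

text \<open>The walk arrives along one half-edge and leaves along another, and the two differ
  because it never backtracks, not even where the word closes up.\<close>

lemma card_half_edges_at:
  assumes "a \<in> vertices x"
  shows "2 \<le> card {l. (a, l) \<in> half_edges x}"
proof -
  obtain t0 where "a = per x t0"
    using assms by (auto simp: vertices_eq)
  then obtain t where "a = per x (Suc t)"
    using per_as_Suc[of x t0] by auto
  then show ?thesis
    using card_mono[OF finite_half_edges_at half_edges_at[of t x]] Z_Suc[of t] by simp
qed

lemma card_half_edges_vertices:
  "card (half_edges x) = (\<Sum>a\<in>vertices x. card {l. (a, l) \<in> half_edges x})"
proof -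
  have "half_edges x = Sigma (vertices x) (\<lambda>a. {l. (a, l) \<in> half_edges x})"
    by (auto simp: half_edges_def)
  then have "card (half_edges x) = card (Sigma (vertices x) (\<lambda>a. {l. (a, l) \<in> half_edges x}))"
    by simp
  then show ?thesis by (simp add: card_SigmaI)
qed

text \<open>Minimal degree two, summed over the vertices. Consequently a nontrivial word has no
  contribution of order n.\<close>

lemma card_vertices_le:
  assumes "consistent x"
  shows "card (vertices x) \<le> num_edges x"
proof -
  have "(\<Sum>a\<in>vertices x. 2) \<le> card (half_edges x)"
    unfolding card_half_edges_vertices by (intro sum_mono card_half_edges_at)
  then show ?thesis using card_half_edges[OF assms] by simp
qed

text \<open>In the equality case every vertex has degree two, so a closed walk without backtracking
  has no choice but to go round a cycle.\<close>

context
  fixes x :: "nat \<Rightarrow> 'v"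
  assumes cons: "consistent x" and unicyclic: "card (vertices x) = num_edges x"
begin

lemma half_edges_at_eq: "{l. (per x (Suc t), l) \<in> half_edges x} = {Z (Suc t), linv (Z t)}"
proof -
  have "card {l. (a, l) \<in> half_edges x} = 2" if "a \<in> vertices x" for a
  proof (rule ccontr)
    assume "card {l. (a, l) \<in> half_edges x} \<noteq> 2"
    with card_half_edges_at[OF that] have "2 < card {l. (a, l) \<in> half_edges x}" by simp
    then have "(\<Sum>a\<in>vertices x. 2) < card (half_edges x)"
      unfolding card_half_edges_vertices using that
      by (intro sum_strict_mono_ex1) (auto intro: card_half_edges_at)
    then show False using card_half_edges[OF cons] unicyclic by simp
  qed
  then have "card {l. (per x (Suc t), l) \<in> half_edges x} = card {Z (Suc t), linv (Z t)}"
    using Z_Suc[of t] by simp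
  then show ?thesis
    using card_subset_eq[OF finite_half_edges_at half_edges_at[of t x]] by simp
qed

lemma half_edges_determined:
  assumes "per x (Suc s) = per x (Suc t)"
  shows "{Z (Suc s), linv (Z s)} = {Z (Suc t), linv (Z t)}"
  using half_edges_at_eq[of s] half_edges_at_eq[of t] assms by simp

end

lemma edgesI:
  "Z t = (i, True) \<Longrightarrow> (per x t, per x (Suc t)) \<in> edges x i"
  "Z t = (i, False) \<Longrightarrow> (per x (Suc t), per x t) \<in> edges x i"
  by (auto simp: edges_def)

lemma consistentD:
  assumes "consistent x"
  shows "(a, b) \<in> edges x i \<Longrightarrow> (a, b') \<in> edges x i \<Longrightarrow> b = b'"
    "(a, b) \<in> edges x i \<Longrightarrow> (a', b) \<in> edges x i \<Longrightarrow> a = a'"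
  using assms unfolding consistent_def partial_injection_def single_valued_def by auto

lemma consistent_forward:
  assumes "consistent x" "per x s = per x t" "Z s = Z t"
  shows "per x (Suc s) = per x (Suc t)"
proof (cases "Z s")
  case (Pair i b)
  then show ?thesis
    using assms edgesI[of s i x] edgesI[of t i x] consistentD[OF assms(1)]
    by (cases b) metis+
qed

lemma consistent_backward:
  assumes "consistent x" "per x s = per x (Suc t)" "Z s = linv (Z t)"
  shows "per x (Suc s) = per x t"
proof (cases "Z t")
  case (Pair i b)
  then have "Z s = (i, \<not> b)" using assms(3) by (simp add: linv_def)
  with Pair show ?thesis
    using assms edgesI[of s i x] edgesI[of t i x] consistentD[OF assms(1)]
    by (cases b) (simp, metis)+
qed

context
  fixes x :: "nat \<Rightarrow> 'v"
  assumes cons: "consistent x" and unicyclic: "card (vertices x) = num_edges x"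
begin

text \<open>If the walk traversed the same stretch in opposite directions, the degree condition
  would let the two visits be followed towards each other in time, to \<open>Suc s\<close> and
  \<open>t - 1\<close>. When they meet, a letter would follow its own inverse or equal its own
  inverse.\<close>

lemma no_reversal:
  "s \<le> t \<Longrightarrow> per x (Suc s) = per x (Suc t) \<Longrightarrow> Z (Suc s) \<noteq> linv (Z t)"
proof (induction "t - s" arbitrary: s t rule: less_induct)
  case less
  show ?case
  proof
    assume rev: "Z (Suc s) = linv (Z t)"
    consider "t = s" | "t = Suc s" | t' where "t = Suc t'" "Suc s \<le> t'"
      using less.prems(1) by (metis Suc_leI le_neq_implies_less less_Suc_eq_le less_imp_Suc_add)
    then show False
    proof cases
      case 1
      with rev show ?thesis by (simp add: Z_Suc)
    next
      case 2
      with rev show ?thesis by simp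
    next
      case 3
      have eq: "per x (Suc (Suc s)) = per x (Suc t')"
        using consistent_backward[OF cons less.prems(2) rev] 3 by simp
      have "{Z (Suc (Suc s)), linv (Z (Suc s))} = {Z (Suc t'), linv (Z t')}"
        by (rule half_edges_determined[OF cons unicyclic eq])
      moreover have "linv (Z (Suc s)) = Z (Suc t')" using rev 3 by simp
      ultimately have "Z (Suc (Suc s)) = linv (Z t')"
        using Z_Suc[of "Suc s"] Z_Suc[of t'] by (auto simp: doubleton_eq_iff)
      then show ?thesis
        using less.hyps[of t' "Suc s"] eq 3 by simp
    qed
  qed
qed

lemma per_add_mult: "per x (t + j * k) = per x t" "Z (t + j * k) = Z t"
  by (simp_all add: per_def Z_def)

lemma unicyclic_step:
  assumes "per x s = per x t"
  shows "Z s = Z t" "per x (Suc s) = per x (Suc t)"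
proof -
  obtain s' where s': "per x s = per x (Suc s')" "Z s = Z (Suc s')" using per_as_Suc[of x s] by auto
  obtain t0 where t0: "per x t = per x (Suc t0)" "Z t = Z (Suc t0)" using per_as_Suc[of x t] by auto
  \<comment> \<open>\<open>no_reversal\<close> needs its two times in order; adding a multiple of
    the period \<open>k\<close> achieves this.\<close>
  define t' where "t' = t0 + s' * k"
  have t': "per x t = per x (Suc t')" "Z t = Z (Suc t')"
    using t0 per_add_mult[of "Suc t0" s'] by (simp_all add: t'_def)
  have "s' \<le> t'" using k_pos by (cases k) (auto simp: t'_def)
  moreover have eq: "per x (Suc s') = per x (Suc t')" using assms s' t' by simp
  ultimately have "Z (Suc s') \<noteq> linv (Z t')" by (rule no_reversal)
  moreover have "{Z (Suc s'), linv (Z s')} = {Z (Suc t'), linv (Z t')}"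
    by (rule half_edges_determined[OF cons unicyclic eq])
  ultimately have "Z (Suc s') = Z (Suc t')" by (auto simp: doubleton_eq_iff)
  then show "Z s = Z t" using s' t' by simp
  then show "per x (Suc s) = per x (Suc t)" using consistent_forward[OF cons assms] by simp
qed

lemma unicyclic_shift:
  assumes "per x s = per x t"
  shows "per x (s + j) = per x (t + j)" "Z (s + j) = Z (t + j)"
proof -
  show *: "per x (s + j) = per x (t + j)"
  proof (induction j)
    case (Suc j)
    then show ?case using unicyclic_step(2)[OF Suc] by simp
  qed (simp add: assms)
  show "Z (s + j) = Z (t + j)" using unicyclic_step(1)[OF *] .
qed

text \<open>The position determines the next letter and the next position, so the walk repeats after
  its first return to the start. That return time \<open>d\<close> is a period of the letters as
  well, so the word is a proper power unless \<open>d = k\<close>.\<close>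

lemma unicyclic_period:
  "\<exists>d. 1 \<le> d \<and> d \<le> k \<and> d dvd k \<and> (\<forall>s t. per x s = per x t \<longleftrightarrow> s mod d = t mod d)
    \<and> (\<forall>t. Z t = Z (t mod d))"
proof -
  define d where "d = (LEAST d. 0 < d \<and> per x d = per x 0)"
  have ex: "0 < k \<and> per x k = per x 0" using k_pos per_add[of x 0] by simp
  have d: "0 < d" "per x d = per x 0"
    unfolding d_def using LeastI[of "\<lambda>d. 0 < d \<and> per x d = per x 0", OF ex] by auto
  have least: "e = 0" if "per x e = per x 0" "e < d" for e
    using not_less_Least[of e "\<lambda>d. 0 < d \<and> per x d = per x 0"] that unfolding d_def by auto
  have dk: "d \<le> k" unfolding d_def using ex by (intro Least_le) auto
  have mult: "per x (t + j * d) = per x t" for t j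
  proof (induction j)
    case (Suc j)
    have "per x (t + Suc j * d) = per x (d + (t + j * d))" by (simp add: algebra_simps)
    also have "\<dots> = per x (0 + (t + j * d))" by (rule unicyclic_shift(1)[OF d(2)])
    finally show ?case using Suc by simp
  qed simp
  have mod: "per x t = per x (t mod d)" for t
    using mult[of "t mod d" "t div d"] unfolding mod_div_mult_eq .
  have zero: "d dvd t" if "per x t = per x 0" for t
    using least[OF trans[OF mod[symmetric] that]] d(1) by (simp add: dvd_eq_mod_eq_0)
  have dvd: "d dvd k" using ex zero by simp
  have diff: "s mod d = t mod d" if "per x s = per x t" "s \<le> t" for s t
  proof -
    \<comment> \<open>Advancing both times by \<open>s * k - s\<close> brings the first to a
      multiple of \<open>k\<close>, that is, to the start of the walk, so that \<open>zero\<close>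
      applies to \<open>t - s\<close>.\<close>
    have "s \<le> s * k" using k_pos by (cases k) auto
    then have "per x (s + (s * k - s)) = per x (t + (s * k - s))"
      by (intro unicyclic_shift(1)[OF that(1)])
    then have "per x (0 + s * k) = per x ((t - s) + s * k)" using that(2) \<open>s \<le> s * k\<close> by simp
    then have "per x (t - s) = per x 0" unfolding per_add_mult by simp
    then have "d dvd t - s" by (rule zero)
    then show ?thesis using that(2) by (metis mod_eq_dvd_iff_nat)
  qed
  have "per x s = per x t \<longleftrightarrow> s mod d = t mod d" for s t
    using diff[of s t] diff[of t s] mod[of s] mod[of t] by (metis nat_le_linear)
  moreover have "Z t = Z (t mod d)" for t
    using unicyclic_step(1)[OF mod[of t]] .
  ultimately show ?thesis using d(1) dk dvd by (intro exI[of _ d]) auto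
qed

end

section \<open>Coincidence patterns of closed walks\<close>

text \<open>This encodes the partition of the times according to the vertex visited, each class
  being represented by its first time. The kernel is itself a walk, with a graph isomorphic to that
  of \<open>x\<close>, and there are finitely many kernels, independently of n.\<close>

definition kernel :: "(nat \<Rightarrow> 'v) \<Rightarrow> nat \<Rightarrow> nat" where
  "kernel x = (\<lambda>t\<in>{..<k}. LEAST s. x s = x t)"

definition kernels :: "(nat \<Rightarrow> nat) set" where
  "kernels = {\<kappa> \<in> {..<k} \<rightarrow>\<^sub>E {..<k}. kernel \<kappa> = \<kappa>}"

lemma finite_kernels [simp]: "finite kernels"
  unfolding kernels_def by (rule finite_subset[of _ "{..<k} \<rightarrow>\<^sub>E {..<k}"]) (auto intro: finite_PiE)

text \<open>The expected number of closed walks with a given consistent kernel is of order n to the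
  power vertices minus edges, so these are exactly the kernels that survive as n grows, each
  contributing 1 in the limit.\<close>

definition unicyclic_kernels :: "(nat \<Rightarrow> nat) set" where
  "unicyclic_kernels = {\<kappa> \<in> kernels. consistent \<kappa> \<and> num_edges \<kappa> = card (vertices \<kappa>)}"

definition mod_kernel :: "nat \<Rightarrow> nat \<Rightarrow> nat" where
  "mod_kernel d = (\<lambda>t\<in>{..<k}. t mod d)"

lemma unicyclic_kernelsD:
  assumes "\<kappa> \<in> unicyclic_kernels"
  shows "\<exists>d. 1 \<le> d \<and> d \<le> k \<and> d dvd k \<and> \<kappa> = mod_kernel d \<and> (\<forall>t. Z t = Z (t mod d))"
proof -
  have \<kappa>: "consistent \<kappa>" "card (vertices \<kappa>) = num_edges \<kappa>" "kernel \<kappa> = \<kappa>"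
    using assms by (auto simp: unicyclic_kernels_def kernels_def)
  obtain d where d: "1 \<le> d" "d \<le> k" "d dvd k" "\<And>s t. per \<kappa> s = per \<kappa> t \<longleftrightarrow> s mod d = t mod d"
    "\<And>t. Z t = Z (t mod d)"
    using unicyclic_period[OF \<kappa>(1,2)] by blast
  have "kernel \<kappa> = mod_kernel d"
    unfolding kernel_def mod_kernel_def
  proof (rule restrict_ext)
    fix t assume "t \<in> {..<k}"
    then have t: "t < k" by simp
    have eq: "\<kappa> s = \<kappa> t \<longleftrightarrow> s mod d = t mod d" if "s < k" for s
      using d(4)[of s t] that t by (simp add: per_def)
    have tm: "t mod d \<le> t" by simp
    show "(LEAST s. \<kappa> s = \<kappa> t) = t mod d"
    proof (rule Least_equality)
      show "\<kappa> (t mod d) = \<kappa> t" using eq[of "t mod d"] tm t by simp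
      show "t mod d \<le> s" if "\<kappa> s = \<kappa> t" for s
      proof (cases "s < k")
        case True
        then show ?thesis using eq[of s] that by (metis mod_less_eq_dividend)
      qed (use tm t in linarith)
    qed
  qed
  then show ?thesis using d \<kappa>(3) by metis
qed

text \<open>The period determines the kernel. This crude count serves for powers, where several
  periods may occur.\<close>

lemma card_unicyclic_kernels_le: "card unicyclic_kernels \<le> k"
proof -
  have "unicyclic_kernels \<subseteq> mod_kernel ` {1..k}"
    using unicyclic_kernelsD by force
  then have "card unicyclic_kernels \<le> card {1..k}"
    by (rule surj_card_le[rotated]) simp
  then show ?thesis by simp
qed

lemma kernel_mod_kernel: "mod_kernel k \<in> kernels"
proof -
  have *: "mod_kernel k = (\<lambda>t\<in>{..<k}. t)" by (auto simp: mod_kernel_def)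
  have "(LEAST s. mod_kernel k s = mod_kernel k t) = t" if "t < k" for t
  proof (rule Least_equality)
    show "t \<le> s" if "mod_kernel k s = mod_kernel k t" for s
      using that \<open>t < k\<close> by (cases "s < k") (auto simp: *)
  qed simp
  moreover have "mod_kernel k t = (if t < k then t else undefined)" for t
    by (simp add: mod_kernel_def)
  ultimately have "kernel (mod_kernel k) = mod_kernel k"
    by (simp add: fun_eq_iff kernel_def)
  then show ?thesis
    using k_pos by (auto simp: kernels_def mod_kernel_def)
qed

lemma per_mod_kernel: "per (mod_kernel k) t = t mod k"
  using k_pos by (simp add: per_def mod_kernel_def)

lemma Z_cong: "s mod k = t mod k \<Longrightarrow> Z s = Z t"
  by (simp add: Z_def)

lemma Suc_mod_inj: "Suc s mod k = Suc t mod k \<Longrightarrow> s mod k = t mod k"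
proof -
  assume "Suc s mod k = Suc t mod k"
  then have "(Suc s + (k - 1)) mod k = (Suc t + (k - 1)) mod k" by (rule mod_add_cong) simp
  then show ?thesis using k_pos by simp
qed

text \<open>All positions are distinct here, so two edges can only conflict at a common vertex of
  consecutive steps, and a conflict there would be a backtracking step.\<close>

lemma consistent_mod_kernel: "consistent (mod_kernel k)"
  unfolding consistent_def
proof
  fix i
  have a: "s mod k = t mod k" if "Suc s mod k = Suc t mod k" for s t
    using Suc_mod_inj[OF that] .
  have no: False if "Z s = (i, True)" "Z t = (i, False)" "s mod k = Suc t mod k" for s t
    using Z_Suc[of t] Z_cong[OF that(3)] that by (simp add: linv_def)
  have no': False if "Z s = (i, True)" "Z t = (i, False)" "Suc s mod k = t mod k" for s t
    using Z_Suc[of s] Z_cong[OF that(3)] that by (simp add: linv_def)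
  show "partial_injection (edges (mod_kernel k) i)"
    unfolding partial_injection_def single_valued_def edges_def per_mod_kernel
    by (auto dest: no no' no[OF _ _ sym] no'[OF _ _ sym] a intro: Suc_mod_cong)
qed

lemma num_edges_le:
  assumes "consistent x"
  shows "num_edges x \<le> k"
proof -
  have "half_edges x \<subseteq> (\<lambda>t. (per x t, Z t)) ` {..<k} \<union> (\<lambda>t. (per x (Suc t), linv (Z t))) ` {..<k}"
  proof
    fix h assume "h \<in> half_edges x"
    then obtain t where "h = (per x t, Z t) \<or> h = (per x (Suc t), linv (Z t))"
      by (auto simp: half_edges_def)
    then have "h = (per x (t mod k), Z (t mod k)) \<or> h = (per x (Suc (t mod k)), linv (Z (t mod k)))"
      by simp
    moreover have "t mod k \<in> {..<k}" using k_pos by simp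
    ultimately show "h \<in> (\<lambda>t. (per x t, Z t)) ` {..<k} \<union> (\<lambda>t. (per x (Suc t), linv (Z t))) ` {..<k}"
      by blast
  qed
  then have "card (half_edges x)
      \<le> card ((\<lambda>t. (per x t, Z t)) ` {..<k}) + card ((\<lambda>t. (per x (Suc t), linv (Z t))) ` {..<k})"
    by (meson card_Un_le card_mono finite_UnI finite_imageI finite_lessThan le_trans)
  also have "\<dots> \<le> k + k"
    by (intro add_mono card_image_le[THEN order_trans]) auto
  finally show ?thesis
    using card_half_edges[OF assms] by simp
qed

lemma mod_kernel_unicyclic: "mod_kernel k \<in> unicyclic_kernels"
proof -
  let ?\<kappa> = "mod_kernel k"
  have "num_edges ?\<kappa> \<le> k"
    by (rule num_edges_le[OF consistent_mod_kernel])
  moreover have "vertices ?\<kappa> = {..<k}"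
    by (auto simp: vertices_def mod_kernel_def image_iff)
  ultimately show ?thesis
    using card_vertices_le[OF consistent_mod_kernel] kernel_mod_kernel consistent_mod_kernel
    by (simp add: unicyclic_kernels_def)
qed

lemma unicyclic_kernels_eq:
  assumes "\<nexists>v m. 2 \<le> m \<and> z = concat (replicate m v)"
  shows "unicyclic_kernels = {mod_kernel k}"
proof -
  have "\<kappa> = mod_kernel k" if "\<kappa> \<in> unicyclic_kernels" for \<kappa>
  proof -
    from unicyclic_kernelsD[OF that] obtain d where d: "1 \<le> d" "d \<le> k" "d dvd k" "\<kappa> = mod_kernel d"
      "\<And>t. Z t = Z (t mod d)" by blast
    obtain m where m: "k = d * m" using d(3) by auto
    have len_d: "length (take d z) = d" using d(2) by (simp add: k_def)
    have "z = concat (replicate m (take d z))"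
    proof (rule nth_equalityI)
      show len: "length z = length (concat (replicate m (take d z)))"
        unfolding length_concat_replicate len_d using m by (simp add: k_def mult.commute)
      have nth: "concat (replicate j v) ! t = v ! (t mod length v)" if "t < j * length v"
        for j t and v :: "letter list"
        using that
      proof (induction j arbitrary: t)
        case (Suc j)
        then show ?case by (cases "t < length v") (auto simp: nth_append mod_if[of t])
      qed simp
      fix t assume t: "t < length z"
      have "t < m * d" using t m by (simp add: k_def mult.commute)
      then have "concat (replicate m (take d z)) ! t = take d z ! (t mod d)"
        using nth[of t m "take d z"] len_d by simp
      also have "\<dots> = z ! (t mod d)" using d(1) by simp
      also have "\<dots> = Z (t mod d)"
      proof -
        have "t mod d < k" using d(1,2) mod_less_divisor[of d t] by linarith
        then show ?thesis by (simp add: Z_def)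
      qed
      also have "\<dots> = z ! t" using d(5)[of t] t by (simp add: Z_def k_def)
      finally show "z ! t = concat (replicate m (take d z)) ! t" by simp
    qed
    then have "\<not> 2 \<le> m" using assms by blast
    moreover have "m \<noteq> 0" using m k_pos by auto
    ultimately have "m = 1" by simp
    then show ?thesis using d(4) m by simp
  qed
  then show ?thesis using mod_kernel_unicyclic by blast
qed

end

text \<open>The falling factorial n (n - 1) ... (n - m + 1) divided by n^m, as a polynomial in 1 /
  n.\<close>

definition falling_poly :: "nat \<Rightarrow> real poly" where
  "falling_poly m = (\<Prod>j<m. [:1, - real j:])"

lemma single_valued_map_prod:
  assumes "inj_on f V" "C \<subseteq> V \<times> V"
  shows "single_valued (map_prod f f ` C) \<longleftrightarrow> single_valued C"
proof
  assume sv: "single_valued (map_prod f f ` C)"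
  show "single_valued C"
  proof (rule single_valuedI)
    fix a b b' assume C: "(a, b) \<in> C" "(a, b') \<in> C"
    then have "(f a, f b) \<in> map_prod f f ` C" "(f a, f b') \<in> map_prod f f ` C" by force+
    then have "f b = f b'" by (rule single_valuedD[OF sv])
    then show "b = b'" using C assms by (auto simp: inj_on_def)
  qed
next
  assume sv: "single_valued C"
  show "single_valued (map_prod f f ` C)"
  proof (rule single_valuedI)
    fix x y y' assume "(x, y) \<in> map_prod f f ` C" "(x, y') \<in> map_prod f f ` C"
    then obtain a b a' b' where C: "(a, b) \<in> C" "(a', b') \<in> C"
      and xy: "x = f a" "y = f b" "x = f a'" "y' = f b'" by auto
    then have "a = a'" using assms by (auto simp: inj_on_def)
    then show "y = y'" using single_valuedD[OF sv C(1), of b'] C xy by simp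
  qed
qed

lemma partial_injection_map_prod:
  assumes "inj_on f V" "C \<subseteq> V \<times> V"
  shows "partial_injection (map_prod f f ` C) \<longleftrightarrow> partial_injection C"
proof -
  have "(map_prod f f ` C)\<inverse> = map_prod f f ` C\<inverse>" by force
  moreover have "C\<inverse> \<subseteq> V \<times> V" using assms(2) by auto
  ultimately show ?thesis
    using assms by (simp add: partial_injection_def single_valued_map_prod)
qed

lemma PiE_dflt_Collect:
  "PiE_dflt I d (\<lambda>i. {y. A y \<and> Q i y}) = {x \<in> PiE_dflt I d (\<lambda>_. {y. A y}). \<forall>i\<in>I. Q i (x i)}"
  by (auto simp: PiE_dflt_def)

context cyclic_word
begin

section \<open>Fixed points as closed walks, and their probabilities\<close>

definition walk :: "(nat \<Rightarrow> nat \<Rightarrow> nat) \<Rightarrow> (nat \<Rightarrow> nat) \<Rightarrow> bool" where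
  "walk \<sigma> x \<longleftrightarrow> (\<forall>t. per x (Suc t) = lperm \<sigma> (Z t) (per x t))"

lemma fold_take_Suc: "j < k \<Longrightarrow> fold (lperm \<sigma>) (take (Suc j) z) a = lperm \<sigma> (Z j) (fold (lperm \<sigma>) (take j z) a)"
  by (simp add: take_Suc_conv_app_nth k_def Z_def)

lemma walk_fold:
  assumes "walk \<sigma> x"
  shows "t \<le> k \<Longrightarrow> per x t = fold (lperm \<sigma>) (take t z) (x 0)"
proof (induction t)
  case 0
  then show ?case by (simp add: per_def)
next
  case (Suc t)
  then have "per x t = fold (lperm \<sigma>) (take t z) (x 0)" by simp
  moreover have "per x (Suc t) = lperm \<sigma> (Z t) (per x t)" using assms by (simp add: walk_def)
  ultimately show ?case using Suc.prems fold_take_Suc[of t \<sigma> "x 0"] by simp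
qed

lemma fixed_points_eq_walks:
  assumes "\<sigma> \<in> Omega n r"
  shows "fixed_points n \<sigma> z = real (card {x \<in> {..<k} \<rightarrow>\<^sub>E {..<n}. walk \<sigma> x})"
proof -
  let ?F = "\<lambda>t. fold (lperm \<sigma>) (take t z)"
  have zk: "take k z = z" by (simp add: k_def)
  have "bij_betw (\<lambda>a. \<lambda>t\<in>{..<k}. ?F t a) {a \<in> {..<n}. fold (lperm \<sigma>) z a = a}
      {x \<in> {..<k} \<rightarrow>\<^sub>E {..<n}. walk \<sigma> x}"
  proof (rule bij_betw_byWitness[where f' = "\<lambda>x. x 0"])
    show "(\<lambda>a. \<lambda>t\<in>{..<k}. ?F t a) ` {a \<in> {..<n}. fold (lperm \<sigma>) z a = a}
        \<subseteq> {x \<in> {..<k} \<rightarrow>\<^sub>E {..<n}. walk \<sigma> x}"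
    proof (rule image_subsetI)
      fix a assume "a \<in> {a \<in> {..<n}. fold (lperm \<sigma>) z a = a}"
      then have a: "a < n" "fold (lperm \<sigma>) z a = a" by auto
      let ?x = "\<lambda>t\<in>{..<k}. ?F t a"
      have "?x \<in> {..<k} \<rightarrow>\<^sub>E {..<n}" using fold_lperm_less[OF assms a(1)] by simp
      moreover have "walk \<sigma> ?x"
        unfolding walk_def
      proof
        fix t
        have tk: "t mod k < k" using k_pos by simp
        have p: "per ?x t = ?F (t mod k) a" using tk by (simp add: per_def)
        have s: "?F (Suc (t mod k)) a = lperm \<sigma> (Z t) (per ?x t)"
          using fold_take_Suc[OF tk, of \<sigma> a] p by simp
        show "per ?x (Suc t) = lperm \<sigma> (Z t) (per ?x t)"
        proof (cases "Suc (t mod k) = k")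
          case True
          then have "per ?x (Suc t) = a" using k_pos by (simp add: per_def mod_Suc)
          also have "a = ?F (Suc (t mod k)) a" using True zk a(2) by simp
          finally show ?thesis using s by simp
        next
          case False
          then have "Suc (t mod k) < k" using tk by simp
          then have "per ?x (Suc t) = ?F (Suc (t mod k)) a" by (simp add: per_def mod_Suc)
          then show ?thesis using s by simp
        qed
      qed
      ultimately show "?x \<in> {x \<in> {..<k} \<rightarrow>\<^sub>E {..<n}. walk \<sigma> x}" by simp
    qed
    show "(\<lambda>x. x 0) ` {x \<in> {..<k} \<rightarrow>\<^sub>E {..<n}. walk \<sigma> x} \<subseteq> {a \<in> {..<n}. fold (lperm \<sigma>) z a = a}"
    proof safe
      fix x assume x: "x \<in> {..<k} \<rightarrow>\<^sub>E {..<n}" "walk \<sigma> x"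
      show "x 0 < n" using x(1) k_pos by auto
      show "fold (lperm \<sigma>) z (x 0) = x 0"
        using walk_fold[OF x(2), of k] zk by (simp add: per_def)
    qed
    show "\<forall>x\<in>{x \<in> {..<k} \<rightarrow>\<^sub>E {..<n}. walk \<sigma> x}. (\<lambda>t\<in>{..<k}. ?F t (x 0)) = x"
    proof safe
      fix x assume x: "x \<in> {..<k} \<rightarrow>\<^sub>E {..<n}" "walk \<sigma> x"
      show "(\<lambda>t\<in>{..<k}. ?F t (x 0)) = x"
      proof
        fix t
        show "(\<lambda>t\<in>{..<k}. ?F t (x 0)) t = x t"
        proof (cases "t < k")
          case True
          then have "x t = per x t" by (simp add: per_def)
          also have "\<dots> = ?F t (x 0)" using walk_fold[OF x(2), of t] True by simp
          finally show ?thesis using True by simp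
        qed (simp add: PiE_arb[OF x(1)])
      qed
    qed
  qed (simp add: k_pos)
  then show ?thesis unfolding fixed_points_def by (simp add: bij_betw_same_card)
qed

lemma walk_iff_edges:
  assumes "\<sigma> \<in> Omega n r"
  shows "walk \<sigma> x \<longleftrightarrow> (\<forall>i<r. \<forall>(a, b)\<in>edges x i. \<sigma> i a = b)"
proof -
  have inv: "a = inv_into UNIV (\<sigma> i) b \<longleftrightarrow> \<sigma> i a = b" for i a b
    using permutes_inverses[OF Omega_permutes[OF assms, of i]] by auto
  have step: "per x (Suc t) = lperm \<sigma> (Z t) (per x t) \<longleftrightarrow>
      (if snd (Z t) then \<sigma> (fst (Z t)) (per x t) = per x (Suc t)
       else \<sigma> (fst (Z t)) (per x (Suc t)) = per x t)" for t
    by (auto simp: lperm_def inv)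
  show ?thesis
  proof
    assume w: "walk \<sigma> x"
    have "\<sigma> i a = b" if ab: "(a, b) \<in> edges x i" for i a b
      using ab[unfolded edges_def] w[unfolded walk_def step]
      by (elim UnE CollectE exE conjE) (simp; metis fst_conv snd_conv)+
    then show "\<forall>i<r. \<forall>(a, b)\<in>edges x i. \<sigma> i a = b" by auto
  next
    assume e: "\<forall>i<r. \<forall>(a, b)\<in>edges x i. \<sigma> i a = b"
    show "walk \<sigma> x"
      unfolding walk_def step
    proof
      fix t
      obtain i b where Z: "Z t = (i, b)" by (cases "Z t")
      have "i < r" using fst_Z_less[of t] Z by simp
      then show "if snd (Z t) then \<sigma> (fst (Z t)) (per x t) = per x (Suc t)
         else \<sigma> (fst (Z t)) (per x (Suc t)) = per x t"
        using e edgesI[of t i x] Z by (cases b) auto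
    qed
  qed
qed

lemma edges_empty: "r \<le> i \<Longrightarrow> edges x i = {}"
proof -
  assume "r \<le> i"
  then have "Z t \<noteq> (i, b)" for t b using fst_Z_less[of t] by auto
  then show ?thesis by (auto simp: edges_def)
qed

lemma consistent_iff: "consistent x \<longleftrightarrow> (\<forall>i<r. partial_injection (edges x i))"
proof -
  have "partial_injection ({} :: ('v \<times> 'v) set)" by (simp add: partial_injection_def)
  then show ?thesis
    unfolding consistent_def using edges_empty by (metis not_le)
qed

definition walk_prob :: "nat \<Rightarrow> (nat \<Rightarrow> nat) \<Rightarrow> real" where
  "walk_prob n x = (if consistent x then \<Prod>i<r. fact (n - card (edges x i)) / fact n else 0)"

lemma average_walk:
  assumes "x \<in> {..<k} \<rightarrow>\<^sub>E {..<n}"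
  shows "average n r (\<lambda>\<sigma>. of_bool (walk \<sigma> x)) = walk_prob n x"
proof -
  let ?B = "\<lambda>i. {\<pi>. \<pi> permutes {..<n} \<and> (\<forall>(a, b)\<in>edges x i. \<pi> a = b)}"
  have "vertices x \<subseteq> {..<n}" using assms by (auto simp: vertices_def)
  then have sub: "edges x i \<subseteq> {..<n} \<times> {..<n}" for i
    using edges_subset[of x i] by blast
  have "(\<Sum>\<sigma>\<in>Omega n r. of_bool (walk \<sigma> x)) = real (card {\<sigma> \<in> Omega n r. walk \<sigma> x})"
    by (simp add: of_bool_def sum.If_cases Int_def)
  also have "real (card {\<sigma> \<in> Omega n r. walk \<sigma> x}) = real (card (PiE_dflt {..<r} id ?B))"
  proof -
    have "{\<sigma> \<in> Omega n r. walk \<sigma> x} = {\<sigma> \<in> Omega n r. \<forall>i<r. \<forall>(a, b)\<in>edges x i. \<sigma> i a = b}"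
      by (intro Collect_cong conj_cong refl walk_iff_edges)
    also have "\<dots> = PiE_dflt {..<r} id ?B"
      unfolding Omega_def PiE_dflt_Collect by (simp add: Ball_def)
    finally show ?thesis by simp
  qed
  also have "card (PiE_dflt {..<r} id ?B) = (\<Prod>i<r. card (?B i))"
    by (rule card_PiE_dflt) (auto intro: finite_subset[OF _ finite_permutations[of "{..<n}"]])
  also have "real (\<Prod>i<r. card (?B i)) = (if consistent x then \<Prod>i<r. fact (n - card (edges x i)) else 0)"
  proof (cases "consistent x")
    case True
    then show ?thesis
      by (simp add: card_permutations_extending[OF sub] consistent_iff)
  next
    case False
    then obtain i where "i < r" "\<not> partial_injection (edges x i)" by (auto simp: consistent_iff)
    then have "(\<Prod>i<r. card (?B i)) = 0"
      by (intro prod_zero) (auto simp: card_permutations_extending[OF sub] intro!: bexI[of _ i])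
    with False show ?thesis by simp
  qed
  finally show ?thesis
    by (simp add: average_def walk_prob_def card_Omega prod_dividef)
qed

lemma average_fixed_points_walks:
  "average n r (\<lambda>\<sigma>. fixed_points n \<sigma> z) = (\<Sum>x\<in>{..<k} \<rightarrow>\<^sub>E {..<n}. walk_prob n x)"
proof -
  have "average n r (\<lambda>\<sigma>. fixed_points n \<sigma> z)
      = average n r (\<lambda>\<sigma>. \<Sum>x\<in>{..<k} \<rightarrow>\<^sub>E {..<n}. of_bool (walk \<sigma> x))"
    by (rule average_cong)
      (simp add: fixed_points_eq_walks of_bool_def sum.If_cases finite_PiE Int_def)
  then show ?thesis by (simp add: average_sum average_walk)
qed

subsection \<open>Grouping closed walks by their coincidences\<close>

text \<open>\<open>kernel\<close> minimises over all times, but the minimiser is at most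
  \<open>t\<close>, so values of \<open>x\<close> from \<open>k\<close> on have no
  influence.\<close>

lemma Least_restrict: "t < k \<Longrightarrow> (LEAST s. x s = x t) = (LEAST s. s < k \<and> x s = x t)" for t :: nat
proof -
  assume t: "t < k"
  let ?m = "LEAST s. s < k \<and> x s = x t"
  have m: "?m < k \<and> x ?m = x t" by (rule LeastI[of _ t]) (use t in auto)
  show ?thesis
  proof (rule Least_equality)
    show "x ?m = x t" using m by simp
    show "?m \<le> s" if "x s = x t" for s
      using that m by (cases "s < k") (auto intro: Least_le)
  qed
qed

lemma kernel_cong:
  assumes "\<And>s t. s < k \<Longrightarrow> t < k \<Longrightarrow> x s = x t \<longleftrightarrow> y s = y t"
  shows "kernel x = kernel y"
proof
  fix t
  have "(\<lambda>s. s < k \<and> x s = x t) = (\<lambda>s. s < k \<and> y s = y t)" if "t < k"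
    using assms that by auto
  then show "kernel x t = kernel y t"
    by (auto simp: kernel_def Least_restrict)
qed

lemma kernel_less: "t < k \<Longrightarrow> kernel x t < k" and apply_kernel: "t < k \<Longrightarrow> x (kernel x t) = x t"
proof -
  assume t: "t < k"
  show "x (kernel x t) = x t" using t by (auto simp: kernel_def intro: LeastI[of "\<lambda>s. x s = x t" t])
  have "kernel x t \<le> t" using t by (auto simp: kernel_def intro: Least_le)
  then show "kernel x t < k" using t by simp
qed

lemma kernel_eq_iff: "s < k \<Longrightarrow> t < k \<Longrightarrow> kernel x s = kernel x t \<longleftrightarrow> x s = x t"
proof
  assume st: "s < k" "t < k" and "kernel x s = kernel x t"
  then have "x (kernel x s) = x (kernel x t)" by simp
  then show "x s = x t" using st by (simp only: apply_kernel)
qed (simp add: kernel_def)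

lemma kernel_in_kernels: "kernel x \<in> kernels"
proof -
  have "kernel (kernel x) = kernel x" by (rule kernel_cong) (rule kernel_eq_iff)
  moreover have "kernel x \<in> {..<k} \<rightarrow>\<^sub>E {..<k}"
    using kernel_less[of _ x] by (auto simp: kernel_def)
  ultimately show ?thesis by (simp add: kernels_def)
qed

lemma kernel_inj_on: "inj_on x (vertices (kernel x))"
proof (rule inj_onI)
  fix a b assume "a \<in> vertices (kernel x)" "b \<in> vertices (kernel x)" "x a = x b"
  then obtain s t where "s < k" "t < k" "a = kernel x s" "b = kernel x t"
    by (auto simp: vertices_def)
  then show "a = b" using \<open>x a = x b\<close> apply_kernel[of s x] apply_kernel[of t x] kernel_eq_iff[of s t x] by simp
qed

lemma edges_eq_image: "edges x i = (\<lambda>t. (per x t, per x (Suc t))) ` {t. Z t = (i, True)}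
    \<union> (\<lambda>t. (per x (Suc t), per x t)) ` {t. Z t = (i, False)}"
  by (auto simp: edges_def)

lemma edges_kernel: "edges x i = map_prod x x ` edges (kernel x) i"
proof -
  have "x (per (kernel x) t) = per x t" for t
    using apply_kernel[of "t mod k" x] k_pos by (simp add: per_def)
  then show ?thesis
    by (simp add: edges_eq_image image_Un image_image)
qed

lemma walk_prob_kernel: "walk_prob n x = walk_prob n (kernel x)"
proof -
  have sub: "edges (kernel x) i \<subseteq> vertices (kernel x) \<times> vertices (kernel x)" for i
    by (rule edges_subset)
  have "card (edges x i) = card (edges (kernel x) i)" for i
    unfolding edges_kernel[of x]
    by (rule card_image[OF inj_on_subset[OF map_prod_inj_on[OF kernel_inj_on kernel_inj_on] sub]])
  moreover have "consistent x \<longleftrightarrow> consistent (kernel x)"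
    unfolding consistent_def edges_kernel[of x]
    using partial_injection_map_prod[OF kernel_inj_on sub] by simp
  ultimately show ?thesis by (simp add: walk_prob_def)
qed

lemma kernelsD:
  assumes "\<kappa> \<in> kernels"
  shows "kernel \<kappa> = \<kappa>" "t < k \<Longrightarrow> \<kappa> t < k" "t < k \<Longrightarrow> \<kappa> (\<kappa> t) = \<kappa> t"
proof -
  show *: "kernel \<kappa> = \<kappa>" using assms by (simp add: kernels_def)
  show "\<kappa> t < k" if "t < k" using kernel_less[OF that, of \<kappa>] * by simp
  show "\<kappa> (\<kappa> t) = \<kappa> t" if "t < k" using apply_kernel[OF that, of \<kappa>] * by simp
qed

text \<open>The vertices of \<open>\<kappa>\<close> are the representatives of its classes. A walk
  with this kernel amounts to an injective labelling of them, extended along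
  \<open>\<kappa>\<close>.\<close>

lemma card_walks_with_kernel:
  assumes \<kappa>: "\<kappa> \<in> kernels"
  shows "card {x \<in> {..<k} \<rightarrow>\<^sub>E {..<n}. kernel x = \<kappa>} = (\<Prod>j<card (vertices \<kappa>). n - j)"
proof -
  let ?V = "vertices \<kappa>"
  have V: "?V \<subseteq> {..<k}" using kernelsD(2)[OF \<kappa>] by (auto simp: vertices_def)
  have "bij_betw (\<lambda>x. restrict x ?V) {x \<in> {..<k} \<rightarrow>\<^sub>E {..<n}. kernel x = \<kappa>}
    {f \<in> ?V \<rightarrow>\<^sub>E {..<n}. inj_on f ?V}"
  proof (rule bij_betw_byWitness[where f' = "\<lambda>f. \<lambda>t\<in>{..<k}. f (\<kappa> t)"])
    show "\<forall>x\<in>{x \<in> {..<k} \<rightarrow>\<^sub>E {..<n}. kernel x = \<kappa>}. (\<lambda>t\<in>{..<k}. restrict x ?V (\<kappa> t)) = x"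
    proof safe
      fix x assume x: "x \<in> {..<k} \<rightarrow>\<^sub>E {..<n}" "\<kappa> = kernel x"
      show "(\<lambda>t\<in>{..<k}. restrict x (vertices (kernel x)) (kernel x t)) = x"
      proof
        fix t
        show "(\<lambda>t\<in>{..<k}. restrict x (vertices (kernel x)) (kernel x t)) t = x t"
        proof (cases "t < k")
          case True
          then have "kernel x t \<in> vertices (kernel x)" by (auto simp: vertices_def)
          then show ?thesis using True by (simp add: apply_kernel)
        qed (simp add: PiE_arb[OF x(1)])
      qed
    qed
    show "\<forall>f\<in>{f \<in> ?V \<rightarrow>\<^sub>E {..<n}. inj_on f ?V}. restrict (\<lambda>t\<in>{..<k}. f (\<kappa> t)) ?V = f"
    proof safe
      fix f assume f: "f \<in> ?V \<rightarrow>\<^sub>E {..<n}"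
      show "restrict (\<lambda>t\<in>{..<k}. f (\<kappa> t)) ?V = f"
      proof
        fix t
        have "\<kappa> t = t" "t < k" if "t \<in> ?V"
          using that kernelsD[OF \<kappa>] by (auto simp: vertices_def)
        then show "restrict (\<lambda>t\<in>{..<k}. f (\<kappa> t)) ?V t = f t"
          by (cases "t \<in> ?V") (simp_all add: PiE_arb[OF f])
      qed
    qed
    show "(\<lambda>x. restrict x ?V) ` {x \<in> {..<k} \<rightarrow>\<^sub>E {..<n}. kernel x = \<kappa>} \<subseteq> {f \<in> ?V \<rightarrow>\<^sub>E {..<n}. inj_on f ?V}"
      using V kernel_inj_on by (auto simp: inj_on_restrict_eq)
    show "(\<lambda>f. \<lambda>t\<in>{..<k}. f (\<kappa> t)) ` {f \<in> ?V \<rightarrow>\<^sub>E {..<n}. inj_on f ?V} \<subseteq> {x \<in> {..<k} \<rightarrow>\<^sub>E {..<n}. kernel x = \<kappa>}"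
    proof (rule image_subsetI)
      fix f assume "f \<in> {f \<in> ?V \<rightarrow>\<^sub>E {..<n}. inj_on f ?V}"
      then have f: "f \<in> ?V \<rightarrow>\<^sub>E {..<n}" "inj_on f ?V" by auto
      have "(\<lambda>t\<in>{..<k}. f (\<kappa> t)) \<in> {..<k} \<rightarrow>\<^sub>E {..<n}" using f by (auto simp: vertices_def)
      moreover have "kernel (\<lambda>t\<in>{..<k}. f (\<kappa> t)) = kernel \<kappa>"
        by (rule kernel_cong) (use f(2) in \<open>auto simp: inj_on_def vertices_def\<close>)
      then have "kernel (\<lambda>t\<in>{..<k}. f (\<kappa> t)) = \<kappa>" using kernelsD(1)[OF \<kappa>] by simp
      ultimately show "(\<lambda>t\<in>{..<k}. f (\<kappa> t)) \<in> {x \<in> {..<k} \<rightarrow>\<^sub>E {..<n}. kernel x = \<kappa>}" by simp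
    qed
  qed
  then have "card {x \<in> {..<k} \<rightarrow>\<^sub>E {..<n}. kernel x = \<kappa>} = card {f \<in> ?V \<rightarrow>\<^sub>E {..<n}. inj_on f ?V}"
    by (rule bij_betw_same_card)
  also have "\<dots> = (\<Prod>j<card ?V. n - j)"
    using card_inj_on_subset_funcset[of ?V "{..<n}" ?V] by (simp add: atLeast0LessThan)
  finally show ?thesis .
qed

lemma average_fixed_points_kernels:
  "average n r (\<lambda>\<sigma>. fixed_points n \<sigma> z)
    = (\<Sum>\<kappa>\<in>kernels. real (\<Prod>j<card (vertices \<kappa>). n - j) * walk_prob n \<kappa>)"
proof -
  let ?X = "{..<k} \<rightarrow>\<^sub>E {..<n}"
  have "(\<Sum>x\<in>?X. walk_prob n x) = (\<Sum>\<kappa>\<in>kernels. \<Sum>x\<in>{x \<in> ?X. kernel x = \<kappa>}. walk_prob n x)"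
    by (rule sum.group[symmetric]) (simp_all add: finite_PiE image_subset_iff kernel_in_kernels)
  also have "\<dots> = (\<Sum>\<kappa>\<in>kernels. \<Sum>x\<in>{x \<in> ?X. kernel x = \<kappa>}. walk_prob n \<kappa>)"
  proof (intro sum.cong refl)
    fix \<kappa> x assume "x \<in> {x \<in> ?X. kernel x = \<kappa>}"
    then show "walk_prob n x = walk_prob n \<kappa>" using walk_prob_kernel[of n x] by simp
  qed
  also have "\<dots> = (\<Sum>\<kappa>\<in>kernels. real (\<Prod>j<card (vertices \<kappa>). n - j) * walk_prob n \<kappa>)"
    by (intro sum.cong refl) (simp only: sum_constant card_walks_with_kernel)
  finally show ?thesis by (simp add: average_fixed_points_walks)
qed

end

section \<open>The mean number of fixed points as a polynomial in 1/n\<close>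

lemma poly_falling_poly: "poly (falling_poly m) x = (\<Prod>j<m. 1 - real j * x)"
  by (simp add: falling_poly_def poly_prod algebra_simps)

lemma poly_falling_poly_0 [simp]: "poly (falling_poly m) 0 = 1"
  by (simp add: poly_falling_poly)

lemma degree_falling_poly: "degree (falling_poly m) \<le> m"
proof -
  have "degree (falling_poly m) \<le> (\<Sum>j<m. degree [:1, - real j:])"
    unfolding falling_poly_def using degree_prod_sum_le[of "{..<m}" "\<lambda>j. [:1, - real j:]"]
    by (simp add: comp_def)
  also have "\<dots> \<le> (\<Sum>j<m. 1)" by (intro sum_mono) simp
  finally show ?thesis by simp
qed

lemma pderiv_falling_poly_0: "poly (pderiv (falling_poly m)) 0 = - (\<Sum>j<m. real j)"
  unfolding falling_poly_def pderiv_prod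
  by (simp add: poly_sum poly_prod pderiv_pCons sum_negf)

lemma prod_falling:
  assumes "m \<le> n" "0 < n"
  shows "real (\<Prod>j<m. n - j) = real n ^ m * poly (falling_poly m) (1 / real n)"
proof -
  have "real (\<Prod>j<m. n - j) = (\<Prod>j<m. real n * (1 - real j / real n))"
    unfolding of_nat_prod using assms by (intro prod.cong) (auto simp: field_simps of_nat_diff)
  then show ?thesis by (simp add: poly_falling_poly prod.distrib)
qed

lemma poly_falling_poly_pos:
  assumes "m \<le> n" "0 < n"
  shows "0 < poly (falling_poly m) (1 / real n)"
  unfolding poly_falling_poly using assms by (intro prod_pos) (auto simp: field_simps)

lemma fact_falling: "m \<le> n \<Longrightarrow> real (\<Prod>j<m. n - j) * fact (n - m) = fact n"
proof (induction m)
  case (Suc m)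
  then have "n - m = Suc (n - Suc m)" by simp
  then have "fact (n - m) = real (n - m) * fact (n - Suc m)" by (metis fact_Suc of_nat_fact of_nat_mult)
  with Suc show ?case by (simp add: mult.assoc)
qed simp

context cyclic_word
begin

section \<open>The contribution of one coincidence pattern\<close>

definition used :: "(nat \<Rightarrow> nat) \<Rightarrow> nat set" where
  "used \<kappa> = {i \<in> {..<r}. edges \<kappa> i \<noteq> {}}"

text \<open>The expected number of walks with kernel \<open>\<kappa>\<close> is a falling factorial
  over a product of falling factorials, one for each index. It is divided by n and multiplied by the
  common denominator \<open>falling_poly q ^ q\<close>. Each used index divides one factor of that
  denominator, leaving the linear factors from \<open>card (edges \<kappa> i)\<close> on. At most
  \<open>q\<close> indices are used, which makes the degree independent of \<open>r\<close>.\<close>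

definition kernel_poly :: "nat \<Rightarrow> (nat \<Rightarrow> nat) \<Rightarrow> real poly" where
  "kernel_poly q \<kappa> = [:0, 1:] ^ (1 + num_edges \<kappa> - card (vertices \<kappa>)) * falling_poly (card (vertices \<kappa>))
     * falling_poly q ^ (q - card (used \<kappa>))
     * (\<Prod>i\<in>used \<kappa>. \<Prod>j\<in>{card (edges \<kappa> i)..<q}. [:1, - real j:])"

lemma finite_used [simp]: "finite (used \<kappa>)"
  by (simp add: used_def)

lemma num_edges_used: "num_edges \<kappa> = (\<Sum>i\<in>used \<kappa>. card (edges \<kappa> i))"
  unfolding num_edges_def used_def by (rule sum.mono_neutral_right) auto

context
  fixes \<kappa> :: "nat \<Rightarrow> nat" and q :: nat
  assumes cons: "consistent \<kappa>" and kq: "k \<le> q"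
begin

lemma num_edges_le_q: "num_edges \<kappa> \<le> q"
  using num_edges_le[OF cons] kq by simp

lemma card_used: "card (used \<kappa>) \<le> q"
proof -
  have "(\<Sum>i\<in>used \<kappa>. 1) \<le> num_edges \<kappa>"
    unfolding num_edges_used
    by (intro sum_mono) (auto simp: used_def Suc_le_eq card_gt_0_iff)
  then show ?thesis using num_edges_le_q by simp
qed

lemma card_edges_le: "i < r \<Longrightarrow> card (edges \<kappa> i) \<le> q"
proof -
  assume "i < r"
  then have "card (edges \<kappa> i) \<le> num_edges \<kappa>"
    unfolding num_edges_def by (intro member_le_sum) auto
  then show ?thesis using num_edges_le_q by simp
qed

lemma vertices_le: "card (vertices \<kappa>) \<le> num_edges \<kappa>"
  by (rule card_vertices_le[OF cons])

lemma degree_kernel_poly: "degree (kernel_poly q \<kappa>) \<le> q\<^sup>2 + q + 1"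
proof -
  let ?v = "card (vertices \<kappa>)" and ?e = "num_edges \<kappa>" and ?S = "used \<kappa>"
  have 1: "degree ([:0, 1:] ^ (1 + ?e - ?v) :: real poly) \<le> 1 + ?e - ?v"
    by (rule order_trans[OF degree_power_le]) simp
  have 3: "degree (falling_poly q ^ (q - card ?S)) \<le> q * (q - card ?S)"
    by (rule order_trans[OF degree_power_le]) (simp add: degree_falling_poly)
  have "degree (\<Prod>i\<in>?S. \<Prod>j\<in>{card (edges \<kappa> i)..<q}. [:1, - real j:])
      \<le> (\<Sum>i\<in>?S. degree (\<Prod>j\<in>{card (edges \<kappa> i)..<q}. [:1, - real j:]))"
    using degree_prod_sum_le[of ?S "\<lambda>i. \<Prod>j\<in>{card (edges \<kappa> i)..<q}. [:1, - real j:]"]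
    by (simp add: comp_def)
  also have "\<dots> \<le> (\<Sum>i\<in>?S. q)"
  proof (rule sum_mono)
    fix i
    have "degree (\<Prod>j\<in>{card (edges \<kappa> i)..<q}. [:1, - real j:]) \<le> (\<Sum>j\<in>{card (edges \<kappa> i)..<q}. degree [:1, - real j:])"
      using degree_prod_sum_le[of "{card (edges \<kappa> i)..<q}" "\<lambda>j. [:1, - real j:]"] by (simp add: comp_def)
    also have "\<dots> \<le> (\<Sum>j\<in>{card (edges \<kappa> i)..<q}. 1)" by (intro sum_mono) simp
    finally show "degree (\<Prod>j\<in>{card (edges \<kappa> i)..<q}. [:1, - real j:]) \<le> q" by simp
  qed
  finally have 4: "degree (\<Prod>i\<in>?S. \<Prod>j\<in>{card (edges \<kappa> i)..<q}. [:1, - real j:]) \<le> q * card ?S"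
    by (simp add: mult.commute)
  have "degree (kernel_poly q \<kappa>) \<le> (1 + ?e - ?v) + ?v + q * (q - card ?S) + q * card ?S"
    unfolding kernel_poly_def
    by (intro order_trans[OF degree_mult_le] add_mono 1 3 4 degree_falling_poly)
  also have "\<dots> = 1 + ?e + q * q"
  proof -
    have "q * (q - card ?S) + q * card ?S = q * (q - card ?S + card ?S)"
      by (simp only: distrib_left)
    then show ?thesis using vertices_le card_used by simp
  qed
  finally show ?thesis using num_edges_le_q by (simp add: power2_eq_square)
qed

lemma poly_kernel_poly:
  assumes n: "q \<le> n"
  shows "poly (kernel_poly q \<kappa>) (1 / real n)
    = poly (falling_poly q ^ q) (1 / real n) * (real (\<Prod>j<card (vertices \<kappa>). n - j) * walk_prob n \<kappa>) / real n"
proof -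
  let ?v = "card (vertices \<kappa>)" and ?e = "num_edges \<kappa>" and ?S = "used \<kappa>"
  define X where "X = 1 / real n"
  define P where "P m = poly (falling_poly m) X" for m
  have n0: "0 < n" using n kq k_pos by simp
  have Ppos: "0 < P m" if "m \<le> q" for m
    unfolding P_def X_def using that n n0 by (intro poly_falling_poly_pos) auto
  define Q where "Q = (\<Prod>i\<in>?S. P (card (edges \<kappa> i)))"
  have Qpos: "0 < Q"
    unfolding Q_def using card_edges_le by (intro prod_pos Ppos) (auto simp: used_def)
  have "(\<Prod>i\<in>?S. \<Prod>j\<in>{card (edges \<kappa> i)..<q}. 1 - real j * X) = (\<Prod>i\<in>?S. P q / P (card (edges \<kappa> i)))"
  proof (rule prod.cong[OF refl])
    fix i assume "i \<in> ?S"
    then have le: "card (edges \<kappa> i) \<le> q" using card_edges_le by (auto simp: used_def)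
    have "{..<q} = {..<card (edges \<kappa> i)} \<union> {card (edges \<kappa> i)..<q}" using le by auto
    then have "P q = P (card (edges \<kappa> i)) * (\<Prod>j\<in>{card (edges \<kappa> i)..<q}. 1 - real j * X)"
      unfolding P_def poly_falling_poly by (simp add: prod.union_disjoint[symmetric] ivl_disj_int)
    then show "(\<Prod>j\<in>{card (edges \<kappa> i)..<q}. 1 - real j * X) = P q / P (card (edges \<kappa> i))"
      using Ppos[OF le] by simp
  qed
  then have A: "(\<Prod>i\<in>?S. \<Prod>j\<in>{card (edges \<kappa> i)..<q}. 1 - real j * X) = P q ^ card ?S / Q"
    by (simp add: Q_def prod_dividef)
  have "walk_prob n \<kappa> = (\<Prod>i<r. 1 / (real n ^ card (edges \<kappa> i) * P (card (edges \<kappa> i))))"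
    unfolding walk_prob_def using cons
  proof (simp, intro prod.cong refl)
    fix i assume "i \<in> {..<r}"
    then have le: "card (edges \<kappa> i) \<le> n" using card_edges_le[of i] n by simp
    have "fact n = real n ^ card (edges \<kappa> i) * P (card (edges \<kappa> i)) * fact (n - card (edges \<kappa> i))"
      using fact_falling[OF le] prod_falling[OF le n0] by (simp add: P_def X_def)
    moreover have "P (card (edges \<kappa> i)) \<noteq> 0" using Ppos[of "card (edges \<kappa> i)"] card_edges_le[of i] \<open>i \<in> {..<r}\<close> by simp
    ultimately show "fact (n - card (edges \<kappa> i)) / fact n = 1 / (real n ^ card (edges \<kappa> i) * P (card (edges \<kappa> i)))"
      using n0 by (simp add: field_simps)
  qed
  also have "\<dots> = 1 / ((\<Prod>i<r. real n ^ card (edges \<kappa> i)) * (\<Prod>i<r. P (card (edges \<kappa> i))))"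
    by (simp add: prod_dividef prod.distrib)
  also have "(\<Prod>i<r. real n ^ card (edges \<kappa> i)) = real n ^ ?e"
    by (simp add: num_edges_def power_sum)
  also have "(\<Prod>i<r. P (card (edges \<kappa> i))) = Q"
    unfolding Q_def used_def by (rule prod.mono_neutral_right) (auto simp: P_def poly_falling_poly)
  finally have W: "walk_prob n \<kappa> = 1 / (real n ^ ?e * Q)" .
  have V: "real (\<Prod>j<?v. n - j) = real n ^ ?v * P ?v"
    using prod_falling[of ?v n] vertices_le num_edges_le_q n n0 by (simp add: P_def X_def)
  have "poly (kernel_poly q \<kappa>) X = X ^ (1 + ?e - ?v) * P ?v * P q ^ (q - card ?S) * (P q ^ card ?S / Q)"
    unfolding A[symmetric] by (simp add: kernel_poly_def poly_prod P_def algebra_simps)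
  also have "\<dots> = X ^ (1 + ?e - ?v) * P ?v * (P q ^ (q - card ?S + card ?S)) / Q"
    by (simp add: power_add)
  also have "q - card ?S + card ?S = q" using card_used by simp
  also have "X ^ (1 + ?e - ?v) = real n ^ ?v / (real n ^ ?e * real n)"
  proof -
    have "real n ^ (1 + ?e - ?v) * real n ^ ?v = real n ^ ?e * real n"
      using vertices_le by (simp flip: power_add)
    then show ?thesis using n0 by (simp add: X_def field_simps)
  qed
  finally show ?thesis
    unfolding W V by (simp add: X_def[symmetric] P_def mult.commute mult.left_commute)
qed

lemma poly_kernel_poly_0: "poly (kernel_poly q \<kappa>) 0 = 0"
  using vertices_le by (simp add: kernel_poly_def zero_power)

text \<open>Apart from the power of the variable, all factors have constant term 1, so the linear
  coefficient is nonzero only if that power is the first.\<close>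

lemma pderiv_kernel_poly_0:
  "poly (pderiv (kernel_poly q \<kappa>)) 0 = of_bool (num_edges \<kappa> = card (vertices \<kappa>))"
proof -
  define R where "R = falling_poly (card (vertices \<kappa>)) * falling_poly q ^ (q - card (used \<kappa>))
     * (\<Prod>i\<in>used \<kappa>. \<Prod>j\<in>{card (edges \<kappa> i)..<q}. [:1, - real j:])"
  define m where "m = num_edges \<kappa> - card (vertices \<kappa>)"
  have R0: "poly R 0 = 1"
    by (simp add: R_def poly_prod)
  have "kernel_poly q \<kappa> = [:0, 1:] * ([:0, 1:] ^ m * R)"
    using vertices_le by (simp add: kernel_poly_def R_def m_def mult.assoc Suc_diff_le)
  then have "poly (pderiv (kernel_poly q \<kappa>)) 0 = poly ([:0, 1:] ^ m * R) 0"
    by (simp add: pderiv_mult pderiv_pCons del: mult_pCons_left)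
  also have "\<dots> = of_bool (m = 0)" using R0 by (simp add: power_0_left)
  finally show ?thesis using vertices_le by (auto simp: m_def)
qed

end

lemma ex_cyclic_word_poly:
  assumes "k \<le> q"
  shows "\<exists>F. degree F \<le> q\<^sup>2 + q + 1
    \<and> (\<forall>n\<ge>q. poly F (1 / real n)
        = poly (falling_poly q ^ q) (1 / real n) * average n r (\<lambda>\<sigma>. fixed_points n \<sigma> z) / real n)
    \<and> poly F 0 = 0 \<and> poly (pderiv F) 0 = real (card unicyclic_kernels)"
proof (intro exI conjI allI impI)
  let ?K = "{\<kappa> \<in> kernels. consistent \<kappa>}"
  let ?F = "\<Sum>\<kappa>\<in>?K. kernel_poly q \<kappa>"
  show "degree ?F \<le> q\<^sup>2 + q + 1"
    by (intro degree_sum_le degree_kernel_poly[OF _ assms]) auto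
  show "poly ?F 0 = 0"
    by (simp add: poly_sum poly_kernel_poly_0[OF _ assms])
  have "poly (pderiv ?F) 0 = (\<Sum>\<kappa>\<in>?K. of_bool (num_edges \<kappa> = card (vertices \<kappa>)))"
    by (simp add: pderiv_sum poly_sum pderiv_kernel_poly_0[OF _ assms])
  also have "\<dots> = real (card {\<kappa> \<in> ?K. num_edges \<kappa> = card (vertices \<kappa>)})"
    by (simp add: of_bool_def sum.If_cases Int_def)
  also have "{\<kappa> \<in> ?K. num_edges \<kappa> = card (vertices \<kappa>)} = unicyclic_kernels"
    by (auto simp: unicyclic_kernels_def)
  finally show "poly (pderiv ?F) 0 = real (card unicyclic_kernels)" .
  fix n assume n: "q \<le> n"
  have "poly ?F (1 / real n) = (\<Sum>\<kappa>\<in>?K. poly (falling_poly q ^ q) (1 / real n)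
      * (real (\<Prod>j<card (vertices \<kappa>). n - j) * walk_prob n \<kappa>) / real n)"
    unfolding poly_sum by (intro sum.cong refl poly_kernel_poly[OF _ assms n]) auto
  also have "\<dots> = poly (falling_poly q ^ q) (1 / real n)
      * (\<Sum>\<kappa>\<in>?K. real (\<Prod>j<card (vertices \<kappa>). n - j) * walk_prob n \<kappa>) / real n"
    by (simp only: sum_distrib_left sum_divide_distrib)
  also have "(\<Sum>\<kappa>\<in>?K. real (\<Prod>j<card (vertices \<kappa>). n - j) * walk_prob n \<kappa>)
      = (\<Sum>\<kappa>\<in>kernels. real (\<Prod>j<card (vertices \<kappa>). n - j) * walk_prob n \<kappa>)"
    by (rule sum.mono_neutral_left) (auto simp: walk_prob_def)
  finally show "poly ?F (1 / real n)
      = poly (falling_poly q ^ q) (1 / real n) * average n r (\<lambda>\<sigma>. fixed_points n \<sigma> z) / real n"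
    by (simp add: average_fixed_points_kernels)
qed

end

text \<open>Up to an explicit denominator, the mean number of fixed points is a polynomial in \<open>1 / n\<close>.
  The term of order \<open>n\<close> only comes from trivial words, and a word that is not a power contributes
  exactly 1, which the eigenvalue 1 of the constants will cancel.\<close>

definition word_poly :: "nat \<Rightarrow> nat \<Rightarrow> letter list \<Rightarrow> real poly \<Rightarrow> bool" where
  "word_poly q r w F \<longleftrightarrow> degree F \<le> q\<^sup>2 + q + 1
    \<and> (\<forall>n\<ge>q. poly F (1 / real n)
        = poly (falling_poly q ^ q) (1 / real n) * average n r (\<lambda>\<sigma>. fixed_points n \<sigma> w) / real n)
    \<and> poly F 0 = of_bool (red w = []) \<and> (\<not> power_like w \<longrightarrow> poly (pderiv F) 0 = 1)
    \<and> \<bar>poly (pderiv F) 0\<bar> \<le> real q ^ 3"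

lemma ex_word_poly:
  assumes w: "fst ` set w \<subseteq> {..<r}" "length w \<le> q" and q: "1 \<le> q"
  shows "\<exists>F. word_poly q r w F"
proof (cases "red w = []")
  case True
  \<comment> \<open>Every point is fixed, so the mean divided by n is 1 and only the denominator
    remains.\<close>
  let ?F = "falling_poly q ^ q"
  have avg: "average n r (\<lambda>\<sigma>. fixed_points n \<sigma> w) = real n" for n
  proof -
    have "average n r (\<lambda>\<sigma>. fixed_points n \<sigma> w) = average n r (\<lambda>\<sigma>. real n)"
    proof (rule average_cong)
      fix \<sigma> assume "\<sigma> \<in> Omega n r"
      then have "fixed_points n \<sigma> w = fixed_points n \<sigma> []" using fixed_points_red[of \<sigma> n r w] True by simp
      then show "fixed_points n \<sigma> w = real n" by (simp add: fixed_points_def)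
    qed
    then show ?thesis by simp
  qed
  have "degree ?F \<le> degree (falling_poly q) * q" by (rule degree_power_le)
  also have "\<dots> \<le> q * q" by (simp add: degree_falling_poly)
  finally have deg: "degree ?F \<le> q\<^sup>2 + q + 1" by (simp add: power2_eq_square)
  obtain q' where q': "q = Suc q'" using q by (cases q) auto
  \<comment> \<open>The bound \<open>q ^ 3\<close> in \<open>word_poly\<close> comes from this case;
    for nontrivial words the slope is at most \<open>q\<close>.\<close>
  have "poly (pderiv ?F) 0 = - (real q * (\<Sum>j<q. real j))"
    unfolding q' pderiv_power_Suc by (simp add: pderiv_falling_poly_0 del: of_nat_Suc sum.lessThan_Suc)
  moreover have "(\<Sum>j<q. real j) \<le> (\<Sum>j<q. real q)" by (intro sum_mono) simp
  then have "real q * (\<Sum>j<q. real j) \<le> real q * (real q * real q)" by (intro mult_left_mono) auto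
  moreover have "0 \<le> real q * (\<Sum>j<q. real j)" by (simp add: sum_nonneg)
  ultimately have "\<bar>poly (pderiv ?F) 0\<bar> \<le> real q ^ 3" by (simp add: power3_eq_cube)
  moreover have "power_like w" using True by (simp add: power_like_def)
  ultimately show ?thesis
    using deg True q by (intro exI[of _ ?F]) (auto simp: avg word_poly_def)
next
  case False
  then obtain y z where yz: "red w = y @ z @ inv_word y" "cyclically_reduced z"
    using reduced_conjugate[OF reduced_red False] by (elim exE conjE) (rule that)
  have "fst ` set z \<subseteq> {..<r}"
    using set_red[of w] w(1) unfolding yz(1) by auto
  then interpret cyclic_word z r using yz(2) by unfold_locales
  have kq: "k \<le> q" using length_red[of w] w(2) by (simp add: yz(1) k_def)
  obtain F where F: "degree F \<le> q\<^sup>2 + q + 1"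
    "\<And>n. q \<le> n \<Longrightarrow> poly F (1 / real n)
        = poly (falling_poly q ^ q) (1 / real n) * average n r (\<lambda>\<sigma>. fixed_points n \<sigma> z) / real n"
    "poly F 0 = 0" "poly (pderiv F) 0 = real (card unicyclic_kernels)"
    using ex_cyclic_word_poly[OF kq] by blast
  have avg: "average n r (\<lambda>\<sigma>. fixed_points n \<sigma> w) = average n r (\<lambda>\<sigma>. fixed_points n \<sigma> z)" for n
  proof (rule average_cong)
    fix \<sigma> assume \<sigma>: "\<sigma> \<in> Omega n r"
    show "fixed_points n \<sigma> w = fixed_points n \<sigma> z"
      using fixed_points_red[OF \<sigma>, of w] fixed_points_conjugate[OF \<sigma>, of y z] yz(1) by simp
  qed
  have "poly (pderiv F) 0 = 1" if "\<not> power_like w"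
  proof -
    have "z \<noteq> []" using yz(2) by (simp add: cyclically_reduced_def)
    have "\<nexists>v m. 2 \<le> m \<and> z = concat (replicate m v)"
    proof
      assume "\<exists>v m. 2 \<le> m \<and> z = concat (replicate m v)"
      then obtain v m where "2 \<le> m" "z = concat (replicate m v)" by blast
      moreover from this \<open>z \<noteq> []\<close> have "v \<noteq> []" by auto
      ultimately have "power_like w" using yz(1) by (auto simp: power_like_def)
      with that show False by simp
    qed
    then show ?thesis by (simp add: F(4) unicyclic_kernels_eq)
  qed
  moreover have "real (card unicyclic_kernels) \<le> real q ^ 3"
  proof -
    have "real (card unicyclic_kernels) \<le> real q" using card_unicyclic_kernels_le kq by simp
    also have "\<dots> \<le> real q ^ 3" using q by (intro self_le_power) auto
    finally show ?thesis .
  qed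
  ultimately show ?thesis
    using F False by (intro exI[of _ F]) (auto simp: avg word_poly_def)
qed

section \<open>Markov's inequality\<close>

definition cosine_poly :: "nat \<Rightarrow> (real \<Rightarrow> real) \<Rightarrow> bool" where
  "cosine_poly D f \<longleftrightarrow> (\<exists>a. \<forall>t. f t = (\<Sum>k\<le>D. a k * cos (real k * t)))"

lemma cosine_poly_add:
  assumes "cosine_poly D f" "cosine_poly D g"
  shows "cosine_poly D (\<lambda>t. f t + g t)"
proof -
  obtain a b where "\<forall>t. f t = (\<Sum>k\<le>D. a k * cos (real k * t))" "\<forall>t. g t = (\<Sum>k\<le>D. b k * cos (real k * t))"
    using assms by (auto simp: cosine_poly_def)
  then show ?thesis
    unfolding cosine_poly_def by (intro exI[of _ "\<lambda>k. a k + b k"]) (simp add: sum.distrib algebra_simps)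
qed

lemma cosine_poly_cmult:
  assumes "cosine_poly D f"
  shows "cosine_poly D (\<lambda>t. c * f t)"
proof -
  obtain a where "\<forall>t. f t = (\<Sum>k\<le>D. a k * cos (real k * t))"
    using assms by (auto simp: cosine_poly_def)
  then show ?thesis
    unfolding cosine_poly_def by (intro exI[of _ "\<lambda>k. c * a k"]) (simp add: sum_distrib_left algebra_simps)
qed

lemma cosine_poly_cos:
  assumes "k \<le> D"
  shows "cosine_poly D (\<lambda>t. cos (real k * t))"
  unfolding cosine_poly_def
proof (intro exI allI)
  fix t
  have "(\<Sum>j\<le>D. (if j = k then 1 else 0) * cos (real j * t)) = (\<Sum>j\<in>{k}. cos (real j * t))"
    using assms by (intro sum.mono_neutral_cong_right) auto
  then show "cos (real k * t) = (\<Sum>j\<le>D. (if j = k then 1 else 0) * cos (real j * t))" by simp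
qed

lemma cosine_poly_sum:
  "(\<And>x. x \<in> A \<Longrightarrow> cosine_poly D (f x)) \<Longrightarrow> cosine_poly D (\<lambda>t. \<Sum>x\<in>A. f x t)"
proof (induction A rule: infinite_finite_induct)
  case (insert x A)
  then show ?case by (simp add: cosine_poly_add)
qed (auto simp: cosine_poly_def intro!: exI[of _ "\<lambda>_. 0"])

lemma cosine_poly_mult_cos:
  assumes "cosine_poly D f"
  shows "cosine_poly (Suc D) (\<lambda>t. cos t * f t)"
proof -
  obtain a where a: "\<And>t. f t = (\<Sum>k\<le>D. a k * cos (real k * t))"
    using assms by (auto simp: cosine_poly_def)
  \<comment> \<open>For \<open>k = 0\<close> the frequency k - 1 would be -1; the cosine is even, so
    1 takes its place.\<close>
  have *: "cos t * cos (real k * t) = 1 / 2 * cos (real (Suc k) * t) + 1 / 2 * cos (real (if k = 0 then 1 else k - 1) * t)" for t k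
  proof (cases k)
    case (Suc j)
    have "cos (real (Suc k) * t) = cos (t + real k * t)" "cos (real j * t) = cos (t - real k * t)"
      using cos_minus[of "t - real k * t"] by (simp_all add: Suc algebra_simps)
    then have "cos (real (Suc k) * t) + cos (real j * t) = 2 * (cos t * cos (real k * t))"
      by (simp add: cos_add cos_diff)
    then show ?thesis by (simp add: Suc)
  qed simp
  have "cosine_poly (Suc D) (\<lambda>t. cos t * cos (real k * t))" if "k \<le> D" for k
    unfolding * using that
    by (intro cosine_poly_add cosine_poly_cmult cosine_poly_cos) auto
  then have "cosine_poly (Suc D) (\<lambda>t. \<Sum>k\<le>D. a k * (cos t * cos (real k * t)))"
    by (intro cosine_poly_sum cosine_poly_cmult) auto
  moreover have "cos t * f t = (\<Sum>k\<le>D. a k * (cos t * cos (real k * t)))" for t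
    by (simp add: a sum_distrib_left algebra_simps)
  ultimately show ?thesis by simp
qed

lemma cosine_poly_mono:
  assumes "cosine_poly D f" "D \<le> D'"
  shows "cosine_poly D' f"
proof -
  obtain a where a: "\<And>t. f t = (\<Sum>k\<le>D. a k * cos (real k * t))"
    using assms by (auto simp: cosine_poly_def)
  have "cosine_poly D' (\<lambda>t. \<Sum>k\<le>D. a k * cos (real k * t))"
    using assms(2) by (intro cosine_poly_sum cosine_poly_cmult cosine_poly_cos) auto
  moreover have "f = (\<lambda>t. \<Sum>k\<le>D. a k * cos (real k * t))" by (rule ext) (rule a)
  ultimately show ?thesis by simp
qed

lemma cosine_poly_poly:
  assumes "degree p \<le> D"
  shows "cosine_poly D (\<lambda>t. poly p (cos t))"
proof -
  have pow: "cosine_poly k (\<lambda>t. cos t ^ k)" for k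
  proof (induction k)
    case 0
    show ?case using cosine_poly_cos[of 0 0] by simp
  next
    case (Suc k)
    then show ?case using cosine_poly_mult_cos by simp
  qed
  have "cosine_poly D (\<lambda>t. \<Sum>k\<le>degree p. coeff p k * cos t ^ k)"
    using assms by (intro cosine_poly_sum cosine_poly_cmult cosine_poly_mono[OF pow]) auto
  then show ?thesis by (simp add: poly_altdef)
qed

lemma has_integral_cos_int:
  "((\<lambda>t. cos (of_int m * t)) has_integral (if m = 0 then 2 * pi else 0)) {0..2 * pi}"
proof (cases "m = 0")
  case True
  then show ?thesis using has_integral_const_real[of "1::real" 0 "2 * pi"] by simp
next
  case False
  have "((\<lambda>t. cos (of_int m * t)) has_integral
      sin (of_int m * (2 * pi)) / of_int m - sin (of_int m * 0) / of_int m) {0..2 * pi}"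
    by (rule fundamental_theorem_of_calculus)
      (use False in \<open>auto intro!: derivative_eq_intros simp: has_real_derivative_iff_has_vector_derivative[symmetric]\<close>)
  moreover have "sin (of_int m * (2 * pi)) = 0"
    using sin_int_2pin[of m] by (simp add: mult.commute)
  ultimately show ?thesis using False by simp
qed

text \<open>Orthogonality of the cosines: integrating \<open>f\<close> against the j-th cosine over
  a full period returns \<open>a j\<close> times pi, or 2 pi for j = 0, and the integral is at most
  2 pi times \<open>S\<close>.\<close>

lemma cosine_coeff_bound:
  assumes f: "\<And>t. f t = (\<Sum>k\<le>D. a k * cos (real k * t))" and S: "\<And>t. \<bar>f t\<bar> \<le> S" and j: "j \<le> D"
  shows "\<bar>a j\<bar> \<le> 2 * S"
proof -
  let ?I = "\<lambda>m::int. if m = 0 then 2 * pi else 0"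
  define I where "I = (\<Sum>k\<le>D. a k * ((?I (int k + int j) + ?I (int k - int j)) / 2))"
  have "((\<lambda>t. \<Sum>k\<le>D. a k * ((cos (of_int (int k + int j) * t) + cos (of_int (int k - int j) * t)) / 2))
      has_integral I) {0..2 * pi}"
    unfolding I_def
    by (intro has_integral_sum has_integral_mult_right has_integral_divide has_integral_add has_integral_cos_int) auto
  moreover have "(\<Sum>k\<le>D. a k * ((cos (of_int (int k + int j) * t) + cos (of_int (int k - int j) * t)) / 2))
      = f t * cos (real j * t)" for t
    unfolding f sum_distrib_right
    by (intro sum.cong refl) (simp add: distrib_right left_diff_distrib cos_add cos_diff)
  ultimately have int: "((\<lambda>t. f t * cos (real j * t)) has_integral I) {0..2 * pi}" by simp
  have "norm (f t * cos (real j * t)) \<le> S" for t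
  proof -
    have "\<bar>f t\<bar> * \<bar>cos (real j * t)\<bar> \<le> S * 1"
      by (intro mult_mono S) (use S[of t] in auto)
    then show ?thesis by (simp add: abs_mult)
  qed
  moreover have "0 \<le> S" using S[of 0] by linarith
  ultimately have "\<bar>I\<bar> \<le> S * (2 * pi)"
    using has_integral_bound[of S "\<lambda>t. f t * cos (real j * t)" I 0 "2 * pi"] int by simp
  moreover have "I = a j * (if j = 0 then 2 * pi else pi)"
  proof -
    have "I = (\<Sum>k\<in>{j}. a k * ((?I (int k + int j) + ?I (int k - int j)) / 2))"
      unfolding I_def using j by (intro sum.mono_neutral_right) auto
    then show ?thesis by (cases "j = 0") simp_all
  qed
  moreover have "\<bar>a j\<bar> * pi \<le> \<bar>a j * (if j = 0 then 2 * pi else pi)\<bar>"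
    unfolding abs_mult by (intro mult_left_mono) auto
  ultimately have "\<bar>a j\<bar> * pi \<le> S * (2 * pi)" by (metis order_trans)
  then have "\<bar>a j\<bar> * pi \<le> (2 * S) * pi" by (simp only: ac_simps)
  then show ?thesis by (rule mult_right_le_imp_le) (rule pi_gt_zero)
qed

text \<open>Differentiating p (cos t) produces a factor sin t, which this bound for the Chebyshev
  polynomials of the second kind allows to be cancelled.\<close>

lemma abs_sin_mult_le: "\<bar>sin (real k * t)\<bar> \<le> real k * \<bar>sin t\<bar>"
proof (induction k)
  case (Suc k)
  have "\<bar>sin (real (Suc k) * t)\<bar> = \<bar>sin t * cos (real k * t) + cos t * sin (real k * t)\<bar>"
    by (simp add: distrib_right sin_add algebra_simps)
  also have "\<dots> \<le> \<bar>sin t\<bar> * \<bar>cos (real k * t)\<bar> + \<bar>cos t\<bar> * \<bar>sin (real k * t)\<bar>"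
    by (metis abs_mult abs_triangle_ineq)
  also have "\<dots> \<le> \<bar>sin t\<bar> * 1 + 1 * \<bar>sin (real k * t)\<bar>"
    by (intro add_mono mult_left_mono mult_right_mono) auto
  finally show ?case using Suc by (simp add: algebra_simps)
qed simp

text \<open>A weak form of Markov's inequality: the exponent 3 in place of 2 comes from bounding the
  Chebyshev coefficients of \<open>p\<close> one by one.\<close>

lemma Markov_inequality:
  fixes p :: "real poly"
  assumes deg: "degree p \<le> D" and S: "\<And>x. -1 \<le> x \<Longrightarrow> x \<le> 1 \<Longrightarrow> \<bar>poly p x\<bar> \<le> S"
    and x: "-1 \<le> x" "x \<le> 1"
  shows "\<bar>poly (pderiv p) x\<bar> \<le> 2 * real (D + 1) ^ 3 * S"
proof -
  obtain a where a: "\<And>t. poly p (cos t) = (\<Sum>k\<le>D. a k * cos (real k * t))"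
    using cosine_poly_poly[OF deg] by (auto simp: cosine_poly_def)
  have S': "\<bar>poly p (cos t)\<bar> \<le> S" for t by (rule S) auto
  have S0: "0 \<le> S" using S'[of 0] by linarith
  have aS: "\<bar>a k\<bar> \<le> 2 * S" if "k \<le> D" for k
    using cosine_coeff_bound[OF a S' that] .
  let ?B = "2 * real (D + 1) ^ 3 * S"
  have inner: "\<bar>poly (pderiv p) y\<bar> \<le> ?B" if y: "-1 < y" "y < 1" for y
  proof -
    define t where "t = arccos y"
    have t: "cos t = y" "0 < sin t"
      using y arccos_lt_bounded[of y] by (auto simp: t_def intro!: sin_gt_zero)
    have "((\<lambda>t. poly p (cos t)) has_real_derivative poly (pderiv p) (cos t) * - sin t) (at t)"
      by (rule DERIV_chain2[OF poly_DERIV]) (auto intro!: derivative_eq_intros)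
    moreover have "((\<lambda>t. \<Sum>k\<le>D. a k * cos (real k * t)) has_real_derivative
        (\<Sum>k\<le>D. a k * (- sin (real k * t) * real k))) (at t)"
      by (auto intro!: derivative_eq_intros sum.cong)
    ultimately have "poly (pderiv p) y * - sin t = (\<Sum>k\<le>D. a k * (- sin (real k * t) * real k))"
      using DERIV_unique t(1) unfolding a by blast
    then have "\<bar>poly (pderiv p) y\<bar> * sin t = \<bar>\<Sum>k\<le>D. a k * (- sin (real k * t) * real k)\<bar>"
      using t(2) by (metis abs_minus_cancel abs_mult abs_of_pos)
    also have "\<dots> \<le> (\<Sum>k\<le>D. \<bar>a k * (- sin (real k * t) * real k)\<bar>)" by (rule sum_abs)
    also have "\<dots> \<le> (\<Sum>k\<le>D. (2 * S) * ((real D * sin t) * real D))"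
    proof (rule sum_mono)
      fix k assume k: "k \<in> {..D}"
      have "\<bar>sin (real k * t)\<bar> \<le> real k * sin t" using abs_sin_mult_le[of k t] t(2) by simp
      also have "\<dots> \<le> real D * sin t" using k t(2) by (intro mult_right_mono) auto
      finally have "\<bar>a k\<bar> * (\<bar>sin (real k * t)\<bar> * real k) \<le> (2 * S) * ((real D * sin t) * real D)"
        using k aS S0 t(2) by (intro mult_mono) auto
      then show "\<bar>a k * (- sin (real k * t) * real k)\<bar> \<le> (2 * S) * ((real D * sin t) * real D)"
        by (simp add: abs_mult)
    qed
    also have "\<dots> = (2 * S * (real (D + 1) * real D * real D)) * sin t" by (simp add: algebra_simps)
    finally have "\<bar>poly (pderiv p) y\<bar> \<le> 2 * S * (real (D + 1) * real D * real D)"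
      using t(2) by (rule mult_right_le_imp_le)
    also have "\<dots> \<le> 2 * S * (real (D + 1) * real (D + 1) * real (D + 1))"
      using S0 by (intro mult_left_mono mult_mono) auto
    finally show ?thesis by (simp add: power3_eq_cube algebra_simps)
  qed
  \<comment> \<open>At the endpoints sin t = 0 and the division fails; there the bound follows by
    continuity.\<close>
  have "closed {y. \<bar>poly (pderiv p) y\<bar> \<le> ?B}"
    by (intro closed_Collect_le continuous_intros)
  moreover have "{-1<..<1} \<subseteq> {y. \<bar>poly (pderiv p) y\<bar> \<le> ?B}" using inner by auto
  ultimately have "closure {-1<..<1} \<subseteq> {y. \<bar>poly (pderiv p) y\<bar> \<le> ?B}"
    by (rule closure_minimal[rotated])
  then show ?thesis using x by auto
qed

lemma Markov_inequality_interval: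
  fixes p :: "real poly"
  assumes deg: "degree p \<le> D" and h: "0 < h" and S: "\<And>x. 0 \<le> x \<Longrightarrow> x \<le> h \<Longrightarrow> \<bar>poly p x\<bar> \<le> S"
    and x: "0 \<le> x" "x \<le> h"
  shows "\<bar>poly (pderiv p) x\<bar> \<le> 4 * real (D + 1) ^ 3 * S / h"
proof -
  define g where "g = pcompose p [:h / 2, h / 2:]"
  have deg_g: "degree g \<le> D"
    unfolding g_def using deg h by simp
  have "\<bar>poly g y\<bar> \<le> S" if "-1 \<le> y" "y \<le> 1" for y
  proof -
    have "0 \<le> h / 2 * (1 + y)" using that h by (intro mult_nonneg_nonneg) auto
    moreover have "h / 2 * (1 + y) \<le> h / 2 * 2" using that h by (intro mult_left_mono) auto
    ultimately have "\<bar>poly p (h / 2 * (1 + y))\<bar> \<le> S" by (intro S) auto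
    moreover have "poly [:h / 2, h / 2:] y = h / 2 * (1 + y)" by (simp add: field_simps)
    ultimately show ?thesis by (simp only: g_def poly_pcompose)
  qed
  moreover have "-1 \<le> 2 * x / h - 1" "2 * x / h - 1 \<le> 1" using x h by (auto simp: field_simps)
  ultimately have "\<bar>poly (pderiv g) (2 * x / h - 1)\<bar> \<le> 2 * real (D + 1) ^ 3 * S"
    by (rule Markov_inequality[OF deg_g])
  moreover have "poly (pderiv g) (2 * x / h - 1) = poly (pderiv p) x * (h / 2)"
    using h by (simp add: g_def pderiv_pcompose poly_pcompose pderiv_pCons field_simps)
  ultimately show ?thesis using h by (simp add: abs_mult field_simps)
qed

text \<open>The reciprocals \<open>1 / n\<close> are so dense near 0 that Markov's inequality carries a bound at
  these points over to the whole interval.\<close>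

lemma poly_bound_of_reciprocals:
  fixes F :: "real poly"
  assumes deg: "degree F \<le> D" and L: "8 * (D + 1) ^ 3 \<le> L"
    and F: "\<And>n. L \<le> n \<Longrightarrow> \<bar>poly F (1 / real n)\<bar> \<le> 1"
    and x: "0 \<le> x" "x \<le> 1 / real L"
  shows "\<bar>poly F x\<bar> \<le> 2"
proof -
  have L1: "1 \<le> L" using L by (rule le_trans[rotated]) simp
  have L0: "0 < real L" using L1 by simp
  have "compact {0..1 / real L}" "{0..1 / real L} \<noteq> {}" using L0 by auto
  moreover have "continuous_on {0..1 / real L} (\<lambda>x. \<bar>poly F x\<bar>)" by (intro continuous_intros)
  ultimately obtain y where y: "y \<in> {0..1 / real L}" "\<And>x. x \<in> {0..1 / real L} \<Longrightarrow> \<bar>poly F x\<bar> \<le> \<bar>poly F y\<bar>"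
    using continuous_attains_sup by metis
  define S where "S = \<bar>poly F y\<bar>"
  have S: "\<bar>poly F x\<bar> \<le> S" if "0 \<le> x" "x \<le> 1 / real L" for x
    using y(2)[of x] that by (simp add: S_def)
  have D: "\<bar>poly (pderiv F) x\<bar> \<le> 4 * real (D + 1) ^ 3 * S * real L" if "0 \<le> x" "x \<le> 1 / real L" for x
    using Markov_inequality_interval[OF deg _ S that] L0 by simp
  \<comment> \<open>Consecutive reciprocals beyond \<open>L\<close> differ by at most 1 / L^2. The
    mean value theorem will be applied between the maximum point \<open>y\<close> and such a
    reciprocal.\<close>
  have "\<exists>n\<ge>L. \<bar>y - 1 / real n\<bar> \<le> 1 / (real L)\<^sup>2"
  proof (cases "y = 0")
    case True
    have "L \<le> L * L" using L1 by simp
    with True show ?thesis by (intro exI[of _ "L * L"]) (auto simp: power2_eq_square)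
  next
    case False
    then have y0: "0 < y" "y \<le> 1 / real L" using y(1) by auto
    define m where "m = nat \<lfloor>1 / y\<rfloor>"
    have Ly: "real L \<le> 1 / y" using y0 L0 by (simp add: field_simps)
    then have Lm: "L \<le> m" unfolding m_def by (simp add: le_nat_floor)
    have "real m = of_int \<lfloor>1 / y\<rfloor>" using y0 by (simp add: m_def)
    then have m: "real m \<le> 1 / y" "1 / y < real m + 1" by linarith+
    have m0: "0 < real m" using Lm L0 by simp
    have "y \<le> 1 / real m" "1 / (real m + 1) \<le> y" using m y0 m0 by (auto simp: field_simps)
    then have "\<bar>y - 1 / real (Suc m)\<bar> \<le> 1 / real m - 1 / (real m + 1)" by (simp add: abs_if algebra_simps)
    also have "\<dots> = 1 / (real m * (real m + 1))" using m0 by (simp add: field_simps)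
    also have "\<dots> \<le> 1 / (real L)\<^sup>2"
      unfolding power2_eq_square using Lm L0 by (intro divide_left_mono mult_mono mult_pos_pos) auto
    finally show ?thesis using Lm by (intro exI[of _ "Suc m"]) auto
  qed
  then obtain n where n: "L \<le> n" "\<bar>y - 1 / real n\<bar> \<le> 1 / (real L)\<^sup>2" by blast
  have n0: "0 < real n" using n(1) L0 by simp
  have n_le: "0 \<le> 1 / real n" "1 / real n \<le> 1 / real L" using n(1) L0 n0 by (auto simp: field_simps)
  have "\<bar>poly F y - poly F (1 / real n)\<bar> \<le> (4 * real (D + 1) ^ 3 * S * real L) * \<bar>y - 1 / real n\<bar>"
  proof -
    have mvt: "\<bar>poly F b - poly F a\<bar> \<le> (4 * real (D + 1) ^ 3 * S * real L) * \<bar>b - a\<bar>"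
      if ab: "a < b" "0 \<le> a" "b \<le> 1 / real L" for a b
    proof -
      obtain c where "a < c" "c < b" "poly F b - poly F a = (b - a) * poly (pderiv F) c"
        using poly_MVT[OF ab(1)] by blast
      moreover from this have "\<bar>poly (pderiv F) c\<bar> \<le> 4 * real (D + 1) ^ 3 * S * real L"
        using ab by (intro D) auto
      ultimately show ?thesis
        by (simp only: abs_mult mult.commute[of "\<bar>b - a\<bar>"] mult_right_mono abs_ge_zero)
    qed
    consider "y = 1 / real n" | "y < 1 / real n" | "1 / real n < y" by linarith
    then show ?thesis
    proof cases
      case 2
      then have "\<bar>poly F (1 / real n) - poly F y\<bar> \<le> (4 * real (D + 1) ^ 3 * S * real L) * \<bar>1 / real n - y\<bar>"
        using y(1) n_le by (intro mvt) auto
      then show ?thesis by (simp only: abs_minus_commute)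
    next
      case 3
      then show ?thesis using y(1) n_le by (intro mvt) auto
    qed (simp only: diff_self abs_zero mult_zero_right order_refl)
  qed
  also have "\<dots> \<le> (4 * real (D + 1) ^ 3 * S * real L) * (1 / (real L)\<^sup>2)"
    using n(2) by (intro mult_left_mono) (auto simp: S_def)
  also have "\<dots> = (4 * real (D + 1) ^ 3) * S / real L" using L0 by (simp add: power2_eq_square)
  also have "\<dots> \<le> S / 2"
  proof -
    have "8 * real (D + 1) ^ 3 \<le> real L" using of_nat_mono[OF L, where 'a = real] by simp
    then have "4 * real (D + 1) ^ 3 * S \<le> (real L / 2) * S" by (intro mult_right_mono) (auto simp: S_def)
    then show ?thesis using L0 by (simp add: field_simps)
  qed
  \<comment> \<open>Markov's inequality bounds the derivative in terms of the unknown maximum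
    \<open>S\<close> itself; the size of \<open>L\<close> turns this into \<open>S\<close> at most 1
    + \<open>S\<close> / 2, which can be solved for \<open>S\<close>.\<close>
  finally have "S \<le> 2" using F[OF n(1)] unfolding S_def by linarith
  then show ?thesis using S[OF x] by linarith
qed

text \<open>Markov's inequality on [0, 1 / L], used twice, turns the uniform bound 2 into bounds on
  the first two derivatives. The constant 32 is 2 times 4 times 4, and the exponent 6 comes from two
  cubes.\<close>

lemma poly_Taylor_bound_of_reciprocals:
  fixes F :: "real poly"
  assumes deg: "degree F \<le> D" and L: "8 * (D + 1) ^ 3 \<le> L"
    and F: "\<And>n. L \<le> n \<Longrightarrow> \<bar>poly F (1 / real n)\<bar> \<le> 1"
    and x: "0 \<le> x" "x \<le> 1 / real L"
  shows "\<bar>poly F x\<bar> \<le> \<bar>poly F 0\<bar> + \<bar>poly (pderiv F) 0\<bar> * x + 32 * real (D + 1) ^ 6 * (real L)\<^sup>2 * x\<^sup>2"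
proof -
  let ?h = "1 / real L"
  let ?B = "32 * real (D + 1) ^ 6 * (real L)\<^sup>2"
  have L1: "1 \<le> L" using L by (rule le_trans[rotated]) simp
  have L0: "0 < real L" using L1 by simp
  have h: "0 < ?h" using L0 by simp
  have 0: "\<bar>poly F y\<bar> \<le> 2" if "0 \<le> y" "y \<le> ?h" for y
    by (rule poly_bound_of_reciprocals[OF deg L F that])
  have 1: "\<bar>poly (pderiv F) y\<bar> \<le> 8 * real (D + 1) ^ 3 * real L" if "0 \<le> y" "y \<le> ?h" for y
    using Markov_inequality_interval[OF deg h 0 that] by simp
  have deg': "degree (pderiv F) \<le> D" using deg by (simp add: degree_pderiv)
  have 2: "\<bar>poly (pderiv (pderiv F)) y\<bar> \<le> ?B" if "0 \<le> y" "y \<le> ?h" for y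
  proof -
    have six: "real (D + 1) ^ 6 = real (D + 1) ^ 3 * real (D + 1) ^ 3"
      by (simp flip: power_add)
    have "4 * real (D + 1) ^ 3 * (8 * real (D + 1) ^ 3 * real L) / ?h = ?B"
      unfolding six by (simp add: power2_eq_square del: of_nat_add of_nat_Suc)
    then show ?thesis using Markov_inequality_interval[OF deg' h 1 that] by (simp only:)
  qed
  show ?thesis
  proof (cases "x = 0")
    case False
    then have x0: "0 < x" using x by simp
    obtain c where c: "0 < c" "c < x" "poly F x - poly F 0 = (x - 0) * poly (pderiv F) c"
      using poly_MVT[OF x0] by blast
    obtain d where d: "0 < d" "d < c" "poly (pderiv F) c - poly (pderiv F) 0 = (c - 0) * poly (pderiv (pderiv F)) d"
      using poly_MVT[OF c(1)] by blast
    have "\<bar>c * poly (pderiv (pderiv F)) d\<bar> \<le> x * ?B"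
      unfolding abs_mult using c d x 2[of d] by (intro mult_mono) auto
    then have "\<bar>poly (pderiv F) c\<bar> \<le> \<bar>poly (pderiv F) 0\<bar> + x * ?B" using d(3) by simp
    then have "x * \<bar>poly (pderiv F) c\<bar> \<le> x * (\<bar>poly (pderiv F) 0\<bar> + x * ?B)" using x0 by simp
    moreover have "\<bar>poly F x\<bar> \<le> \<bar>poly F 0\<bar> + x * \<bar>poly (pderiv F) c\<bar>"
    proof -
      have "poly F x = poly F 0 + x * poly (pderiv F) c" using c(3) by simp
      then show ?thesis using x0 by (metis abs_mult abs_of_pos abs_triangle_ineq)
    qed
    ultimately show ?thesis by (simp add: algebra_simps power2_eq_square)
  qed simp
qed

section \<open>Complex matrices\<close>

subsection \<open>Traces of powers of complex matrices\<close>

definition mat_trace :: "nat \<Rightarrow> complex mat \<Rightarrow> complex" where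
  "mat_trace n A = (\<Sum>i<n. A $$ (i, i))"

lemma index_mult_mat_sum:
  "A \<in> carrier_mat n n \<Longrightarrow> B \<in> carrier_mat n n \<Longrightarrow> x < n \<Longrightarrow> y < n
    \<Longrightarrow> (A * B) $$ (x, y) = (\<Sum>z<n. A $$ (x, z) * B $$ (z, y))"
  by (simp add: scalar_prod_def atLeast0LessThan)

lemma mat_trace_commute:
  assumes "A \<in> carrier_mat n n" "B \<in> carrier_mat n n"
  shows "mat_trace n (A * B) = mat_trace n (B * A)"
proof -
  have "mat_trace n (A * B) = (\<Sum>i<n. \<Sum>j<n. A $$ (i, j) * B $$ (j, i))"
    unfolding mat_trace_def using assms by (intro sum.cong refl index_mult_mat_sum) auto
  also have "\<dots> = (\<Sum>j<n. \<Sum>i<n. A $$ (i, j) * B $$ (j, i))"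
    by (rule sum.swap)
  also have "\<dots> = (\<Sum>j<n. \<Sum>i<n. B $$ (j, i) * A $$ (i, j))"
    by (simp add: mult.commute)
  also have "\<dots> = mat_trace n (B * A)"
    unfolding mat_trace_def using assms by (intro sum.cong refl index_mult_mat_sum[symmetric]) auto
  finally show ?thesis .
qed

lemma upper_triangular_mult:
  assumes A: "A \<in> carrier_mat n n" "upper_triangular A" and B: "B \<in> carrier_mat n n" "upper_triangular B"
  shows "upper_triangular (A * B)" "i < n \<Longrightarrow> (A * B) $$ (i, i) = A $$ (i, i) * B $$ (i, i :: nat) "
proof -
  have zero: "A $$ (x, z) * B $$ (z, y) = 0" if "x < n" "z < n" "y \<le> x" "z \<noteq> x \<or> y < x" for x y z
    using that A B by (cases "z < x") (auto simp: upper_triangular_def)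
  show "upper_triangular (A * B)"
  proof (rule upper_triangularI)
    fix x y assume "y < x" "x < dim_row (A * B)"
    then show "(A * B) $$ (x, y) = 0"
      using A B zero by (subst index_mult_mat_sum[of _ n]) (auto intro!: sum.neutral)
  qed
  assume i: "i < n"
  then have "(A * B) $$ (i, i) = (\<Sum>z<n. A $$ (i, z) * B $$ (z, i))"
    using A B by (intro index_mult_mat_sum)
  also have "\<dots> = (\<Sum>z\<in>{i}. A $$ (i, z) * B $$ (z, i))"
    using i zero by (intro sum.mono_neutral_right) auto
  finally show "(A * B) $$ (i, i) = A $$ (i, i) * B $$ (i, i)" by simp
qed

lemma upper_triangular_pow:
  assumes B: "B \<in> carrier_mat n n" "upper_triangular (B :: complex mat)"
  shows "upper_triangular (B ^\<^sub>m k) \<and> (\<forall>i<n. (B ^\<^sub>m k) $$ (i, i) = B $$ (i, i) ^ k)"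
proof (induction k)
  case 0
  show ?case using B(1) by (auto intro!: upper_triangularI)
next
  case (Suc k)
  have "B ^\<^sub>m k \<in> carrier_mat n n" using B(1) by simp
  then show ?case
    using upper_triangular_mult[of "B ^\<^sub>m k" n B] Suc B by (simp add: mult.commute)
qed

lemma trace_pow_eigenvalues:
  assumes A: "A \<in> carrier_mat n n"
  shows "\<exists>as. length as = n \<and> (\<forall>a\<in>set as. eigenvalue A a)
    \<and> (\<forall>k. mat_trace n (A ^\<^sub>m k) = (\<Sum>a\<leftarrow>as. a ^ k))"
proof -
  obtain as where as: "char_poly A = (\<Prod>a\<leftarrow>as. [:- a, 1:])" "length as = n"
    using char_poly_factorized[OF A] by blast
  obtain B P Q where "schur_decomposition A as = (B, P, Q)"
    by (metis prod_cases3)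
  then have wit: "similar_mat_wit A B P Q" and B: "upper_triangular B" "diag_mat B = as"
    using schur_decomposition[OF A as(1)] by auto
  have carr: "B \<in> carrier_mat n n" "P \<in> carrier_mat n n" "Q \<in> carrier_mat n n" "Q * P = 1\<^sub>m n"
    using similar_mat_witD2[OF A wit] by auto
  have "mat_trace n (A ^\<^sub>m k) = (\<Sum>a\<leftarrow>as. a ^ k)" for k
  proof -
    have Bk: "B ^\<^sub>m k \<in> carrier_mat n n" using carr by simp
    have "mat_trace n (A ^\<^sub>m k) = mat_trace n (P * B ^\<^sub>m k * Q)"
      by (simp add: similar_mat_wit_pow_id[OF wit])
    also have "\<dots> = mat_trace n (Q * (P * B ^\<^sub>m k))"
      using carr Bk by (intro mat_trace_commute) auto
    also have "Q * (P * B ^\<^sub>m k) = B ^\<^sub>m k"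
      using carr Bk by (simp add: assoc_mult_mat[of Q n n P n _ n, symmetric])
    also have "mat_trace n (B ^\<^sub>m k) = (\<Sum>i<n. B $$ (i, i) ^ k)"
      unfolding mat_trace_def using upper_triangular_pow[OF carr(1) B(1)] by simp
    also have "\<dots> = (\<Sum>a\<leftarrow>as. a ^ k)"
      using carr(1) unfolding B(2)[symmetric]
      by (simp add: diag_mat_def sum_list_sum_nth atLeast0LessThan)
    finally show ?thesis .
  qed
  moreover have "eigenvalue A a" if "a \<in> set as" for a
  proof -
    have "poly (char_poly A) a = (\<Prod>x\<leftarrow>as. a - x)"
      unfolding as(1) by (simp add: poly_prod_list comp_def)
    also have "\<dots> = 0" using that by (auto simp: prod_list_zero_iff)
    finally have "poly (char_poly A) a = 0" .
    then show ?thesis using eigenvalue_root_char_poly[OF A] by simp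
  qed
  ultimately show ?thesis using as(2) by blast
qed

lemma eigenvalueE_fun:
  assumes A: "A \<in> carrier_mat n n" and "eigenvalue A (a :: complex)"
  obtains v where "\<exists>x<n. v x \<noteq> 0" "\<And>x. x < n \<Longrightarrow> (\<Sum>z<n. A $$ (x, z) * v z) = a * v x"
proof -
  obtain w where w: "w \<in> carrier_vec n" "w \<noteq> 0\<^sub>v n" "A *\<^sub>v w = a \<cdot>\<^sub>v w"
    using assms by (auto simp: eigenvalue_def eigenvector_def)
  have "\<exists>x<n. w $ x \<noteq> 0"
    using w(1,2) by (metis carrier_vecD eq_vecI index_zero_vec)
  moreover have "(\<Sum>z<n. A $$ (x, z) * w $ z) = a * w $ x" if "x < n" for x
  proof -
    have "(A *\<^sub>v w) $ x = (\<Sum>z<n. A $$ (x, z) * w $ z)"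
      using that w(1) A by (simp add: scalar_prod_def atLeast0LessThan)
    then show ?thesis using that w by simp
  qed
  ultimately show ?thesis using that[of "\<lambda>x. w $ x"] by blast
qed

text \<open>Two of the ordered moduli are at least \<open>\<beta>\<close>, and the factor
  \<open>[:- 1, 1:]\<close> accounts for one root only. Counting with multiplicity also covers a
  multiple eigenvalue 1.\<close>

lemma eigenvalue_modulus_2_imp_eigenvalue:
  assumes "char_poly A = [:- 1, 1:] * char_poly D" "2 \<le> n" "A \<in> carrier_mat n n"
    and "D \<in> carrier_mat m m" "\<beta> \<le> eigenvalue_modulus A 2"
  shows "\<exists>\<mu>. eigenvalue D \<mu> \<and> \<beta> \<le> cmod \<mu>"
proof (rule ccontr)
  assume "\<not> ?thesis"
  then have small: "cmod \<mu> < \<beta>" if "eigenvalue D \<mu>" for \<mu> using that by (auto simp: not_le)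
  have D0: "char_poly D \<noteq> 0" using degree_monic_char_poly[OF assms(4)] by auto
  let ?L = "eigenvalue_moduli A"
  let ?M = "image_mset cmod (proots (char_poly A))"
  have "mset ?L = ?M" by (simp add: eigenvalue_moduli_def)
  also have "proots (char_poly A) = {#1#} + proots (char_poly D)"
    unfolding assms(1) using D0 by (subst proots_mult) (auto simp: proots_linear_factor)
  finally have L: "mset ?L = {#1#} + image_mset cmod (proots (char_poly D))" by simp
  have len: "length ?L = n" by (rule length_eigenvalue_moduli[OF assms(3)])
  have "?L ! 0 \<ge> \<beta>" "?L ! 1 \<ge> \<beta>"
    using eigenvalue_modulus_antimono[OF assms(3), of 1 2] assms(2,5) by (auto simp: eigenvalue_modulus_def)
  moreover obtain a b t where abt: "?L = a # b # t"
    using len assms(2) by (cases ?L; cases "tl ?L") auto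
  ultimately have "a \<ge> \<beta>" "b \<ge> \<beta>" by auto
  then have two: "2 \<le> size (filter_mset (\<lambda>x. \<beta> \<le> x) (mset ?L))" by (simp add: abt)
  have none: "filter_mset (\<lambda>x. \<beta> \<le> x) (image_mset cmod (proots (char_poly D))) = {#}"
  proof -
    have "\<not> \<beta> \<le> cmod x" if "x \<in># proots (char_poly D)" for x
      using that small[of x] D0 eigenvalue_root_char_poly[OF assms(4)] by auto
    then show ?thesis by (auto simp: filter_mset_eq_mempty_iff)
  qed
  have "filter_mset (\<lambda>x. \<beta> \<le> x) (mset ?L) = filter_mset (\<lambda>x. \<beta> \<le> x) {#1#}"
    unfolding L filter_union_mset none by simp
  with two show False by (simp split: if_splits)
qed


subsection \<open>Splitting off the eigenvalue 1 of a matrix with unit row sums\<close>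

text \<open>Replace the first basis vector by the all-ones vector, the first column of
  \<open>S\<close>. The matrix becomes block upper triangular with corner 1, and the other diagonal
  block is the action on the quotient by the constants.\<close>

lemma char_poly_unit_row_sums:
  fixes P :: "complex mat"
  assumes P: "P \<in> carrier_mat (Suc m) (Suc m)" and row: "\<And>x. x < Suc m \<Longrightarrow> (\<Sum>y<Suc m. P $$ (x, y)) = 1"
  shows "char_poly P = [:- 1, 1:] * char_poly (mat m m (\<lambda>(x, y). P $$ (Suc x, Suc y) - P $$ (0, Suc y)))"
proof -
  let ?n = "Suc m"
  define D where "D = mat m m (\<lambda>(x, y). P $$ (Suc x, Suc y) - P $$ (0, Suc y))"
  define B where "B = four_block_mat (1\<^sub>m 1) (mat 1 m (\<lambda>(x, y). P $$ (0, Suc y))) (0\<^sub>m m 1) D"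
  define S :: "complex mat" where "S = mat ?n ?n (\<lambda>(x, y). if y = 0 \<or> x = y then 1 else 0)"
  define T :: "complex mat" where "T = mat ?n ?n (\<lambda>(x, y). if x = y then 1 else if y = 0 then - 1 else 0)"
  have carr: "S \<in> carrier_mat ?n ?n" "T \<in> carrier_mat ?n ?n" "B \<in> carrier_mat ?n ?n" "D \<in> carrier_mat m m"
    by (auto simp: S_def T_def B_def D_def)
  have B: "B $$ (x, y) = (if y = 0 then (if x = 0 then 1 else 0) else if x = 0 then P $$ (0, y) else P $$ (x, y) - P $$ (0, y))"
    if "x < ?n" "y < ?n" for x y
    using that by (cases x; cases y) (auto simp: B_def D_def)
  have sum2: "(\<Sum>z<?n. f z) = f 0 + (if x = 0 then 0 else f x)"
    if "x < ?n" "\<And>z. z < ?n \<Longrightarrow> z \<noteq> 0 \<Longrightarrow> z \<noteq> x \<Longrightarrow> f z = 0" for f :: "nat \<Rightarrow> complex" and x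
  proof -
    have "(\<Sum>z<?n. f z) = (\<Sum>z\<in>{0, x}. f z)" using that by (intro sum.mono_neutral_right) auto
    then show ?thesis by auto
  qed
  have SM: "(S * M) $$ (x, y) = M $$ (0, y) + (if x = 0 then 0 else M $$ (x, y))"
    if "M \<in> carrier_mat ?n ?n" "x < ?n" "y < ?n" for M x y
    using that carr by (subst index_mult_mat_sum[of _ ?n], simp_all only:, subst sum2[of x]) (auto simp: S_def)
  have TM: "(T * M) $$ (x, y) = (if x = 0 then M $$ (0, y) else M $$ (x, y) - M $$ (0, y))"
    if "M \<in> carrier_mat ?n ?n" "x < ?n" "y < ?n" for M x y
    using that carr by (subst index_mult_mat_sum[of _ ?n], simp_all only:, subst sum2[of x]) (auto simp: T_def)
  have PS: "(P * S) $$ (x, y) = (if y = 0 then 1 else P $$ (x, y))" if "x < ?n" "y < ?n" for x y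
  proof -
    have "(P * S) $$ (x, y) = (\<Sum>z<?n. P $$ (x, z) * S $$ (z, y))"
      using that P carr by (intro index_mult_mat_sum)
    also have "\<dots> = (if y = 0 then \<Sum>z<?n. P $$ (x, z) else P $$ (x, y))"
    proof (cases "y = 0")
      case False
      then have "(\<Sum>z<?n. P $$ (x, z) * S $$ (z, y)) = (\<Sum>z\<in>{y}. P $$ (x, z) * S $$ (z, y))"
        using that by (intro sum.mono_neutral_right) (auto simp: S_def)
      then show ?thesis using False that by (simp add: S_def)
    qed (auto simp: S_def intro!: sum.cong)
    finally show ?thesis using row that by simp
  qed
  have ST: "S * T = 1\<^sub>m ?n"
  proof (rule eq_matI)
    fix x y assume "x < dim_row (1\<^sub>m ?n :: complex mat)" "y < dim_col (1\<^sub>m ?n :: complex mat)"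
    then show "(S * T) $$ (x, y) = (1\<^sub>m ?n :: complex mat) $$ (x, y)"
      using SM[OF carr(2), of x y] by (auto simp: T_def)
  qed (use carr in auto)
  have TS: "T * S = 1\<^sub>m ?n"
  proof (rule eq_matI)
    fix x y assume "x < dim_row (1\<^sub>m ?n :: complex mat)" "y < dim_col (1\<^sub>m ?n :: complex mat)"
    then show "(T * S) $$ (x, y) = (1\<^sub>m ?n :: complex mat) $$ (x, y)"
      using TM[OF carr(1), of x y] by (auto simp: S_def)
  qed (use carr in auto)
  have "P * S = S * B"
  proof (rule eq_matI)
    fix x y assume "x < dim_row (S * B)" "y < dim_col (S * B)"
    then have "x < ?n" "y < ?n" using carr by auto
    then show "(P * S) $$ (x, y) = (S * B) $$ (x, y)"
      using PS[of x y] SM[OF carr(3), of x y] B[of x y] B[of 0 y] by auto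
  qed (use carr P in auto)
  then have "S * B * T = P * S * T" by simp
  also have "\<dots> = P" using P carr ST by (simp add: assoc_mult_mat[of P ?n ?n S ?n T ?n])
  finally have "similar_mat P B"
    using carr P ST TS by (intro similar_matI[of _ _ S T ?n]) auto
  then have "char_poly P = char_poly B" by (rule char_poly_similar)
  also have "\<dots> = char_poly (1\<^sub>m 1) * char_poly D"
    unfolding B_def by (rule char_poly_four_block_zeros_col) (use carr in auto)
  also have "char_poly (1\<^sub>m 1 :: complex mat) = [:- 1, 1:]"
    by (subst char_poly_upper_triangular[of _ 1]) (auto simp: diag_mat_def intro!: upper_triangularI)
  finally show ?thesis unfolding D_def .
qed

section \<open>Singular values of powers of the walk matrix\<close>

text \<open>The signs of the words occurring in the k-th power of P^l times its transpose;
  \<open>flip\<close> corresponds to transposition, under which this pattern is invariant.\<close>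

definition pattern :: "nat \<Rightarrow> nat \<Rightarrow> bool list" where
  "pattern l k = concat (replicate k (replicate l True @ replicate l False))"

definition flip :: "bool list \<Rightarrow> bool list" where
  "flip s = rev (map Not s)"

lemma length_pattern [simp]: "length (pattern l k) = 2 * l * k"
  by (simp add: pattern_def)

lemma pattern_add: "pattern l (j + k) = pattern l j @ pattern l k"
  by (simp add: pattern_def replicate_add)

lemma flip_replicate [simp]: "flip (replicate l b) = replicate l (\<not> b)"
  by (simp add: flip_def)

lemma flip_append [simp]: "flip (s @ t) = flip t @ flip s"
  by (simp add: flip_def)

lemma flip_flip [simp]: "flip (flip s) = s"
  by (simp add: flip_def rev_map comp_def)

lemma pattern_Suc: "pattern l (Suc k) = replicate l True @ replicate l False @ pattern l k"
  by (simp add: pattern_def)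

lemma flip_pattern [simp]: "flip (pattern l k) = pattern l k"
proof (induction k)
  case 0
  then show ?case by (simp add: pattern_def flip_def)
next
  case (Suc k)
  have "flip (pattern l (Suc k)) = pattern l k @ pattern l 1"
    using Suc by (simp add: pattern_Suc) (simp add: pattern_def)
  also have "\<dots> = pattern l (Suc k)" using pattern_add[of l k 1] by simp
  finally show ?case .
qed

locale walk_matrix = weights p r for p r +
  fixes n :: nat and \<sigma> :: "nat \<Rightarrow> nat \<Rightarrow> nat"
  assumes n: "2 \<le> n" and \<sigma>: "\<sigma> \<in> Omega n r"
begin

text \<open>The entries of the product of the matrices \<open>P\<close> and \<open>P\<^sup>T\<close> prescribed by the pattern \<open>s\<close>
  (\<open>True\<close> stands for \<open>P\<close>), and of its restriction to the complement of the constants.\<close>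

definition E :: "bool list \<Rightarrow> nat \<Rightarrow> nat \<Rightarrow> real" where
  "E s x y = wsum p r s (\<lambda>w. of_bool (fold (lperm \<sigma>) w x = y))"

definition Y :: "bool list \<Rightarrow> nat \<Rightarrow> nat \<Rightarrow> real" where
  "Y s x y = E s x y - 1 / n"

lemma E_nonneg: "0 \<le> E s x y"
  unfolding E_def by (rule wsum_nonneg) auto

lemma sum_E_row: "x < n \<Longrightarrow> (\<Sum>y<n. E s x y) = 1"
proof -
  assume x: "x < n"
  have "(\<Sum>y<n. E s x y) = wsum p r s (\<lambda>w. \<Sum>y<n. of_bool (fold (lperm \<sigma>) w x = y))"
    by (simp only: E_def wsum_sum)
  also have "\<dots> = wsum p r s (\<lambda>w. 1)"
  proof (rule wsum_cong)
    fix w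
    have "fold (lperm \<sigma>) w x < n" using fold_lperm_less[OF \<sigma> x] .
    then show "(\<Sum>y<n. of_bool (fold (lperm \<sigma>) w x = y)) = (1 :: real)"
      by (subst sum.remove[of _ "fold (lperm \<sigma>) w x"]) auto
  qed
  finally show ?thesis by simp
qed

lemma E_append: "x < n \<Longrightarrow> (\<Sum>z<n. E s x z * E t z y) = E (s @ t) x y"
proof -
  assume x: "x < n"
  have "(\<Sum>z<n. E s x z * E t z y) = wsum p r s (\<lambda>v. \<Sum>z<n. of_bool (fold (lperm \<sigma>) v x = z) * E t z y)"
    by (simp only: E_def[of s] wsum_sum wsum_cmult_right)
  also have "\<dots> = wsum p r s (\<lambda>v. E t (fold (lperm \<sigma>) v x) y)"
  proof (rule wsum_cong)
    fix v
    have "fold (lperm \<sigma>) v x < n" using fold_lperm_less[OF \<sigma> x] .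
    then show "(\<Sum>z<n. of_bool (fold (lperm \<sigma>) v x = z) * E t z y) = E t (fold (lperm \<sigma>) v x) y"
      by (subst sum.remove[of _ "fold (lperm \<sigma>) v x"]) auto
  qed
  finally show ?thesis by (simp add: E_def wsum_append)
qed

lemma E_flip: "x < n \<Longrightarrow> y < n \<Longrightarrow> E (flip s) y x = E s x y"
proof (induction s arbitrary: x)
  case Nil
  then show ?case by (auto simp: E_def flip_def)
next
  case (Cons b s)
  have single: "E [b] x z = E [\<not> b] z x" for z
  proof -
    have "lperm \<sigma> (i, b) x = z \<longleftrightarrow> lperm \<sigma> (i, \<not> b) z = x" for i
      using lperm_linv[OF \<sigma>, of "(i, b)"] lperm_linv'[OF \<sigma>, of "(i, b)"] by (auto simp: linv_def)
    then show ?thesis by (simp add: E_def)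
  qed
  have "E (b # s) x y = (\<Sum>z<n. E [b] x z * E s z y)"
    using E_append[OF Cons.prems(1), of "[b]" s y] by simp
  also have "\<dots> = (\<Sum>z<n. E (flip s) y z * E [\<not> b] z x)"
    using Cons by (intro sum.cong) (auto simp: single)
  also have "\<dots> = E (flip s @ [\<not> b]) y x"
    using Cons.prems by (intro E_append)
  also have "flip s @ [\<not> b] = flip (b # s)" by (simp add: flip_def)
  finally show ?case by simp
qed

lemma sum_E_col: "y < n \<Longrightarrow> (\<Sum>x<n. E s x y) = 1"
proof -
  assume y: "y < n"
  have "(\<Sum>x<n. E s x y) = (\<Sum>x<n. E (flip s) y x)"
    using y by (intro sum.cong) (auto simp: E_flip)
  then show ?thesis using sum_E_row[OF y] by simp
qed

text \<open>All these matrices are doubly stochastic, so the projection onto the constants is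
  absorbed by either factor, and subtracting it is compatible with products.\<close>

lemma Y_append: "x < n \<Longrightarrow> y < n \<Longrightarrow> (\<Sum>z<n. Y s x z * Y t z y) = Y (s @ t) x y"
proof -
  assume x: "x < n" and y: "y < n"
  have "(\<Sum>z<n. Y s x z * Y t z y)
      = (\<Sum>z<n. E s x z * E t z y) - (\<Sum>z<n. E s x z) / n - (\<Sum>z<n. E t z y) / n + (\<Sum>z<n. 1 / n * (1 / n))"
    by (simp add: Y_def algebra_simps sum.distrib sum_subtractf sum_divide_distrib)
  then show ?thesis
    using n by (simp add: E_append[OF x] sum_E_row[OF x] sum_E_col[OF y] Y_def)
qed

lemma Y_flip: "x < n \<Longrightarrow> y < n \<Longrightarrow> Y (flip s) y x = Y s x y"
  by (simp add: Y_def E_flip)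

lemma sum_Y_col: "y < n \<Longrightarrow> (\<Sum>x<n. Y s x y) = 0"
  using n by (simp add: Y_def sum_subtractf sum_E_col)

lemma sum_Y_diag: "(\<Sum>x<n. Y s x x) = wsum p r s (fixed_points n \<sigma>) - 1"
proof -
  have "(\<Sum>x<n. E s x x) = wsum p r s (\<lambda>w. \<Sum>x<n. of_bool (fold (lperm \<sigma>) w x = x))"
    by (simp only: E_def wsum_sum)
  also have "(\<lambda>w. \<Sum>x<n. of_bool (fold (lperm \<sigma>) w x = x)) = fixed_points n \<sigma>"
    by (simp add: fun_eq_iff fixed_points_def of_bool_def sum.If_cases Int_def)
  finally show ?thesis using n by (simp add: Y_def sum_subtractf)
qed

section \<open>Action on complex vectors and Rayleigh quotients\<close>

definition act :: "bool list \<Rightarrow> (nat \<Rightarrow> complex) \<Rightarrow> nat \<Rightarrow> complex" where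
  "act s u x = (\<Sum>z<n. of_real (Y s x z) * u z)"

definition inner :: "(nat \<Rightarrow> complex) \<Rightarrow> (nat \<Rightarrow> complex) \<Rightarrow> complex" where
  "inner u v = (\<Sum>x<n. u x * cnj (v x))"

definition energy :: "(nat \<Rightarrow> complex) \<Rightarrow> real" where
  "energy u = (\<Sum>x<n. (cmod (u x))\<^sup>2)"

lemma inner_self: "inner u u = of_real (energy u)"
  by (simp add: inner_def energy_def complex_norm_square[symmetric])

lemma energy_nonneg: "0 \<le> energy u"
  by (simp add: energy_def sum_nonneg)

lemma energy_pos: "\<exists>x<n. u x \<noteq> 0 \<Longrightarrow> 0 < energy u"
  unfolding energy_def by (auto intro!: sum_pos2)

lemma energy_cong: "(\<And>x. x < n \<Longrightarrow> u x = v x) \<Longrightarrow> energy u = energy v"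
  by (simp add: energy_def)

lemma inner_cong: "(\<And>x. x < n \<Longrightarrow> u x = u' x) \<Longrightarrow> (\<And>x. x < n \<Longrightarrow> v x = v' x) \<Longrightarrow> inner u v = inner u' v'"
  by (simp add: inner_def)

lemma act_cong: "(\<And>x. x < n \<Longrightarrow> u x = v x) \<Longrightarrow> act s u = act s v"
  by (simp add: act_def fun_eq_iff)

lemma act_append: "x < n \<Longrightarrow> act (s @ t) u x = act s (act t u) x"
proof -
  assume x: "x < n"
  have "act s (act t u) x = (\<Sum>z<n. \<Sum>y<n. of_real (Y s x z) * (of_real (Y t z y) * u y))"
    by (simp add: act_def sum_distrib_left)
  also have "\<dots> = (\<Sum>y<n. \<Sum>z<n. of_real (Y s x z) * (of_real (Y t z y) * u y))"
    by (rule sum.swap)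
  also have "\<dots> = (\<Sum>y<n. of_real (\<Sum>z<n. Y s x z * Y t z y) * u y)"
    by (simp add: sum_distrib_right mult.assoc)
  also have "\<dots> = act (s @ t) u x"
    using x by (simp add: act_def Y_append)
  finally show ?thesis by simp
qed

lemma inner_act: "inner (act s u) v = inner u (act (flip s) v)"
proof -
  have "inner (act s u) v = (\<Sum>x<n. \<Sum>z<n. of_real (Y s x z) * u z * cnj (v x))"
    by (simp add: inner_def act_def sum_distrib_right)
  also have "\<dots> = (\<Sum>z<n. \<Sum>x<n. of_real (Y s x z) * u z * cnj (v x))"
    by (rule sum.swap)
  also have "\<dots> = (\<Sum>z<n. \<Sum>x<n. u z * (of_real (Y (flip s) z x) * cnj (v x)))"
    by (intro sum.cong refl) (simp add: Y_flip)
  also have "\<dots> = inner u (act (flip s) v)"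
    by (simp add: inner_def act_def sum_distrib_left)
  finally show ?thesis .
qed

lemma inner_act_append_flip: "inner (act (flip s @ s) u) u = of_real (energy (act s u))"
proof -
  have "inner (act (flip s @ s) u) u = inner (act (flip s) (act s u)) u"
    by (rule inner_cong) (auto simp: act_append)
  also have "\<dots> = inner (act s u) (act s u)" by (simp add: inner_act)
  finally show ?thesis by (simp add: inner_self)
qed

lemma Cauchy_Schwarz: "(cmod (inner u v))\<^sup>2 \<le> energy u * energy v"
proof -
  have "cmod (inner u v) \<le> (\<Sum>x<n. cmod (u x) * cmod (v x))"
    unfolding inner_def by (rule order_trans[OF norm_sum]) (simp add: norm_mult)
  then have "(cmod (inner u v))\<^sup>2 \<le> (\<Sum>x<n. cmod (u x) * cmod (v x))\<^sup>2"
    by (rule power_mono) simp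
  also have "\<dots> \<le> energy u * energy v"
    unfolding energy_def by (rule Cauchy_Schwarz_ineq_sum)
  finally show ?thesis .
qed

text \<open>The operator norm is at most the Hilbert--Schmidt norm, whose square is the trace of the
  matrix times its transpose.\<close>

lemma energy_act_le: "energy (act s u) \<le> (\<Sum>x<n. Y (s @ flip s) x x) * energy u"
proof -
  have "energy (act s u) \<le> (\<Sum>x<n. (\<Sum>z<n. (Y s x z)\<^sup>2) * energy u)"
    unfolding energy_def[of "act s u"]
  proof (rule sum_mono)
    fix x
    have "cmod (act s u x) \<le> (\<Sum>z<n. \<bar>Y s x z\<bar> * cmod (u z))"
      unfolding act_def by (rule order_trans[OF norm_sum]) (simp add: norm_mult)
    then have "(cmod (act s u x))\<^sup>2 \<le> (\<Sum>z<n. \<bar>Y s x z\<bar> * cmod (u z))\<^sup>2"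
      by (rule power_mono) simp
    also have "\<dots> \<le> (\<Sum>z<n. \<bar>Y s x z\<bar>\<^sup>2) * energy u"
      unfolding energy_def by (rule Cauchy_Schwarz_ineq_sum)
    finally show "(cmod (act s u x))\<^sup>2 \<le> (\<Sum>z<n. (Y s x z)\<^sup>2) * energy u" by simp
  qed
  also have "\<dots> = (\<Sum>x<n. \<Sum>z<n. Y s x z * Y (flip s) z x) * energy u"
    by (simp add: sum_distrib_right Y_flip power2_eq_square)
  finally show ?thesis by (simp add: Y_append)
qed

text \<open>The Rayleigh quotients of the powers \<open>2\<^sup>j\<close> of a positive matrix dominate the powers of the
  first one, and they are bounded by traces.\<close>

lemma trace_pattern_ge:
  assumes u: "0 < energy u" and g: "0 \<le> g" "g * energy u \<le> Re (inner (act (pattern l 1) u) u)"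
  shows "g ^ (2 ^ Suc j) \<le> (\<Sum>x<n. Y (pattern l (2 ^ Suc j)) x x)"
proof -
  have double: "pattern l (2 ^ Suc j) = flip (pattern l (2 ^ j)) @ pattern l (2 ^ j)" for j
    using pattern_add[of l "2 ^ j" "2 ^ j"] by (simp add: mult_2)
  have step: "g ^ (2 ^ Suc j) * energy u \<le> energy (act (pattern l (2 ^ j)) u)"
    if "g ^ (2 ^ j) * energy u \<le> Re (inner (act (pattern l (2 ^ j)) u) u)" for j
  proof -
    have "0 \<le> g ^ (2 ^ j) * energy u" using g u by simp
    then have "(g ^ (2 ^ j) * energy u)\<^sup>2 \<le> (cmod (inner (act (pattern l (2 ^ j)) u) u))\<^sup>2"
      using that complex_Re_le_cmod[of "inner (act (pattern l (2 ^ j)) u) u"] by (intro power_mono) linarith+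
    also have "\<dots> \<le> energy (act (pattern l (2 ^ j)) u) * energy u" by (rule Cauchy_Schwarz)
    finally have "(g ^ (2 ^ Suc j) * energy u) * energy u \<le> energy (act (pattern l (2 ^ j)) u) * energy u"
      by (simp add: power2_eq_square mult_2 power_add ac_simps)
    then show ?thesis using u by (rule mult_right_le_imp_le)
  qed
  have ray: "g ^ (2 ^ j) * energy u \<le> Re (inner (act (pattern l (2 ^ j)) u) u)" for j
  proof (induction j)
    case 0
    then show ?case using g by simp
  next
    case (Suc j)
    show ?case using step[OF Suc] unfolding double inner_act_append_flip by simp
  qed
  have "g ^ (2 ^ Suc j) * energy u \<le> energy (act (pattern l (2 ^ j)) u)" by (rule step[OF ray])
  also have "\<dots> \<le> (\<Sum>x<n. Y (pattern l (2 ^ j) @ flip (pattern l (2 ^ j))) x x) * energy u"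
    by (rule energy_act_le)
  also have "pattern l (2 ^ j) @ flip (pattern l (2 ^ j)) = pattern l (2 ^ Suc j)"
    using double[of j] by simp
  finally show ?thesis using u by (rule mult_right_le_imp_le)
qed

definition A :: "nat \<Rightarrow> complex mat" where
  "A l = mat n n (\<lambda>(x, y). of_real (Y (pattern l 1) x y))"

lemma A_carrier [simp]: "A l \<in> carrier_mat n n"
  by (simp add: A_def)

lemma A_pow: "x < n \<Longrightarrow> y < n \<Longrightarrow> (A l ^\<^sub>m Suc k) $$ (x, y) = of_real (Y (pattern l (Suc k)) x y)"
proof (induction k arbitrary: x y)
  case 0
  then show ?case by (simp add: A_def)
next
  case (Suc k)
  have "(A l ^\<^sub>m Suc (Suc k)) $$ (x, y) = (\<Sum>z<n. (A l ^\<^sub>m Suc k) $$ (x, z) * A l $$ (z, y))"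
    unfolding pow_mat.simps(2)[of _ "Suc k"]
    by (rule index_mult_mat_sum[OF pow_carrier_mat[OF A_carrier] A_carrier Suc.prems])
  also have "\<dots> = (\<Sum>z<n. of_real (Y (pattern l (Suc k)) x z) * of_real (Y (pattern l 1) z y))"
    using Suc by (intro sum.cong) (auto simp: A_def)
  also have "\<dots> = of_real (\<Sum>z<n. Y (pattern l (Suc k)) x z * Y (pattern l 1) z y)" by simp
  also have "\<dots> = of_real (Y (pattern l (Suc (Suc k))) x y)"
    using Suc.prems pattern_add[of l "Suc k" 1] by (simp add: Y_append)
  finally show ?case .
qed

text \<open>The Rayleigh quotient is a quotient of energies, hence real and nonnegative. For the
  upper bound, an eigenvector with nonzero eigenvalue has entries summing to 0, so on it the matrix
  acts like the stochastic \<open>E\<close>, which cannot increase the maximum modulus.\<close>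

lemma eigenvalue_A:
  assumes "eigenvalue (A l) a"
  shows "a = of_real (Re a)" "0 \<le> Re a" "Re a \<le> 1"
proof -
  define s where "s = pattern l 1"
  obtain v where v: "\<exists>x<n. v x \<noteq> 0" "\<And>x. x < n \<Longrightarrow> (\<Sum>z<n. A l $$ (x, z) * v z) = a * v x"
    using eigenvalueE_fun[OF A_carrier assms] by metis
  have act: "act (s) v x = a * v x" if "x < n" for x
    using v(2)[OF that] that by (simp add: act_def A_def s_def)
  have pos: "0 < energy v" using energy_pos[OF v(1)] .
  have "inner (act (s) v) v = inner (\<lambda>x. a * v x) v"
    by (rule inner_cong) (auto simp: act)
  also have "\<dots> = a * of_real (energy v)"
    unfolding inner_self[symmetric] by (simp add: inner_def sum_distrib_left mult.assoc)
  finally have "a * of_real (energy v) = inner (act (s) v) v" by simp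
  also have "s = flip (replicate l False) @ replicate l False"
    by (simp add: s_def pattern_def)
  finally have "a * of_real (energy v) = of_real (energy (act (replicate l False) v))"
    by (simp only: inner_act_append_flip)
  then have a: "a = of_real (energy (act (replicate l False) v) / energy v)"
    using pos by (simp add: field_simps)
  show "a = of_real (Re a)" by (simp only: a Re_complex_of_real)
  show "0 \<le> Re a" using pos energy_nonneg by (simp only: a Re_complex_of_real divide_nonneg_pos)
  have "Max ((\<lambda>x. cmod (v x)) ` {..<n}) \<in> (\<lambda>x. cmod (v x)) ` {..<n}"
    using n by (intro Max_in) (auto simp: lessThan_empty_iff)
  then obtain m where "m < n" "cmod (v m) = Max ((\<lambda>x. cmod (v x)) ` {..<n})" by auto
  then have m: "m < n" "\<And>x. x < n \<Longrightarrow> cmod (v x) \<le> cmod (v m)" by auto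
  have vm: "0 < cmod (v m)"
  proof -
    obtain x where "x < n" "v x \<noteq> 0" using v(1) by blast
    then show ?thesis using m(2)[of x] zero_less_norm_iff[of "v x"] by linarith
  qed
  show "Re a \<le> 1"
  proof (cases "a = 0")
    case False
    have "a * (\<Sum>x<n. v x) = (\<Sum>x<n. act (s) v x)"
      by (simp add: act sum_distrib_left)
    also have "\<dots> = (\<Sum>z<n. \<Sum>x<n. of_real (Y (s) x z) * v z)"
      unfolding act_def by (rule sum.swap)
    also have "\<dots> = (\<Sum>z<n. of_real (\<Sum>x<n. Y (s) x z) * v z)"
      by (simp add: sum_distrib_right)
    also have "\<dots> = 0" by (simp add: sum_Y_col)
    finally have sum0: "(\<Sum>x<n. v x) = 0" using False by simp
    have "a * v m = (\<Sum>z<n. of_real (E (s) m z) * v z) - of_real (1 / n) * (\<Sum>z<n. v z)"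
      unfolding act[OF m(1), symmetric] act_def Y_def
      by (simp add: left_diff_distrib sum_subtractf sum_distrib_left)
    then have "cmod (a * v m) \<le> (\<Sum>z<n. E (s) m z * cmod (v z))"
      unfolding sum0 by (simp only: mult_zero_right diff_0_right)
        (rule order_trans[OF norm_sum], simp add: norm_mult E_nonneg)
    also have "\<dots> \<le> (\<Sum>z<n. E (s) m z * cmod (v m))"
      by (intro sum_mono mult_left_mono m(2) E_nonneg) auto
    also have "\<dots> = cmod (v m)" by (simp add: sum_E_row[OF m(1)] flip: sum_distrib_right)
    finally have "cmod a \<le> 1" using vm by (simp add: norm_mult)
    then show ?thesis using complex_Re_le_cmod[of a] by linarith
  qed simp
qed

text \<open>The block \<open>?D\<close> is P on the quotient by the constants. Its dual is the
  transpose of P on vectors with sum 0, where it agrees with \<open>act [False]\<close>. An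
  eigenvector of the transposed block is therefore completed by the coordinate 0 that makes the sum
  vanish.\<close>

lemma ex_eigenvector:
  assumes "\<beta> \<le> second_modulus n \<sigma>"
  shows "\<exists>\<mu> u. \<beta> \<le> cmod \<mu> \<and> (\<exists>x<n. u x \<noteq> 0) \<and> (\<forall>x<n. act [False] u x = \<mu> * u x)"
proof -
  obtain m where nm: "n = Suc m" "1 \<le> m" using n by (cases n) auto
  let ?P = "weighted_permutation_matrix n r p \<sigma>"
  let ?D = "mat m m (\<lambda>(x, y). ?P $$ (Suc x, Suc y) - ?P $$ (0, Suc y))"
  have P: "?P \<in> carrier_mat n n" by (simp add: weighted_permutation_matrix_def)
  have entry: "?P $$ (x, y) = of_real (E [True] x y)" if "x < n" "y < n" for x y
  proof -
    have "?P $$ (x, y) = (\<Sum>i<r. of_real (p i) * (if \<sigma> i x = y then 1 else 0))"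
      using that by (simp add: weighted_permutation_matrix_def permutation_matrix_def)
    also have "\<dots> = (\<Sum>i<r. of_real (p i * of_bool (\<sigma> i x = y)))"
      by (intro sum.cong refl) (simp add: of_bool_def)
    also have "\<dots> = of_real (\<Sum>i<r. p i * of_bool (\<sigma> i x = y))"
      by (simp only: of_real_sum)
    finally show ?thesis
      by (simp only: E_def wsum.simps fold_simps lperm_def fst_conv snd_conv if_True)
  qed
  have row: "(\<Sum>y<n. ?P $$ (x, y)) = 1" if "x < n" for x
  proof -
    have "(\<Sum>y<n. ?P $$ (x, y)) = (\<Sum>y<n. of_real (E [True] x y))"
      using that by (intro sum.cong) (auto simp: entry)
    also have "\<dots> = of_real (\<Sum>y<n. E [True] x y)" by (simp only: of_real_sum)
    finally show ?thesis using that by (simp only: sum_E_row of_real_1)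
  qed
  have "char_poly ?P = [:- 1, 1:] * char_poly ?D"
    using char_poly_unit_row_sums[of ?P m] P row unfolding nm(1) by blast
  from eigenvalue_modulus_2_imp_eigenvalue[OF this n P _ assms, of m] obtain \<mu>
    where \<mu>: "eigenvalue ?D \<mu>" "\<beta> \<le> cmod \<mu>" by auto
  have "eigenvalue (transpose_mat ?D) \<mu>"
    using \<mu>(1) eigenvalue_root_char_poly[of ?D m] eigenvalue_root_char_poly[of "transpose_mat ?D" m]
      char_poly_transpose_mat[of ?D m] by simp
  then obtain w where w: "\<exists>x<m. w x \<noteq> 0" "\<And>x. x < m \<Longrightarrow> (\<Sum>z<m. transpose_mat ?D $$ (x, z) * w z) = \<mu> * w x"
    using eigenvalueE_fun[of "transpose_mat ?D" m \<mu>] by auto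
  define u where "u x = (case x of 0 \<Rightarrow> - (\<Sum>z<m. w z) | Suc z \<Rightarrow> w z)" for x
  have sum_u: "(\<Sum>x<n. u x) = 0"
    unfolding nm(1) sum.lessThan_Suc_shift by (simp add: u_def)
  have Pu: "act [False] u y = (\<Sum>x<n. ?P $$ (x, y) * u x)" if "y < n" for y
  proof -
    have "act [False] u y = (\<Sum>x<n. of_real (E [False] y x) * u x) - of_real (1 / n) * (\<Sum>x<n. u x)"
      by (simp add: act_def Y_def left_diff_distrib sum_subtractf sum_distrib_left)
    also have "\<dots> = (\<Sum>x<n. of_real (E [False] y x) * u x)" by (simp add: sum_u)
    also have "\<dots> = (\<Sum>x<n. ?P $$ (x, y) * u x)"
      using that E_flip[of _ y "[True]"] by (intro sum.cong refl) (simp add: entry flip_def)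
    finally show ?thesis .
  qed
  have Suc_case: "act [False] u (Suc y) = \<mu> * u (Suc y)" if "y < m" for y
  proof -
    have "Suc y < n" using that nm by simp
    then have "act [False] u (Suc y) = (\<Sum>x<n. ?P $$ (x, Suc y) * u x)" by (rule Pu)
    also have "\<dots> = (\<Sum>x<Suc m. ?P $$ (x, Suc y) * u x)"
      by (rule sum.cong) (simp_all only: nm(1))
    also have "\<dots> = ?P $$ (0, Suc y) * - (\<Sum>z<m. w z) + (\<Sum>z<m. ?P $$ (Suc z, Suc y) * w z)"
      unfolding sum.lessThan_Suc_shift by (simp add: u_def)
    also have "\<dots> = (\<Sum>z<m. transpose_mat ?D $$ (y, z) * w z)"
      using that by (simp add: left_diff_distrib sum_subtractf sum_distrib_left)
    finally show ?thesis using w(2)[OF that] by (simp add: u_def)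
  qed
  have sum_act: "(\<Sum>y<n. act [False] u y) = 0"
  proof -
    have "(\<Sum>y<n. act [False] u y) = (\<Sum>z<n. \<Sum>y<n. of_real (Y [False] y z) * u z)"
      unfolding act_def by (rule sum.swap)
    also have "\<dots> = (\<Sum>z<n. of_real (\<Sum>y<n. Y [False] y z) * u z)"
      by (simp add: sum_distrib_right)
    finally show ?thesis by (simp add: sum_Y_col)
  qed
  have "act [False] u 0 = - (\<Sum>y<m. act [False] u (Suc y))"
    using sum_act unfolding nm(1) sum.lessThan_Suc_shift by (simp add: eq_neg_iff_add_eq_0)
  also have "\<dots> = \<mu> * u 0"
    by (simp add: Suc_case u_def sum_distrib_left sum_negf)
  finally have "act [False] u x = \<mu> * u x" if "x < n" for x
    using that Suc_case nm(1) by (cases x) auto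
  moreover have "\<exists>x<n. u x \<noteq> 0"
  proof -
    obtain x where "x < m" "w x \<noteq> 0" using w(1) by blast
    then show ?thesis by (intro exI[of _ "Suc x"]) (auto simp: u_def nm)
  qed
  ultimately show ?thesis using \<mu>(2) by blast
qed

text \<open>The squared singular values of the \<open>l\<close>-th power of the walk matrix on the complement of the
  constants, that is, the eigenvalues of \<open>P\<^sup>l (P\<^sup>l)\<^sup>T\<close> with one eigenvalue 1 replaced by 0.\<close>

theorem ex_singular_values:
  assumes l: "1 \<le> l"
  shows "\<exists>mus. length mus = n \<and> (\<forall>\<mu>\<in>set mus. 0 \<le> \<mu> \<and> \<mu> \<le> 1)
    \<and> (\<forall>k\<ge>1. (\<Sum>\<mu>\<leftarrow>mus. \<mu> ^ k) = wsum p r (pattern l k) (fixed_points n \<sigma>) - 1)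
    \<and> (\<forall>\<beta>>0. \<beta> \<le> second_modulus n \<sigma> \<longrightarrow>
         (\<exists>\<mu>\<in>set mus. \<beta> ^ (2 * l) \<le> \<mu>))"
proof -
  obtain as where as: "length as = n" "\<And>a. a \<in> set as \<Longrightarrow> eigenvalue (A l) a"
    "\<And>k. mat_trace n (A l ^\<^sub>m k) = (\<Sum>a\<leftarrow>as. a ^ k)"
    using trace_pow_eigenvalues[OF A_carrier, of l] by metis
  define mus where "mus = map Re as"
  have mus01: "0 \<le> \<mu>" "\<mu> \<le> 1" if "\<mu> \<in> set mus" for \<mu>
  proof -
    from that obtain a where "a \<in> set as" "\<mu> = Re a" unfolding mus_def by auto
    then show "0 \<le> \<mu>" "\<mu> \<le> 1" using eigenvalue_A(2,3)[OF as(2), of a] by simp_all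
  qed
  have trace: "(\<Sum>\<mu>\<leftarrow>mus. \<mu> ^ k) = (\<Sum>x<n. Y (pattern l k) x x)" if "1 \<le> k" for k
  proof -
    from that obtain k' where k: "k = Suc k'" by (cases k) auto
    have "of_real (\<Sum>\<mu>\<leftarrow>mus. \<mu> ^ k) = (\<Sum>a\<leftarrow>as. (of_real (Re a) :: complex) ^ k)"
      unfolding mus_def by (induction as) auto
    also have "\<dots> = (\<Sum>a\<leftarrow>as. a ^ k)"
      using eigenvalue_A(1)[OF as(2)] by (intro arg_cong[of _ _ sum_list] map_cong) simp_all
    also have "\<dots> = of_real (\<Sum>x<n. Y (pattern l k) x x)"
      unfolding as(3)[symmetric] mat_trace_def k by (simp add: A_pow del: pow_mat.simps)
    finally show ?thesis by (simp only: of_real_eq_iff)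
  qed
  have "\<exists>\<mu>\<in>set mus. \<beta> ^ (2 * l) \<le> \<mu>"
    if \<beta>: "0 < \<beta>" "\<beta> \<le> second_modulus n \<sigma>" for \<beta>
  proof (rule ccontr)
    assume "\<not> ?thesis"
    then have small: "\<mu> < \<beta> ^ (2 * l)" if "\<mu> \<in> set mus" for \<mu> using that by (auto simp: not_le)
    let ?g = "\<beta> ^ (2 * l)"
    have g: "0 < ?g" using \<beta> by simp
    obtain \<mu> u where u: "\<beta> \<le> cmod \<mu>" "\<exists>x<n. u x \<noteq> 0" "\<And>x. x < n \<Longrightarrow> act [False] u x = \<mu> * u x"
      using ex_eigenvector[OF \<beta>(2)] by blast
    have pow: "act (replicate (Suc j) False) u x = \<mu> ^ Suc j * u x" if "x < n" for j x
      using that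
    proof (induction j arbitrary: x)
      case (Suc j)
      have "act (replicate (Suc (Suc j)) False) u x = act [False] (act (replicate (Suc j) False) u) x"
        using act_append[OF Suc.prems, of "[False]" "replicate (Suc j) False" u] by simp
      also have "\<dots> = act [False] (\<lambda>x. \<mu> ^ Suc j * u x) x"
        by (subst act_cong[of _ "\<lambda>x. \<mu> ^ Suc j * u x"]) (auto simp: Suc.IH simp del: replicate_Suc)
      also have "\<dots> = \<mu> ^ Suc j * act [False] u x"
        by (simp add: act_def sum_distrib_left ac_simps)
      finally show ?case using u(3)[OF Suc.prems] by simp
    qed (simp add: u(3))
    have pos: "0 < energy u" by (rule energy_pos[OF u(2)])
    have "energy (act (replicate l False) u) = energy (\<lambda>x. \<mu> ^ l * u x)"
      using l pow[of _ "l - 1"] by (intro energy_cong) simp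
    also have "\<dots> = (cmod \<mu>) ^ (2 * l) * energy u"
      by (simp add: energy_def norm_mult norm_power power_mult_distrib sum_distrib_left power_mult[symmetric] mult.commute)
    finally have en: "energy (act (replicate l False) u) = (cmod \<mu>) ^ (2 * l) * energy u" .
    have pat: "pattern l 1 = flip (replicate l False) @ replicate l False" by (simp add: pattern_def)
    have "?g * energy u \<le> (cmod \<mu>) ^ (2 * l) * energy u"
      using \<beta> u(1) pos by (intro mult_right_mono power_mono) auto
    then have ray: "?g * energy u \<le> Re (inner (act (pattern l 1) u) u)"
      unfolding pat inner_act_append_flip by (simp add: en)
    define M where "M = Max (insert 0 (set mus))"
    have M: "\<mu> \<le> M" if "\<mu> \<in> set mus" for \<mu> using that by (simp add: M_def)
    have M0: "0 \<le> M" by (simp add: M_def)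
    have Mg: "M < ?g" unfolding M_def using small g by simp
    \<comment> \<open>The trace is at least a power of the Rayleigh bound \<open>?g\<close> and at
      most n times the same power of the largest eigenvalue. As the exponent grows, the factor n
      cannot make up for \<open>M < ?g\<close>.\<close>
    have bound: "?g ^ (2 ^ Suc j) \<le> real n * M ^ (2 ^ Suc j)" for j
    proof -
      have "?g ^ (2 ^ Suc j) \<le> (\<Sum>\<mu>\<leftarrow>mus. \<mu> ^ (2 ^ Suc j))"
        using trace_pattern_ge[OF pos _ ray, of j] g by (simp add: trace)
      also have "\<dots> \<le> (\<Sum>\<mu>\<leftarrow>mus. M ^ (2 ^ Suc j))"
        using M mus01 by (intro sum_list_mono power_mono) auto
      also have "\<dots> = real n * M ^ (2 ^ Suc j)"
        using as(1) by (simp add: sum_list_triv mus_def)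
      finally show ?thesis .
    qed
    have "M / ?g < 1" "0 \<le> M / ?g" using Mg g M0 by auto
    then obtain N where N: "(M / ?g) ^ N < 1 / real n"
      using real_arch_pow_inv[of "1 / real n" "M / ?g"] n by auto
    have "N \<le> 2 ^ Suc N" using less_exp[of "Suc N"] by simp
    then have "(M / ?g) ^ (2 ^ Suc N) \<le> (M / ?g) ^ N"
      using \<open>M / ?g < 1\<close> \<open>0 \<le> M / ?g\<close> by (intro power_decreasing) auto
    then have "(M / ?g) ^ (2 ^ Suc N) < 1 / real n" using N by linarith
    then have "real n * M ^ (2 ^ Suc N) < ?g ^ (2 ^ Suc N)"
      using n g by (simp add: power_divide field_simps)
    then show False using bound[of N] by linarith
  qed
  then show ?thesis
    using as(1) mus01 trace sum_Y_diag by (intro exI[of _ mus]) (auto simp: mus_def)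
qed

end

section \<open>The polynomial method\<close>

text \<open>\<open>wsum\<close> averages real numbers only, so the mean polynomial is assembled from
  averaged coefficients. The linear coefficient exists since \<open>D\<close> is at least 1.\<close>

lemma ex_poly_wsum:
  assumes deg: "\<And>w. w \<in> words r s \<Longrightarrow> degree (F w) \<le> D" and D: "1 \<le> D"
  shows "\<exists>Q. degree Q \<le> D \<and> (\<forall>x. poly Q x = wsum p r s (\<lambda>w. poly (F w) x))
    \<and> poly (pderiv Q) 0 = wsum p r s (\<lambda>w. poly (pderiv (F w)) 0)"
proof -
  define c where "c j = wsum p r s (\<lambda>w. coeff (F w) j)" for j
  define Q where "Q = (\<Sum>j\<le>D. monom (c j) j)"
  have coeff_Q: "coeff Q j = (if j \<le> D then c j else 0)" for j
    by (simp add: Q_def coeff_sum)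
  have "poly Q x = wsum p r s (\<lambda>w. poly (F w) x)" for x
  proof -
    have "poly Q x = (\<Sum>j\<le>D. c j * x ^ j)" by (simp add: Q_def poly_sum poly_monom)
    also have "\<dots> = wsum p r s (\<lambda>w. \<Sum>j\<le>D. coeff (F w) j * x ^ j)"
      by (simp only: c_def wsum_sum wsum_cmult_right)
    also have "\<dots> = wsum p r s (\<lambda>w. poly (F w) x)"
    proof (rule wsum_cong)
      fix w assume "w \<in> words r s"
      then have "degree (F w) \<le> D" by (rule deg)
      then show "(\<Sum>j\<le>D. coeff (F w) j * x ^ j) = poly (F w) x"
        unfolding poly_altdef by (intro sum.mono_neutral_right) (auto simp: coeff_eq_0)
    qed
    finally show ?thesis .
  qed
  moreover have "poly (pderiv Q) 0 = wsum p r s (\<lambda>w. poly (pderiv (F w)) 0)"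
    using D by (simp add: poly_0_coeff_0 coeff_pderiv coeff_Q c_def)
  moreover have "degree Q \<le> D" by (rule degree_le) (simp add: coeff_Q)
  ultimately show ?thesis by blast
qed

section \<open>Absolute coefficient sums and the cutoff polynomial\<close>

text \<open>This weighted l1 norm of the coefficients bounds any sum of coefficients against
  quantities of size at most \<open>a ^ k\<close>. It is submultiplicative, so the coefficients of
  \<open>cutoff\<close> never have to be computed.\<close>

definition abs_poly_sum :: "real poly \<Rightarrow> real \<Rightarrow> real" where
  "abs_poly_sum p a = (\<Sum>k\<le>degree p. \<bar>coeff p k\<bar> * a ^ k)"

lemma abs_poly_sum_eq: "degree p \<le> K \<Longrightarrow> abs_poly_sum p a = (\<Sum>k\<le>K. \<bar>coeff p k\<bar> * a ^ k)"
  unfolding abs_poly_sum_def by (rule sum.mono_neutral_left) (auto simp: coeff_eq_0)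

lemma abs_poly_sum_nonneg: "0 \<le> a \<Longrightarrow> 0 \<le> abs_poly_sum p a"
  unfolding abs_poly_sum_def by (intro sum_nonneg) auto

lemma abs_poly_sum_mult:
  assumes a: "0 \<le> a"
  shows "abs_poly_sum (p * q) a \<le> abs_poly_sum p a * abs_poly_sum q a"
proof -
  define P where "P = (\<Sum>k\<le>degree p. monom \<bar>coeff p k\<bar> k)"
  define Q where "Q = (\<Sum>k\<le>degree q. monom \<bar>coeff q k\<bar> k)"
  have cP: "coeff P k = \<bar>coeff p k\<bar>" for k
    by (auto simp: P_def coeff_sum coeff_eq_0)
  have cQ: "coeff Q k = \<bar>coeff q k\<bar>" for k
    by (auto simp: Q_def coeff_sum coeff_eq_0)
  have dP: "degree P \<le> degree p" and dQ: "degree Q \<le> degree q"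
    by (auto intro!: degree_le simp: cP cQ coeff_eq_0)
  have pP: "poly P a = abs_poly_sum p a" and pQ: "poly Q a = abs_poly_sum q a"
    by (simp_all add: P_def Q_def poly_sum poly_monom abs_poly_sum_def)
  let ?K = "degree p + degree q"
  have "abs_poly_sum (p * q) a = (\<Sum>k\<le>?K. \<bar>coeff (p * q) k\<bar> * a ^ k)"
    by (rule abs_poly_sum_eq) (rule degree_mult_le)
  also have "\<dots> \<le> (\<Sum>k\<le>?K. coeff (P * Q) k * a ^ k)"
  proof (intro sum_mono mult_right_mono)
    show "\<bar>coeff (p * q) k\<bar> \<le> coeff (P * Q) k" for k
      unfolding coeff_mult cP cQ abs_mult[symmetric] by (rule sum_abs)
  qed (use a in auto)
  also have "\<dots> = poly (P * Q) a"
    unfolding poly_altdef using dP dQ degree_mult_le[of P Q]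
    by (intro sum.mono_neutral_right) (auto simp: coeff_eq_0)
  finally show ?thesis by (simp add: pP pQ)
qed

lemma abs_poly_sum_power:
  assumes a: "0 \<le> a"
  shows "abs_poly_sum (p ^ m) a \<le> abs_poly_sum p a ^ m"
proof (induction m)
  case 0
  then show ?case by (simp add: abs_poly_sum_def)
next
  case (Suc m)
  have "abs_poly_sum (p ^ Suc m) a \<le> abs_poly_sum p a * abs_poly_sum (p ^ m) a"
    using abs_poly_sum_mult[OF a, of p "p ^ m"] by simp
  also have "\<dots> \<le> abs_poly_sum p a * abs_poly_sum p a ^ m"
    by (intro mult_left_mono Suc abs_poly_sum_nonneg a)
  finally show ?case by simp
qed

text \<open>A polynomial that is close to 0 below \<open>1 / M\<close>, bounded away from 0 above, and bounded by 1
  on the unit interval.\<close>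

definition cutoff :: "nat \<Rightarrow> nat \<Rightarrow> real poly" where
  "cutoff M m = (1 - [:1, - 1:] ^ M) ^ m"

lemma poly_cutoff: "poly (cutoff M m) x = (1 - (1 - x) ^ M) ^ m"
  by (simp add: cutoff_def)

lemma cutoff_bounds:
  assumes "0 \<le> x" "x \<le> 1"
  shows "0 \<le> poly (cutoff M m) x" "poly (cutoff M m) x \<le> 1"
proof -
  have "0 \<le> (1 - x) ^ M" "(1 - x) ^ M \<le> 1" using assms by (auto intro: power_le_one)
  then show "0 \<le> poly (cutoff M m) x" "poly (cutoff M m) x \<le> 1"
    by (auto simp: poly_cutoff intro: power_le_one)
qed

lemma cutoff_mono:
  assumes "0 \<le> x" "x \<le> y" "y \<le> 1"
  shows "poly (cutoff M m) x \<le> poly (cutoff M m) y"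
proof -
  have "(1 - y) ^ M \<le> (1 - x) ^ M" using assms by (intro power_mono) auto
  moreover have "(1 - x) ^ M \<le> 1" using assms by (intro power_le_one) auto
  ultimately show ?thesis unfolding poly_cutoff by (intro power_mono) auto
qed

lemma degree_cutoff: "degree (cutoff M m) \<le> M * m"
proof -
  have "degree ([:1, - 1:] ^ M :: real poly) \<le> M" by (rule order_trans[OF degree_power_le]) simp
  then have "degree (1 - [:1, - 1:] ^ M :: real poly) \<le> M" by (intro degree_diff_le) auto
  then have "degree (1 - [:1, - 1:] ^ M :: real poly) * m \<le> M * m" by (rule mult_right_mono) simp
  then show ?thesis
    unfolding cutoff_def by (rule order_trans[OF degree_power_le])
qed

lemma coeff_cutoff_0: "1 \<le> m \<Longrightarrow> coeff (cutoff M m) 0 = 0"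
  by (simp add: poly_0_coeff_0[symmetric] poly_cutoff zero_power)

text \<open>The constant term of 1 - (1 - x)^M cancels, hence the -1 on the right: for small
  \<open>a\<close> the base is about \<open>a M\<close>, and its m-th power is tiny.\<close>

lemma abs_poly_sum_cutoff:
  assumes a: "0 \<le> a"
  shows "abs_poly_sum (cutoff M m) a \<le> ((1 + a) ^ M - 1) ^ m"
proof -
  define g :: "real poly" where "g = 1 - [:1, - 1:] ^ M"
  have dg: "degree g \<le> M"
    unfolding g_def by (intro degree_diff_le order_trans[OF degree_power_le]) auto
  have g0: "coeff g 0 = 0" by (simp add: g_def poly_0_coeff_0[symmetric])
  have "abs_poly_sum [:1, - 1:] a = 1 + a" by (simp add: abs_poly_sum_def)
  then have pow: "abs_poly_sum ([:1, - 1:] ^ M) a \<le> (1 + a) ^ M"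
    using abs_poly_sum_power[OF a, of "[:1, - 1:]" M] by simp
  have dpow: "degree ([:1, - 1:] ^ M :: real poly) \<le> M"
    by (rule order_trans[OF degree_power_le]) simp
  have "abs_poly_sum g a = (\<Sum>k\<in>{..M} - {0}. \<bar>coeff g k\<bar> * a ^ k)"
    unfolding abs_poly_sum_eq[OF dg] by (subst sum.remove[of _ 0]) (auto simp: g0)
  also have "\<dots> = (\<Sum>k\<in>{..M} - {0}. \<bar>coeff ([:1, - 1:] ^ M) k\<bar> * a ^ k)"
    by (intro sum.cong) (auto simp: g_def)
  also have "\<dots> = abs_poly_sum ([:1, - 1:] ^ M) a - 1"
    unfolding abs_poly_sum_eq[OF dpow]
    by (subst sum.remove[of _ 0]) (auto simp: coeff_0_power)
  finally have "abs_poly_sum g a \<le> (1 + a) ^ M - 1" using pow by simp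
  then have "abs_poly_sum g a ^ m \<le> ((1 + a) ^ M - 1) ^ m"
    by (intro power_mono abs_poly_sum_nonneg a)
  then show ?thesis
    using abs_poly_sum_power[OF a, of g m] by (simp add: cutoff_def g_def)
qed

context weights
begin

section \<open>Averages of spectral sums\<close>

lemma runs_pattern: "runs l (2 * k) (pattern l k)"
proof (induction k)
  case 0
  then show ?case by (simp add: pattern_def runs.Nil)
next
  case (Suc k)
  have "runs l (Suc (Suc (2 * k))) (replicate l True @ replicate l False @ pattern l k)"
    by (intro runs.append Suc) auto
  then show ?case by (simp add: pattern_Suc)
qed

lemma ex_word_poly_words:
  assumes "w \<in> words r s" "length s \<le> q" "1 \<le> q"
  shows "\<exists>F. word_poly q r w F"
proof -
  have "fst ` set w \<subseteq> {..<r}" "length w \<le> q"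
    using assms length_words[OF assms(1)] by (auto simp: words_def)
  then show ?thesis using ex_word_poly assms(3) by blast
qed

text \<open>Both leading coefficients see only power-like words: trivial words give the constant
  term, and a word that is not power-like has slope 1, which the eigenvalue 1 cancels.\<close>

lemma ex_pattern_poly:
  assumes q: "2 * l * k \<le> q" "1 \<le> q"
  shows "\<exists>Q. degree Q \<le> q\<^sup>2 + q + 1
    \<and> (\<forall>n\<ge>q. poly Q (1 / real n) = poly (falling_poly q ^ q) (1 / real n)
        * average n r (\<lambda>\<sigma>. wsum p r (pattern l k) (fixed_points n \<sigma>) - 1) / real n)
    \<and> \<bar>poly Q 0\<bar> \<le> wsum p r (pattern l k) (\<lambda>w. of_bool (power_like w))
    \<and> \<bar>poly (pderiv Q) 0\<bar> \<le> (real q ^ 3 + 1) * wsum p r (pattern l k) (\<lambda>w. of_bool (power_like w))"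
proof -
  let ?s = "pattern l k" and ?G = "falling_poly q ^ q"
  have "\<forall>w\<in>words r ?s. \<exists>F. word_poly q r w F"
    using q by (intro ballI ex_word_poly_words) auto
  then obtain F where "\<forall>w\<in>words r ?s. word_poly q r w (F w)" by (auto dest: bchoice)
  then have P: "word_poly q r w (F w)" if "w \<in> words r ?s" for w using that by blast
  have F: "degree (F w) \<le> q\<^sup>2 + q + 1"
    "q \<le> n \<Longrightarrow> poly (F w) (1 / real n)
        = poly ?G (1 / real n) * average n r (\<lambda>\<sigma>. fixed_points n \<sigma> w) / real n"
    "poly (F w) 0 = of_bool (red w = [])"
    "\<not> power_like w \<Longrightarrow> poly (pderiv (F w)) 0 = 1"
    "\<bar>poly (pderiv (F w)) 0\<bar> \<le> real q ^ 3" if "w \<in> words r ?s" for w n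
    using P[OF that] by (simp_all add: word_poly_def)
  obtain Q0 where Q0: "degree Q0 \<le> q\<^sup>2 + q + 1" "\<And>x. poly Q0 x = wsum p r ?s (\<lambda>w. poly (F w) x)"
    "poly (pderiv Q0) 0 = wsum p r ?s (\<lambda>w. poly (pderiv (F w)) 0)"
    using ex_poly_wsum[of r ?s F "q\<^sup>2 + q + 1" p] F(1) by auto
  \<comment> \<open>At 1 / n the subtracted polynomial equals the denominator divided by n, the
    contribution of the eigenvalue 1. Since the denominator is 1 at 0, its slope there is 1.\<close>
  define Q where "Q = Q0 - [:0, 1:] * ?G"
  have "degree ([:0, 1:] * ?G) \<le> 1 + q * q"
  proof (rule order_trans[OF degree_mult_le add_mono])
    show "degree ?G \<le> q * q"
      by (rule order_trans[OF degree_power_le]) (simp add: degree_falling_poly)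
  qed simp
  then have "degree ([:0, 1:] * ?G) \<le> q\<^sup>2 + q + 1" by (simp add: power2_eq_square)
  then have deg: "degree Q \<le> q\<^sup>2 + q + 1"
    unfolding Q_def using Q0(1) by (intro degree_diff_le)
  have val: "poly Q (1 / real n) = poly ?G (1 / real n)
        * average n r (\<lambda>\<sigma>. wsum p r ?s (fixed_points n \<sigma>) - 1) / real n" if n: "q \<le> n" for n
  proof -
    have "poly Q0 (1 / real n) = wsum p r ?s (\<lambda>w. poly ?G (1 / real n) * average n r (\<lambda>\<sigma>. fixed_points n \<sigma> w) / real n)"
      unfolding Q0(2) by (intro wsum_cong F(2) n)
    also have "\<dots> = poly ?G (1 / real n) * wsum p r ?s (\<lambda>w. average n r (\<lambda>\<sigma>. fixed_points n \<sigma> w)) / real n"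
      by (simp only: wsum_cmult wsum_divide)
    also have "wsum p r ?s (\<lambda>w. average n r (\<lambda>\<sigma>. fixed_points n \<sigma> w))
        = average n r (\<lambda>\<sigma>. wsum p r ?s (fixed_points n \<sigma>))"
      by (simp only: average_wsum)
    finally show ?thesis
      by (simp add: Q_def average_diff algebra_simps diff_divide_distrib)
  qed
  have "\<bar>poly Q 0\<bar> \<le> wsum p r ?s (\<lambda>w. of_bool (power_like w))"
  proof -
    have "poly Q 0 = wsum p r ?s (\<lambda>w. poly (F w) 0)" by (simp add: Q_def Q0(2))
    also have "\<bar>\<dots>\<bar> \<le> wsum p r ?s (\<lambda>w. \<bar>poly (F w) 0\<bar>)" by (rule wsum_abs_le)
    also have "\<dots> \<le> wsum p r ?s (\<lambda>w. of_bool (power_like w))"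
      by (rule wsum_mono) (auto simp: F(3) power_like_def)
    finally show ?thesis .
  qed
  moreover have "\<bar>poly (pderiv Q) 0\<bar> \<le> (real q ^ 3 + 1) * wsum p r ?s (\<lambda>w. of_bool (power_like w))"
  proof -
    have "poly (pderiv Q) 0 = wsum p r ?s (\<lambda>w. poly (pderiv (F w)) 0) - 1"
      by (simp add: Q_def Q0(3) pderiv_diff pderiv_mult pderiv_pCons)
    also have "\<dots> = wsum p r ?s (\<lambda>w. poly (pderiv (F w)) 0 - 1)"
      by (simp add: wsum_diff)
    also have "\<bar>\<dots>\<bar> \<le> wsum p r ?s (\<lambda>w. \<bar>poly (pderiv (F w)) 0 - 1\<bar>)" by (rule wsum_abs_le)
    also have "\<dots> \<le> wsum p r ?s (\<lambda>w. (real q ^ 3 + 1) * of_bool (power_like w))"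
    proof (rule wsum_mono)
      fix w assume w: "w \<in> words r ?s"
      show "\<bar>poly (pderiv (F w)) 0 - 1\<bar> \<le> (real q ^ 3 + 1) * of_bool (power_like w)"
        using F(4)[OF w] F(5)[OF w] by (cases "power_like w") auto
    qed
    finally show ?thesis by (simp only: wsum_cmult)
  qed
  ultimately show ?thesis using deg val by (intro exI[of _ Q]) auto
qed

text \<open>For H without constant term this is the trace of H (A) on the complement of the
  constants, written linearly in fixed point counts so that its mean is accessible.\<close>

definition spectral_sum :: "nat \<Rightarrow> real poly \<Rightarrow> nat \<Rightarrow> (nat \<Rightarrow> nat \<Rightarrow> nat) \<Rightarrow> real" where
  "spectral_sum l H n \<sigma> = (\<Sum>k\<in>{1..degree H}. coeff H k * (wsum p r (pattern l k) (fixed_points n \<sigma>) - 1))"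

lemma spectral_sum_bounds:
  assumes n: "2 \<le> n" and \<sigma>: "\<sigma> \<in> Omega n r" and l: "1 \<le> l" and m: "1 \<le> m"
  shows "0 \<le> spectral_sum l (cutoff M m) n \<sigma>" "spectral_sum l (cutoff M m) n \<sigma> \<le> real n"
    "0 < \<beta> \<Longrightarrow> \<beta> \<le> 1 \<Longrightarrow> \<beta> \<le> second_modulus n \<sigma>
      \<Longrightarrow> poly (cutoff M m) (\<beta> ^ (2 * l)) \<le> spectral_sum l (cutoff M m) n \<sigma>"
proof -
  interpret walk_matrix p r n \<sigma> using n \<sigma> by unfold_locales
  let ?H = "cutoff M m"
  obtain mus where mus: "length mus = n" "\<And>\<mu>. \<mu> \<in> set mus \<Longrightarrow> 0 \<le> \<mu> \<and> \<mu> \<le> 1"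
    "\<And>k. 1 \<le> k \<Longrightarrow> (\<Sum>\<mu>\<leftarrow>mus. \<mu> ^ k) = wsum p r (pattern l k) (fixed_points n \<sigma>) - 1"
    "\<And>\<beta>. 0 < \<beta> \<Longrightarrow> \<beta> \<le> second_modulus n \<sigma> \<Longrightarrow>
         \<exists>\<mu>\<in>set mus. \<beta> ^ (2 * l) \<le> \<mu>"
    using ex_singular_values[OF l] by metis
  have "spectral_sum l ?H n \<sigma> = (\<Sum>k\<in>{1..degree ?H}. coeff ?H k * (\<Sum>\<mu>\<leftarrow>mus. \<mu> ^ k))"
    unfolding spectral_sum_def by (intro sum.cong refl) (simp add: mus(3))
  also have "\<dots> = (\<Sum>k\<le>degree ?H. coeff ?H k * (\<Sum>\<mu>\<leftarrow>mus. \<mu> ^ k))"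
    using coeff_cutoff_0[OF m, of M] by (intro sum.mono_neutral_left) (auto simp: Suc_le_eq)
  also have "\<dots> = (\<Sum>\<mu>\<leftarrow>mus. poly ?H \<mu>)"
    unfolding poly_altdef by (induction mus) (simp_all add: sum.distrib distrib_left)
  finally have eq: "spectral_sum l ?H n \<sigma> = (\<Sum>\<mu>\<leftarrow>mus. poly ?H \<mu>)" .
  show "0 \<le> spectral_sum l ?H n \<sigma>"
    unfolding eq using mus(2) by (intro sum_list_nonneg) (auto intro!: cutoff_bounds(1))
  have "(\<Sum>\<mu>\<leftarrow>mus. poly ?H \<mu>) \<le> (\<Sum>\<mu>\<leftarrow>mus. 1)"
    using mus(2) by (intro sum_list_mono) (auto intro!: cutoff_bounds(2))
  then show "spectral_sum l ?H n \<sigma> \<le> real n"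
    unfolding eq by (simp add: sum_list_triv mus(1))
  assume \<beta>: "0 < \<beta>" "\<beta> \<le> 1" "\<beta> \<le> second_modulus n \<sigma>"
  obtain \<mu> where \<mu>: "\<mu> \<in> set mus" "\<beta> ^ (2 * l) \<le> \<mu>" using mus(4)[OF \<beta>(1,3)] by blast
  have "poly ?H (\<beta> ^ (2 * l)) \<le> poly ?H \<mu>"
    using \<beta> \<mu> mus(2) by (intro cutoff_mono) auto
  also have "\<dots> \<le> (\<Sum>\<mu>\<leftarrow>mus. poly ?H \<mu>)"
    using \<mu>(1) mus(2) by (intro member_le_sum_list) (auto intro!: cutoff_bounds(1))
  finally show "poly ?H (\<beta> ^ (2 * l)) \<le> spectral_sum l ?H n \<sigma>" unfolding eq .
qed

text \<open>A single polynomial \<open>F\<close> in 1 / n represents the normalised mean trace for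
  every large number of points, with \<open>D\<close> bounding its degree. The Taylor bound applies
  to it because the trace lies between 0 and n, and \<open>B\<close> bounds both leading
  coefficients.\<close>

lemma average_spectral_sum_le:
  assumes l: "1 \<le> l" and M: "1 \<le> M" and m: "1 \<le> m" and q_def: "q = 2 * l * (M * m)"
    and D_def: "D = q\<^sup>2 + q + 1" and L_def: "L = 8 * (D + 1) ^ 3" and n: "L \<le> n"
    and B_def: "B = (real q ^ 3 + 1) * (real (q + 2) ^ 4 * real (Suc l) ^ 3)
      * ((1 + real (Suc l) ^ 2 * \<rho> ^ (2 * l)) ^ M - 1) ^ m"
  shows "average n r (spectral_sum l (cutoff M m) n)
    \<le> 2 * real n * (B + B / real n + 32 * real (D + 1) ^ 6 * (real L)\<^sup>2 / (real n)\<^sup>2)"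
proof -
  let ?H = "cutoff M m" and ?G = "falling_poly q ^ q"
  define a where "a = real (Suc l) ^ 2 * \<rho> ^ (2 * l)"
  have a0: "0 \<le> a" using rho_nonneg by (simp add: a_def)
  have q1: "1 \<le> q" using l M m by (simp add: q_def)
  have qD: "q \<le> D" by (simp add: D_def)
  have "D + 1 \<le> (D + 1) ^ 3" by (rule self_le_power) auto
  then have qL: "q \<le> L" "1 \<le> L" using qD by (auto simp: L_def)
  have q_poly: "2 * l * k \<le> q" if "k \<in> {1..degree ?H}" for k
  proof -
    have "k \<le> M * m" using that degree_cutoff[of M m] by simp
    then show ?thesis unfolding q_def by (rule mult_left_mono) simp
  qed
  let ?bad = "\<lambda>k. wsum p r (pattern l k) (\<lambda>w. of_bool (power_like w))"
  define P where "P k Q \<longleftrightarrow> degree Q \<le> D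
    \<and> (\<forall>n\<ge>q. poly Q (1 / real n) = poly ?G (1 / real n)
        * average n r (\<lambda>\<sigma>. wsum p r (pattern l k) (fixed_points n \<sigma>) - 1) / real n)
    \<and> \<bar>poly Q 0\<bar> \<le> ?bad k \<and> \<bar>poly (pderiv Q) 0\<bar> \<le> (real q ^ 3 + 1) * ?bad k" for k Q
  have "\<forall>k\<in>{1..degree ?H}. \<exists>Q. P k Q"
    unfolding P_def D_def by (intro ballI ex_pattern_poly q_poly q1)
  then obtain Q where "\<forall>k\<in>{1..degree ?H}. P k (Q k)" by (auto dest: bchoice)
  then have P: "P k (Q k)" if "k \<in> {1..degree ?H}" for k using that by blast
  have Q: "degree (Q k) \<le> D"
    "q \<le> n \<Longrightarrow> poly (Q k) (1 / real n) = poly ?G (1 / real n)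
        * average n r (\<lambda>\<sigma>. wsum p r (pattern l k) (fixed_points n \<sigma>) - 1) / real n"
    "\<bar>poly (Q k) 0\<bar> \<le> ?bad k"
    "\<bar>poly (pderiv (Q k)) 0\<bar> \<le> (real q ^ 3 + 1) * ?bad k" if "k \<in> {1..degree ?H}" for k n
    using P[OF that] by (simp_all add: P_def)
  define F where "F = (\<Sum>k\<in>{1..degree ?H}. Polynomial.smult (coeff ?H k) (Q k))"
  have degF: "degree F \<le> D"
    unfolding F_def by (intro degree_sum_le order_trans[OF degree_smult_le] Q(1)) auto
  have val: "poly F (1 / real N) = poly ?G (1 / real N) * average N r (spectral_sum l ?H N) / real N"
    if N: "q \<le> N" for N
  proof -
    have "poly F (1 / real N) = (\<Sum>k\<in>{1..degree ?H}. coeff ?H k * (poly ?G (1 / real N)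
        * average N r (\<lambda>\<sigma>. wsum p r (pattern l k) (fixed_points N \<sigma>) - 1) / real N))"
      unfolding F_def poly_sum poly_smult by (intro sum.cong refl) (simp only: Q(2)[OF _ N])
    also have "\<dots> = poly ?G (1 / real N) * (\<Sum>k\<in>{1..degree ?H}. coeff ?H k
        * average N r (\<lambda>\<sigma>. wsum p r (pattern l k) (fixed_points N \<sigma>) - 1)) / real N"
      by (simp add: sum_distrib_left sum_divide_distrib ac_simps)
    finally show ?thesis by (simp only: spectral_sum_def[abs_def] average_sum average_cmult)
  qed
  have G: "0 < poly ?G (1 / real N)" "poly ?G (1 / real N) \<le> 1" if "q \<le> N" for N
  proof -
    have N0: "0 < N" using that q1 by simp
    have pos: "0 < poly (falling_poly q) (1 / real N)"
      using that N0 by (rule poly_falling_poly_pos)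
    then show "0 < poly ?G (1 / real N)" by simp
    have "poly (falling_poly q) (1 / real N) \<le> 1"
      unfolding poly_falling_poly using that N0 by (intro prod_le_1) (auto simp: field_simps)
    then show "poly ?G (1 / real N) \<le> 1" using pos by (auto intro!: power_le_one)
  qed
  \<comment> \<open>This is needed at every \<open>N\<close> from \<open>L\<close> on, not only at
    the given \<open>n\<close>; it follows from the bounds 0 and 1 for the cutoff and for the
    denominator.\<close>
  have bound: "\<bar>poly F (1 / real N)\<bar> \<le> 1" if N: "L \<le> N" for N
  proof -
    have "8 * 1 \<le> L" unfolding L_def by (intro mult_left_mono one_le_power) auto
    then have N2: "2 \<le> N" "q \<le> N" using N qL by auto
    have "average N r (\<lambda>_. 0) \<le> average N r (spectral_sum l ?H N)"
      by (intro average_mono spectral_sum_bounds N2 l m)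
    then have "0 \<le> average N r (spectral_sum l ?H N)" by simp
    moreover have "average N r (spectral_sum l ?H N) \<le> average N r (\<lambda>_. real N)"
      by (intro average_mono spectral_sum_bounds N2 l m)
    ultimately have "0 \<le> average N r (spectral_sum l ?H N) / real N" "average N r (spectral_sum l ?H N) / real N \<le> 1"
      using N2 by auto
    then have "\<bar>poly ?G (1 / real N) * (average N r (spectral_sum l ?H N) / real N)\<bar> \<le> 1 * 1"
      unfolding abs_mult using G[OF N2(2)] by (intro mult_mono) auto
    then show ?thesis by (simp add: val[OF N2(2)])
  qed
  have bad_le: "?bad k \<le> (real (q + 2) ^ 4 * real (Suc l) ^ 3) * a ^ k" if k: "k \<in> {1..degree ?H}" for k
  proof -
    have "?bad k \<le> real (2 * l * k + 2) ^ 4 * real (Suc l) ^ (2 * k + 3) * \<rho> ^ (2 * l * k)"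
      using wsum_power_like_le[OF runs_pattern[of l k]] by simp
    also have "\<dots> \<le> real (q + 2) ^ 4 * real (Suc l) ^ (2 * k + 3) * \<rho> ^ (2 * l * k)"
      using q_poly[OF k] rho_nonneg by (intro mult_right_mono power_mono) (auto simp flip: of_nat_mult)
    also have "\<dots> = (real (q + 2) ^ 4 * real (Suc l) ^ 3) * a ^ k"
      by (simp add: a_def power_add power_mult power_mult_distrib)
    finally show ?thesis .
  qed
  have sumH: "(\<Sum>k\<in>{1..degree ?H}. \<bar>coeff ?H k\<bar> * a ^ k) \<le> ((1 + a) ^ M - 1) ^ m"
  proof -
    have "(\<Sum>k\<in>{1..degree ?H}. \<bar>coeff ?H k\<bar> * a ^ k) \<le> abs_poly_sum ?H a"
      unfolding abs_poly_sum_def using a0 by (intro sum_mono2) auto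
    then show ?thesis using abs_poly_sum_cutoff[OF a0, of M m] by linarith
  qed
  let ?C = "real (q + 2) ^ 4 * real (Suc l) ^ 3"
  have sum_bad: "(\<Sum>k\<in>{1..degree ?H}. \<bar>coeff ?H k\<bar> * ((real q ^ 3 + 1) * ?bad k)) \<le> B"
  proof -
    have "(\<Sum>k\<in>{1..degree ?H}. \<bar>coeff ?H k\<bar> * ((real q ^ 3 + 1) * ?bad k))
        \<le> (\<Sum>k\<in>{1..degree ?H}. \<bar>coeff ?H k\<bar> * ((real q ^ 3 + 1) * (?C * a ^ k)))"
      by (intro sum_mono mult_left_mono bad_le) auto
    also have "\<dots> = (real q ^ 3 + 1) * ?C * (\<Sum>k\<in>{1..degree ?H}. \<bar>coeff ?H k\<bar> * a ^ k)"
      by (simp add: sum_distrib_left ac_simps)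
    also have "\<dots> \<le> (real q ^ 3 + 1) * ?C * ((1 + a) ^ M - 1) ^ m"
      by (intro mult_left_mono sumH) auto
    finally show ?thesis by (simp add: B_def a_def)
  qed
  have F1: "\<bar>poly (pderiv F) 0\<bar> \<le> B"
  proof -
    have "poly (pderiv F) 0 = (\<Sum>k\<in>{1..degree ?H}. coeff ?H k * poly (pderiv (Q k)) 0)"
      by (simp add: F_def pderiv_sum pderiv_smult poly_sum)
    also have "\<bar>\<dots>\<bar> \<le> (\<Sum>k\<in>{1..degree ?H}. \<bar>coeff ?H k\<bar> * ((real q ^ 3 + 1) * ?bad k))"
      by (rule order_trans[OF sum_abs sum_mono]) (auto simp: abs_mult intro!: mult_left_mono Q(4))
    finally show ?thesis using sum_bad by linarith
  qed
  have F0: "\<bar>poly F 0\<bar> \<le> B"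
  proof -
    have "\<bar>poly F 0\<bar> \<le> (\<Sum>k\<in>{1..degree ?H}. \<bar>coeff ?H k\<bar> * ((real q ^ 3 + 1) * ?bad k))"
      unfolding F_def poly_sum poly_smult
    proof (rule order_trans[OF sum_abs sum_mono])
      fix k assume k: "k \<in> {1..degree ?H}"
      have "0 \<le> ?bad k" by (rule wsum_nonneg) simp
      then have "1 * ?bad k \<le> (real q ^ 3 + 1) * ?bad k" by (intro mult_right_mono) auto
      then show "\<bar>coeff ?H k * poly (Q k) 0\<bar> \<le> \<bar>coeff ?H k\<bar> * ((real q ^ 3 + 1) * ?bad k)"
        unfolding abs_mult using Q(3)[OF k] by (intro mult_left_mono) auto
    qed
    then show ?thesis using sum_bad by linarith
  qed
  have n0: "0 < real n" using n qL by simp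
  have qn: "q \<le> n" using n qL by simp
  have "\<bar>poly F (1 / real n)\<bar> \<le> \<bar>poly F 0\<bar> + \<bar>poly (pderiv F) 0\<bar> * (1 / real n)
      + 32 * real (D + 1) ^ 6 * (real L)\<^sup>2 * (1 / real n)\<^sup>2"
  proof (rule poly_Taylor_bound_of_reciprocals[OF degF _ bound])
    show "8 * (D + 1) ^ 3 \<le> L" by (simp only: L_def)
    show "1 / real n \<le> 1 / real L" using n qL by (intro frac_le) auto
  qed auto
  then have "poly F (1 / real n) \<le> \<bar>poly F 0\<bar> + \<bar>poly (pderiv F) 0\<bar> * (1 / real n)
      + 32 * real (D + 1) ^ 6 * (real L)\<^sup>2 * (1 / real n)\<^sup>2"
    by linarith
  also have "\<dots> \<le> B + B * (1 / real n) + 32 * real (D + 1) ^ 6 * (real L)\<^sup>2 * (1 / real n)\<^sup>2"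
    using F0 F1 n0 by (intro add_mono mult_right_mono) auto
  finally have Fn: "poly F (1 / real n) \<le> B + B / real n + 32 * real (D + 1) ^ 6 * (real L)\<^sup>2 / (real n)\<^sup>2"
    by (simp add: power_divide)
  \<comment> \<open>Each of the q^2 factors is at least 1 - q / n, and 8 q^3 is at most n, so
    Bernoulli's inequality suffices. Dividing by the denominator then gives the factor 2 in the
    conclusion.\<close>
  have Ghalf: "1 / 2 \<le> poly ?G (1 / real n)"
  proof -
    have "(1 - real q / real n) ^ q \<le> poly (falling_poly q) (1 / real n)"
    proof -
      have "(\<Prod>j<q. 1 - real q / real n) \<le> poly (falling_poly q) (1 / real n)"
        unfolding poly_falling_poly using qn n0 by (intro prod_mono) (auto simp: field_simps)
      then show ?thesis by simp
    qed
    then have "((1 - real q / real n) ^ q) ^ q \<le> poly (falling_poly q) (1 / real n) ^ q"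
      using qn n0 by (intro power_mono) auto
    moreover have "1 + real (q * q) * (- (real q / real n)) \<le> (1 + - (real q / real n)) ^ (q * q)"
      using qn n0 by (intro Bernoulli_inequality) auto
    moreover have "real (q * q) * (real q / real n) \<le> 1 / 2"
    proof -
      have "8 * q ^ 3 \<le> L"
        unfolding L_def using qD by (intro mult_left_mono power_mono) auto
      then have "8 * real q ^ 3 \<le> real n" using n by (metis (mono_tags) le_trans of_nat_le_iff of_nat_mult of_nat_numeral of_nat_power)
      then show ?thesis using n0 by (simp add: power3_eq_cube field_simps)
    qed
    ultimately show ?thesis by (simp add: power_mult)
  qed
  have avg0: "0 \<le> average n r (spectral_sum l ?H n)"
  proof -
    have "8 * 1 \<le> L" unfolding L_def by (intro mult_left_mono one_le_power) auto
    then have "average n r (\<lambda>_. 0) \<le> average n r (spectral_sum l ?H n)"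
      using n by (intro average_mono spectral_sum_bounds l m) auto
    then show ?thesis by simp
  qed
  have "1 / 2 * average n r (spectral_sum l ?H n) \<le> poly ?G (1 / real n) * average n r (spectral_sum l ?H n)"
    by (intro mult_right_mono Ghalf avg0)
  also have "\<dots> = real n * poly F (1 / real n)"
    using n0 by (simp add: val[OF qn])
  also have "\<dots> \<le> real n * (B + B / real n + 32 * real (D + 1) ^ 6 * (real L)\<^sup>2 / (real n)\<^sup>2)"
    using Fn n0 by (intro mult_left_mono) auto
  finally show ?thesis by (simp add: ac_simps)
qed

end

section \<open>Moments for many permutations\<close>

text \<open>Signs are ignored, since a letter and its inverse come from the same
  permutation.\<close>

definition once_free :: "letter list \<Rightarrow> bool" where
  "once_free w \<longleftrightarrow> (\<forall>i. count_list (map fst w) i \<noteq> 1)"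

subsection \<open>Words with a letter that occurs only once\<close>

lemma fold_lperm_cong:
  "(\<And>a. a \<in> set w \<Longrightarrow> \<sigma> (fst a) = \<tau> (fst a)) \<Longrightarrow> fold (lperm \<sigma>) w = fold (lperm \<tau>) w"
proof (induction w)
  case (Cons a w)
  have "\<sigma> (fst a) = \<tau> (fst a)" using Cons.prems by simp
  then have "lperm \<sigma> a = lperm \<tau> a" by (intro ext) (simp add: lperm_def)
  then show ?case using Cons by simp
qed simp

lemma bij_Omega_update:
  assumes g: "g permutes {..<n}" and i: "i < r"
  shows "bij_betw (\<lambda>\<sigma>. \<sigma>(i := g \<circ> \<sigma> i)) (Omega n r) (Omega n r)"
proof (rule bij_betw_byWitness[where f' = "\<lambda>\<sigma>. \<sigma>(i := inv_into UNIV g \<circ> \<sigma> i)"])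
  have closed: "\<sigma>(i := h \<circ> \<sigma> i) \<in> Omega n r" if "h permutes {..<n}" "\<sigma> \<in> Omega n r" for h \<sigma>
    using that i permutes_compose[OF Omega_permutes[OF that(2), of i] that(1)]
    by (auto simp: Omega_def PiE_dflt_def)
  show "(\<lambda>\<sigma>. \<sigma>(i := g \<circ> \<sigma> i)) ` Omega n r \<subseteq> Omega n r"
    using closed[OF g] by auto
  show "(\<lambda>\<sigma>. \<sigma>(i := inv_into UNIV g \<circ> \<sigma> i)) ` Omega n r \<subseteq> Omega n r"
    using closed[OF permutes_inv[OF g]] by auto
qed (auto simp: fun_eq_iff permutes_inverses[OF g])

text \<open>Replacing permutation \<open>i\<close> by \<open>g \<circ> \<sigma> i\<close> with
  uniform \<open>g\<close> preserves the mean. As the index occurs once, a point is fixed exactly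
  when \<open>g\<close> sends one given point to another, which has probability 1 / n; there are n
  points.\<close>

lemma average_fixed_points_single:
  assumes n: "0 < n" and w: "w = u @ [(i, b)] @ v" "i \<notin> fst ` set u" "i \<notin> fst ` set v" and i: "i < r"
  shows "average n r (\<lambda>\<sigma>. fixed_points n \<sigma> w) = 1"
proof -
  let ?S = "{g. g permutes {..<n}}"
  have finS: "finite ?S" by (simp add: finite_permutations)
  have cardS: "card ?S = fact n" by (simp add: card_permutations)
  have count: "real (card {g \<in> ?S. g a = c}) = fact (n - 1)" if "a < n" "c < n" for a c
    using card_permutations_extending[of "{(a, c)}" "{..<n}"] that
    by (simp add: partial_injection_def single_valued_def conj_commute)
  let ?up = "\<lambda>g \<sigma>. \<sigma>(i := g \<circ> \<sigma> i)"
  have shift: "(\<Sum>\<sigma>\<in>Omega n r. fixed_points n (?up g \<sigma>) w) = (\<Sum>\<sigma>\<in>Omega n r. fixed_points n \<sigma> w)"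
    if "g \<in> ?S" for g
    by (rule sum.reindex_bij_betw[OF bij_Omega_update]) (use that i in auto)
  have inner: "(\<Sum>g\<in>?S. fixed_points n (?up g \<sigma>) w) = fact n" if \<sigma>: "\<sigma> \<in> Omega n r" for \<sigma>
  proof -
    have up: "?up g \<sigma> \<in> Omega n r" if "g \<in> ?S" for g
      using bij_betw_apply[OF bij_Omega_update \<sigma>] that i by auto
    let ?u = "fold (lperm \<sigma>) u" and ?v = "fold (lperm \<sigma>) v" and ?v' = "fold (lperm \<sigma>) (inv_word v)"
    have uv: "fold (lperm (?up g \<sigma>)) u = ?u" "fold (lperm (?up g \<sigma>)) v = ?v" for g
    proof -
      have "fst a \<noteq> i" if "a \<in> set u \<union> set v" for a using that w(2,3) by auto
      then have eq: "?up g \<sigma> (fst a) = \<sigma> (fst a)" if "a \<in> set u \<union> set v" for a using that by simp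
      show "fold (lperm (?up g \<sigma>)) u = ?u" "fold (lperm (?up g \<sigma>)) v = ?v"
        by (intro fold_lperm_cong eq; simp)+
    qed
    have v: "?v x = y \<longleftrightarrow> x = ?v' y" for x y
      using fold_lperm_inv_word[OF \<sigma>, of v] fold_lperm_inv_word[OF \<sigma>, of "inv_word v"] by auto
    define a where "a x = (if b then \<sigma> i (?u x) else \<sigma> i (?v' x))" for x
    define c where "c x = (if b then ?v' x else ?u x)" for x
    have ac: "a x < n" "c x < n" if "x < n" for x
      using fold_lperm_less[OF \<sigma> that] permutes_in_image[OF Omega_permutes[OF \<sigma>, of i]]
      by (auto simp: a_def c_def)
    have fp: "fold (lperm (?up g \<sigma>)) w x = x \<longleftrightarrow> g (a x) = c x" if "g \<in> ?S" for g x
    proof -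
      have "fold (lperm (?up g \<sigma>)) w x = x \<longleftrightarrow> lperm (?up g \<sigma>) (i, b) (?u x) = ?v' x"
        unfolding w(1) by (simp add: uv v)
      also have "\<dots> \<longleftrightarrow> g (a x) = c x"
      proof (cases b)
        case False
        have "lperm (?up g \<sigma>) (i, False) y = z \<longleftrightarrow> lperm (?up g \<sigma>) (i, True) z = y" for y z
          using lperm_linv[OF up[OF that], of "(i, False)"] lperm_linv'[OF up[OF that], of "(i, False)"]
          by (auto simp: linv_def)
        then show ?thesis using False by (simp add: a_def c_def lperm_def)
      qed (simp add: a_def c_def lperm_def)
      finally show ?thesis .
    qed
    have "(\<Sum>g\<in>?S. fixed_points n (?up g \<sigma>) w) = (\<Sum>g\<in>?S. \<Sum>x<n. of_bool (g (a x) = c x))"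
    proof (rule sum.cong[OF refl])
      fix g assume "g \<in> ?S"
      then have "{x \<in> {..<n}. fold (lperm (?up g \<sigma>)) w x = x} = {x \<in> {..<n}. g (a x) = c x}"
        by (simp only: fp)
      then show "fixed_points n (?up g \<sigma>) w = (\<Sum>x<n. of_bool (g (a x) = c x))"
        unfolding fixed_points_def by (simp add: of_bool_def sum.If_cases Int_def)
    qed
    also have "\<dots> = (\<Sum>x<n. \<Sum>g\<in>?S. of_bool (g (a x) = c x))" by (rule sum.swap)
    also have "\<dots> = (\<Sum>x<n. fact (n - 1))"
    proof (rule sum.cong[OF refl])
      fix x assume "x \<in> {..<n}"
      then show "(\<Sum>g\<in>?S. of_bool (g (a x) = c x)) = (fact (n - 1) :: real)"
        using count[OF ac, of x x] finS by (simp add: of_bool_def sum.If_cases Int_def)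
    qed
    also have "\<dots> = fact n" using n by (simp add: fact_reduce)
    finally show ?thesis .
  qed
  have "fact n * (\<Sum>\<sigma>\<in>Omega n r. fixed_points n \<sigma> w) = (\<Sum>g\<in>?S. \<Sum>\<sigma>\<in>Omega n r. fixed_points n (?up g \<sigma>) w)"
    using cardS by (simp add: shift)
  also have "\<dots> = (\<Sum>\<sigma>\<in>Omega n r. \<Sum>g\<in>?S. fixed_points n (?up g \<sigma>) w)" by (rule sum.swap)
  also have "\<dots> = fact n * real (card (Omega n r))" by (simp add: inner)
  finally have "(\<Sum>\<sigma>\<in>Omega n r. fixed_points n \<sigma> w) = real (card (Omega n r))" by simp
  then show ?thesis using card_Omega_pos[of n r] by (auto simp: average_def)
qed

lemma fixed_points_le: "fixed_points n \<sigma> w \<le> real n"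
proof -
  have "card {x \<in> {..<n}. fold (lperm \<sigma>) w x = x} \<le> card {..<n}" by (rule card_mono) auto
  then show ?thesis by (simp add: fixed_points_def)
qed

lemma average_fixed_points_le:
  assumes n: "0 < n" and w: "w \<in> words r s"
  shows "average n r (\<lambda>\<sigma>. fixed_points n \<sigma> w) - 1 \<le> real n * of_bool (once_free w)"
proof (cases "once_free w")
  case True
  have "average n r (\<lambda>\<sigma>. fixed_points n \<sigma> w) \<le> average n r (\<lambda>_. real n)"
    by (rule average_mono) (rule fixed_points_le)
  with True show ?thesis by simp
next
  case False
  then obtain i where i: "count_list (map fst w) i = 1" by (auto simp: once_free_def)
  then have i_in: "i \<in> set (map fst w)" using count_notin[of i "map fst w"] by (cases "i \<in> set (map fst w)") simp_all
  then obtain xs ys where xy: "map fst w = xs @ i # ys" "i \<notin> set xs"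
    using split_list_first[OF i_in] by blast
  then have "i \<notin> set ys" using i by (auto simp: count_list_0_iff)
  obtain u c v where uv: "w = u @ c # v" "map fst u = xs" "fst c = i" "map fst v = ys"
    using xy(1) by (auto simp: map_eq_append_conv map_eq_Cons_conv)
  have "i < r" using w i_in by (auto simp: words_def)
  then have "average n r (\<lambda>\<sigma>. fixed_points n \<sigma> w) = 1"
    using uv xy(2) \<open>i \<notin> set ys\<close>
    by (intro average_fixed_points_single[OF n, of w u i "snd c" v]) (auto simp flip: set_map)
  with False show ?thesis by simp
qed

subsection \<open>The exponential generating function of words without such letters\<close>

text \<open>The exponential generating function of the further occurrences of one index of weight
  \<open>x\<close> that has occurred \<open>c\<close> times, restricted to totals other than 1: the
  linear term is missing for \<open>c = 0\<close>, the constant term for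
  \<open>c = 1\<close>.\<close>

definition gen_factor :: "nat \<Rightarrow> real \<Rightarrow> real fps" where
  "gen_factor c x = (if c = 0 then fps_exp x - fps_const x * fps_X
     else if c = 1 then fps_exp x - 1 else fps_exp x)"

lemma fps_deriv_gen_factor: "fps_deriv (gen_factor c x) = fps_const x * gen_factor (Suc c) x"
  by (simp add: gen_factor_def fps_exp_deriv algebra_simps)

lemma gen_factor_nth_0: "fps_nth (gen_factor c x) 0 = of_bool (c \<noteq> 1)"
  by (simp add: gen_factor_def)

lemma fps_deriv_prod:
  "finite A \<Longrightarrow> fps_deriv (\<Prod>i\<in>A. f i) = (\<Sum>i\<in>A. fps_deriv (f i) * (\<Prod>j\<in>A - {i}. f j :: real fps))"
proof (induction A rule: finite_induct)
  case (insert a A)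
  have "fps_deriv (\<Prod>i\<in>insert a A. f i) = fps_deriv (f a) * (\<Prod>j\<in>A. f j) + f a * fps_deriv (\<Prod>j\<in>A. f j)"
    using insert by (simp add: fps_deriv_mult algebra_simps)
  also have "f a * fps_deriv (\<Prod>j\<in>A. f j) = (\<Sum>i\<in>A. fps_deriv (f i) * (\<Prod>j\<in>insert a A - {i}. f j))"
    unfolding insert.IH sum_distrib_left
  proof (rule sum.cong[OF refl])
    fix i assume "i \<in> A"
    then have "insert a A - {i} = insert a (A - {i})" using insert by auto
    then show "f a * (fps_deriv (f i) * (\<Prod>j\<in>A - {i}. f j)) = fps_deriv (f i) * (\<Prod>j\<in>insert a A - {i}. f j)"
      using insert by (simp add: algebra_simps)
  qed
  finally show ?case using insert by (simp add: Diff_insert_absorb)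
qed simp

lemma fps_prod_nth_0: "fps_nth (\<Prod>i\<in>A. f i) 0 = (\<Prod>i\<in>A. fps_nth (f i :: real fps) 0)"
  by (induction A rule: infinite_finite_induct) auto

definition gen_fun :: "(nat \<Rightarrow> real) \<Rightarrow> nat \<Rightarrow> (nat \<Rightarrow> nat) \<Rightarrow> real fps" where
  "gen_fun p r c = (\<Prod>i<r. gen_factor (c i) (p i))"

lemma fps_deriv_gen_fun: "fps_deriv (gen_fun p r c) = (\<Sum>i<r. fps_const (p i) * gen_fun p r (c(i := Suc (c i))))"
  unfolding gen_fun_def fps_deriv_prod[OF finite_lessThan]
proof (rule sum.cong[OF refl])
  fix i assume i: "i \<in> {..<r}"
  have "(\<Prod>j<r. gen_factor ((c(i := Suc (c i))) j) (p j))
      = gen_factor (Suc (c i)) (p i) * (\<Prod>j\<in>{..<r} - {i}. gen_factor ((c(i := Suc (c i))) j) (p j))"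
    using i by (subst prod.remove[of _ i]) auto
  also have "(\<Prod>j\<in>{..<r} - {i}. gen_factor ((c(i := Suc (c i))) j) (p j)) = (\<Prod>j\<in>{..<r} - {i}. gen_factor (c j) (p j))"
    by (rule prod.cong) auto
  finally show "fps_deriv (gen_factor (c i) (p i)) * (\<Prod>j\<in>{..<r} - {i}. gen_factor (c j) (p j))
      = fps_const (p i) * (\<Prod>j<r. gen_factor ((c(i := Suc (c i))) j) (p j))"
    by (simp only: fps_deriv_gen_factor mult.assoc)
qed

text \<open>Here \<open>c i\<close> counts the occurrences of \<open>i\<close> in the letters that have already been read.\<close>

lemma wsum_once_free_gen_fun:
  "wsum p r s (\<lambda>w. of_bool (\<forall>i<r. c i + count_list (map fst w) i \<noteq> 1)) = fact (length s) * fps_nth (gen_fun p r c) (length s)"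
proof (induction s arbitrary: c)
  case Nil
  have "fps_nth (gen_fun p r c) 0 = (\<Prod>i<r. of_bool (c i \<noteq> 1))"
    by (simp add: gen_fun_def fps_prod_nth_0 gen_factor_nth_0)
  also have "\<dots> = of_bool (\<forall>i<r. c i \<noteq> 1)"
    by (cases "\<forall>i<r. c i \<noteq> 1") (auto intro!: prod_zero)
  finally show ?case by simp
next
  case (Cons b s)
  let ?k = "length s"
  have "wsum p r (b # s) (\<lambda>w. of_bool (\<forall>i<r. c i + count_list (map fst w) i \<noteq> 1))
      = (\<Sum>j<r. p j * wsum p r s (\<lambda>w. of_bool (\<forall>i<r. (c(j := Suc (c j))) i + count_list (map fst w) i \<noteq> 1)))"
    unfolding wsum.simps
  proof (intro sum.cong refl arg_cong2[where f = "(*)"] wsum_cong)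
    fix j w
    have "c i + count_list (map fst ((j, b) # w)) i = (c(j := Suc (c j))) i + count_list (map fst w) i" for i
      by simp
    then show "of_bool (\<forall>i<r. c i + count_list (map fst ((j, b) # w)) i \<noteq> 1)
        = (of_bool (\<forall>i<r. (c(j := Suc (c j))) i + count_list (map fst w) i \<noteq> 1) :: real)"
      by simp
  qed
  also have "\<dots> = (\<Sum>j<r. p j * (fact ?k * fps_nth (gen_fun p r (c(j := Suc (c j)))) ?k))"
    by (simp only: Cons.IH)
  also have "\<dots> = fact ?k * fps_nth (fps_deriv (gen_fun p r c)) ?k"
    unfolding fps_deriv_gen_fun by (simp add: fps_sum_nth sum_distrib_left ac_simps)
  also have "\<dots> = fact (Suc ?k) * fps_nth (gen_fun p r c) (Suc ?k)"
    by (simp add: fps_deriv_nth ac_simps)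
  finally show ?case by simp
qed

text \<open>For nonnegative coefficients, a bound on all partial sums replaces both convergence at
  \<open>t\<close> and a bound on the value there.\<close>

definition eval_le :: "real \<Rightarrow> real fps \<Rightarrow> real \<Rightarrow> bool" where
  "eval_le t f v \<longleftrightarrow> (\<forall>k. 0 \<le> fps_nth f k) \<and> (\<forall>K. (\<Sum>k\<le>K. fps_nth f k * t ^ k) \<le> v)"

lemma eval_le_mult:
  assumes t: "0 \<le> t" and f: "eval_le t f v" and g: "eval_le t g w"
  shows "eval_le t (f * g) (v * w)"
  unfolding eval_le_def
proof (intro conjI allI)
  have f0: "0 \<le> fps_nth f k" and g0: "0 \<le> fps_nth g k" for k using f g by (auto simp: eval_le_def)
  show "0 \<le> fps_nth (f * g) k" for k
    unfolding fps_mult_nth by (intro sum_nonneg mult_nonneg_nonneg f0 g0)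
  fix K
  let ?h = "\<lambda>x. (fps_nth f (fst x) * t ^ fst x) * (fps_nth g (snd x) * t ^ snd x)"
  have "(\<Sum>k\<le>K. fps_nth (f * g) k * t ^ k) = (\<Sum>k\<le>K. \<Sum>i\<le>k. ?h (i, k - i))"
    unfolding fps_mult_nth sum_distrib_right atLeast0AtMost
    by (intro sum.cong refl) (auto simp: power_add[symmetric] ac_simps simp del: power_add)
  also have "\<dots> = (\<Sum>x\<in>{(i, j). i + j \<le> K}. ?h x)"
    using sum.triangle_reindex_eq[of "\<lambda>i j. ?h (i, j)" K] by (simp add: case_prod_unfold)
  also have "\<dots> \<le> (\<Sum>x\<in>{..K} \<times> {..K}. ?h x)"
    using t by (intro sum_mono2 mult_nonneg_nonneg f0 g0) auto
  also have "\<dots> = (\<Sum>i\<le>K. fps_nth f i * t ^ i) * (\<Sum>j\<le>K. fps_nth g j * t ^ j)"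
    by (simp add: sum_product sum.cartesian_product case_prod_unfold)
  also have "\<dots> \<le> v * w"
  proof (intro mult_mono)
    show "(\<Sum>i\<le>K. fps_nth f i * t ^ i) \<le> v" "(\<Sum>i\<le>K. fps_nth g i * t ^ i) \<le> w" using f g by (auto simp: eval_le_def)
    then show "0 \<le> v" using f0 t by (meson mult_nonneg_nonneg order_trans sum_nonneg zero_le_power)
    show "0 \<le> (\<Sum>i\<le>K. fps_nth g i * t ^ i)" using g0 t by (intro sum_nonneg) auto
  qed
  finally show "(\<Sum>k\<le>K. fps_nth (f * g) k * t ^ k) \<le> v * w" .
qed

lemma eval_le_prod:
  assumes "0 \<le> t" "finite A" "\<And>i. i \<in> A \<Longrightarrow> eval_le t (f i) (v i)"
  shows "eval_le t (\<Prod>i\<in>A. f i) (\<Prod>i\<in>A. v i)"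
  using assms(2,3)
proof (induction A rule: finite_induct)
  case empty
  have "(\<Sum>k\<le>K. fps_nth (1 :: real fps) k * t ^ k) = 1" for K
    by (subst sum.remove[of _ 0]) auto
  then show ?case by (simp add: eval_le_def)
next
  case (insert a A)
  then show ?case by (simp add: eval_le_mult[OF assms(1)])
qed

lemma exp_minus_le_exp_square:
  assumes "0 \<le> (x :: real)"
  shows "exp x - x \<le> exp (x\<^sup>2)"
proof (cases "x \<le> 1")
  case True
  then have "exp x \<le> 1 + x + x\<^sup>2" using exp_bound[of x] assms by simp
  then show ?thesis using exp_ge_add_one_self[of "x\<^sup>2"] by linarith
next
  case False
  then have "x \<le> x\<^sup>2" by (simp add: power2_eq_square)
  then have "exp x \<le> exp (x\<^sup>2)" by simp
  then show ?thesis using assms by linarith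
qed

lemma eval_le_gen_factor:
  assumes x: "0 \<le> x" and t: "0 \<le> t"
  shows "eval_le t (gen_factor 0 x) (exp ((x * t)\<^sup>2))"
  unfolding eval_le_def
proof (intro conjI allI)
  have nth: "fps_nth (gen_factor 0 x) k = (if k = 1 then 0 else x ^ k / fact k)" for k
    by (auto simp: gen_factor_def)
  show "0 \<le> fps_nth (gen_factor 0 x) k" for k using x by (simp add: nth)
  fix K
  have exp_sum: "(\<Sum>k\<in>A. (x * t) ^ k / fact k) \<le> exp (x * t)" if "finite A" for A
  proof -
    have "(\<lambda>k. (x * t) ^ k /\<^sub>R fact k) sums exp (x * t)" by (rule exp_converges)
    then have "(\<lambda>k. (x * t) ^ k / fact k) sums exp (x * t)" by (simp add: divide_inverse mult.commute)
    then show ?thesis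
      using sum_le_suminf[of "\<lambda>k. (x * t) ^ k / fact k" A] that x t by (auto simp: sums_iff)
  qed
  have "(\<Sum>k\<le>K. fps_nth (gen_factor 0 x) k * t ^ k) = (\<Sum>k\<in>{..K} - {1}. (x * t) ^ k / fact k)"
    by (rule sum.mono_neutral_cong_right) (auto simp: nth power_mult_distrib)
  also have "\<dots> = (\<Sum>k\<in>insert 1 ({..K} - {1}). (x * t) ^ k / fact k) - x * t"
    by (subst sum.insert) auto
  also have "\<dots> \<le> exp (x * t) - x * t" using exp_sum[of "insert 1 ({..K} - {1})"] by simp
  also have "\<dots> \<le> exp ((x * t)\<^sup>2)" using x t by (intro exp_minus_le_exp_square) auto
  finally show "(\<Sum>k\<le>K. fps_nth (gen_factor 0 x) k * t ^ k) \<le> exp ((x * t)\<^sup>2)" .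
qed

context weights
begin

text \<open>A nonnegative coefficient of order k is at most the value at \<open>t\<close> divided by
  t^k. Since the linear terms are missing, each factor is at most exp of the square of
  \<open>p i * t\<close>, which is how \<open>\<rho>\<close> enters.\<close>

lemma wsum_once_free_le:
  assumes t: "0 < t"
  shows "wsum p r s (\<lambda>w. of_bool (once_free w)) \<le> fact (length s) / t ^ length s * exp (\<rho>\<^sup>2 * t\<^sup>2)"
proof -
  let ?k = "length s"
  have "eval_le t (gen_fun p r (\<lambda>_. 0)) (\<Prod>i<r. exp ((p i * t)\<^sup>2))"
    unfolding gen_fun_def using t p_nonneg by (intro eval_le_prod eval_le_gen_factor) auto
  also have "(\<Prod>i<r. exp ((p i * t)\<^sup>2)) = exp (\<rho>\<^sup>2 * t\<^sup>2)"
    by (simp add: exp_sum[symmetric] rho_sq sum_distrib_right power_mult_distrib)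
  finally have ev: "eval_le t (gen_fun p r (\<lambda>_. 0)) (exp (\<rho>\<^sup>2 * t\<^sup>2))" .
  have "fps_nth (gen_fun p r (\<lambda>_. 0)) ?k * t ^ ?k \<le> (\<Sum>k\<le>?k. fps_nth (gen_fun p r (\<lambda>_. 0)) k * t ^ k)"
    using ev t by (intro member_le_sum) (auto simp: eval_le_def)
  also have "\<dots> \<le> exp (\<rho>\<^sup>2 * t\<^sup>2)" using ev by (simp add: eval_le_def)
  finally have "fps_nth (gen_fun p r (\<lambda>_. 0)) ?k \<le> exp (\<rho>\<^sup>2 * t\<^sup>2) / t ^ ?k" using t by (simp add: field_simps)
  then have "fact ?k * fps_nth (gen_fun p r (\<lambda>_. 0)) ?k \<le> fact ?k * (exp (\<rho>\<^sup>2 * t\<^sup>2) / t ^ ?k)"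
    by (intro mult_left_mono) auto
  moreover have "wsum p r s (\<lambda>w. of_bool (once_free w)) \<le> fact ?k * fps_nth (gen_fun p r (\<lambda>_. 0)) ?k"
    unfolding wsum_once_free_gen_fun[of p r s "\<lambda>_. 0", symmetric]
    by (rule wsum_mono) (auto simp: once_free_def)
  ultimately show ?thesis by simp
qed

text \<open>Plain moments suffice once \<open>\<epsilon>\<close> exceeds a multiple of \<open>sqrt (ln n)\<close>, as in the
  noncommutative Khintchine inequality.\<close>

lemma prob_le_moment:
  assumes n: "2 \<le> n" and \<beta>: "0 < \<beta>" and m: "1 \<le> m"
  shows "tail_prob n \<beta>
    \<le> real n * (4 * exp 1 * real m * (\<rho> / \<beta>)\<^sup>2) ^ m"
proof -
  let ?f = "\<lambda>\<sigma>. wsum p r (pattern 1 m) (fixed_points n \<sigma>) - 1"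
  have f: "0 \<le> ?f \<sigma>" "\<beta> \<le> second_modulus n \<sigma> \<Longrightarrow> \<beta> ^ (2 * m) \<le> ?f \<sigma>"
    if \<sigma>: "\<sigma> \<in> Omega n r" for \<sigma>
  proof -
    interpret walk_matrix p r n \<sigma> using n \<sigma> by unfold_locales
    from ex_singular_values[of 1] obtain mus where *: "\<forall>\<mu>\<in>set mus. 0 \<le> \<mu> \<and> \<mu> \<le> 1"
      "\<forall>k\<ge>1. (\<Sum>\<mu>\<leftarrow>mus. \<mu> ^ k) = wsum p r (pattern 1 k) (fixed_points n \<sigma>) - 1"
      "\<forall>\<beta>>0. \<beta> \<le> second_modulus n \<sigma> \<longrightarrow> (\<exists>\<mu>\<in>set mus. \<beta> ^ (2 * 1) \<le> \<mu>)"
      by auto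
    have mus: "\<And>\<mu>. \<mu> \<in> set mus \<Longrightarrow> 0 \<le> \<mu>" "(\<Sum>\<mu>\<leftarrow>mus. \<mu> ^ m) = ?f \<sigma>"
      "\<beta> \<le> second_modulus n \<sigma> \<Longrightarrow> \<exists>\<mu>\<in>set mus. \<beta>\<^sup>2 \<le> \<mu>"
      using * m \<beta> by simp_all
    show "0 \<le> ?f \<sigma>" unfolding mus(2)[symmetric] using mus(1) by (intro sum_list_nonneg) auto
    assume "\<beta> \<le> second_modulus n \<sigma>"
    then obtain \<mu> where \<mu>: "\<mu> \<in> set mus" "\<beta>\<^sup>2 \<le> \<mu>" using mus(3) by auto
    have "\<beta> ^ (2 * m) \<le> \<mu> ^ m" using \<mu> \<beta> by (simp add: power_mult power_mono)
    also have "\<dots> \<le> (\<Sum>\<mu>\<leftarrow>mus. \<mu> ^ m)"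
      using \<mu> mus(1) by (intro member_le_sum_list) auto
    finally show "\<beta> ^ (2 * m) \<le> ?f \<sigma>" by (simp only: mus(2))
  qed
  have n0: "0 < n" using n by simp
  have "average n r ?f = wsum p r (pattern 1 m) (\<lambda>w. average n r (\<lambda>\<sigma>. fixed_points n \<sigma> w) - 1)"
    by (simp add: average_diff average_wsum wsum_diff)
  also have "\<dots> \<le> wsum p r (pattern 1 m) (\<lambda>w. real n * of_bool (once_free w))"
    by (rule wsum_mono) (rule average_fixed_points_le[OF n0])
  also have "\<dots> = real n * wsum p r (pattern 1 m) (\<lambda>w. of_bool (once_free w))" by (rule wsum_cmult)
  also have "\<dots> \<le> real n * ((4 * exp 1 * real m) ^ m * \<rho> ^ (2 * m))"
  proof (rule mult_left_mono)
    \<comment> \<open>This choice minimises exp (rho^2 t^2) / t^(2 m).\<close>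
    let ?t = "sqrt (real m) / \<rho>"
    have t: "0 < ?t" using m rho_pos by simp
    have "wsum p r (pattern 1 m) (\<lambda>w. of_bool (once_free w)) \<le> fact (2 * m) / ?t ^ (2 * m) * exp (\<rho>\<^sup>2 * ?t\<^sup>2)"
      using wsum_once_free_le[OF t, of "pattern 1 m"] by simp
    also have "?t ^ (2 * m) = real m ^ m / \<rho> ^ (2 * m)"
      using m by (simp add: power_divide power_mult)
    also have "\<rho>\<^sup>2 * ?t\<^sup>2 = real m"
      using rho_pos by (simp add: power_divide)
    also have "fact (2 * m) / (real m ^ m / \<rho> ^ (2 * m)) * exp (real m)
        \<le> (2 * real m) ^ (2 * m) / (real m ^ m / \<rho> ^ (2 * m)) * exp (real m)"
      using fact_le_power[of "2 * m", where 'a = real] rho_nonneg by (intro mult_right_mono divide_right_mono) auto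
    also have "\<dots> = (4 * exp 1 * real m) ^ m * \<rho> ^ (2 * m)"
    proof -
      have "(2 * real m) ^ (2 * m) = 4 ^ m * real m ^ m * real m ^ m"
        by (simp add: power_mult power2_eq_square power_mult_distrib)
      moreover have "exp (real m) = exp 1 ^ m" using exp_of_nat_mult[of m "1 :: real"] by simp
      ultimately show ?thesis
        using m rho_pos by (simp add: power_mult_distrib)
    qed
    finally show "wsum p r (pattern 1 m) (\<lambda>w. of_bool (once_free w)) \<le> (4 * exp 1 * real m) ^ m * \<rho> ^ (2 * m)" .
  qed simp
  finally have avg: "average n r ?f \<le> real n * ((4 * exp 1 * real m) ^ m * \<rho> ^ (2 * m))" .
  have "tail_prob n \<beta> \<le> average n r ?f / \<beta> ^ (2 * m)"
    by (rule prob_le_average) (use f \<beta> in auto)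
  also have "\<dots> \<le> real n * ((4 * exp 1 * real m) ^ m * \<rho> ^ (2 * m)) / \<beta> ^ (2 * m)"
    using avg \<beta> by (intro divide_right_mono) auto
  also have "\<dots> = real n * (4 * exp 1 * real m * (\<rho> / \<beta>)\<^sup>2) ^ m"
    by (simp add: power_mult_distrib power_divide power_mult)
  finally show ?thesis .
qed

end

section \<open>Choice of the parameters\<close>

lemma power_ge_quadratic:
  assumes "0 \<le> (x :: real)"
  shows "1 + real k * x + real k * (real k - 1) / 2 * x\<^sup>2 \<le> (1 + x) ^ k"
proof (induction k)
  case (Suc k)
  have "0 \<le> real k * (real k - 1) / 2 * x\<^sup>2 * x"
    using assms by (cases k) auto
  then have "1 + real (Suc k) * x + real (Suc k) * (real (Suc k) - 1) / 2 * x\<^sup>2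
      \<le> (1 + x) * (1 + real k * x + real k * (real k - 1) / 2 * x\<^sup>2)"
    by (simp add: field_simps power2_eq_square)
  also have "\<dots> \<le> (1 + x) * (1 + x) ^ k" using Suc assms by (intro mult_left_mono) auto
  finally show ?case by simp
qed simp

lemma exp_1_le_3: "exp 1 \<le> (3 :: real)"
  using exp_bound[of 1] by simp

context weights
begin

text \<open>Squared singular values are at most 1. This disposes of thresholds above 1, where
  \<open>cutoff\<close> is not under control.\<close>

lemma prob_eq_0:
  assumes n: "2 \<le> n" and \<beta>: "1 < \<beta>"
  shows "tail_prob n \<beta> = 0"
proof -
  have "\<not> \<beta> \<le> second_modulus n \<sigma>" if \<sigma>: "\<sigma> \<in> Omega n r" for \<sigma>
  proof
    assume *: "\<beta> \<le> second_modulus n \<sigma>"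
    interpret walk_matrix p r n \<sigma> using n \<sigma> by unfold_locales
    from ex_singular_values[of 1] obtain mus where mus: "\<forall>\<mu>\<in>set mus. 0 \<le> \<mu> \<and> \<mu> \<le> 1"
      "\<forall>\<beta>>0. \<beta> \<le> second_modulus n \<sigma> \<longrightarrow> (\<exists>\<mu>\<in>set mus. \<beta> ^ (2 * 1) \<le> \<mu>)"
      by auto
    have "\<exists>\<mu>\<in>set mus. \<beta> ^ (2 * 1) \<le> \<mu>" using mus(2)[rule_format, of \<beta>] * \<beta> by simp
    then obtain \<mu> where "\<mu> \<le> 1" "\<beta>\<^sup>2 \<le> \<mu>" using mus(1) by auto
    moreover have "1 < \<beta>\<^sup>2" using \<beta> by (simp add: one_less_power)
    ultimately show False by linarith
  qed
  then have "tail_prob n \<beta> \<le> average n r (\<lambda>_. 0) / 1"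
    by (intro prob_le_average) auto
  then show ?thesis by (simp add: measure_le_0_iff)
qed

text \<open>A moment of order about ln n, whose base is at most exp (-2), yields n times
  n^(-2).\<close>

lemma prob_le_large_deviation:
  assumes n: "2 \<le> n" and \<epsilon>: "17 * sqrt (ln (real n)) \<le> \<epsilon>"
  shows "tail_prob n ((1 + \<epsilon>) * \<rho>) \<le> 1 / real n"
proof -
  define x where "x = ln (real n)"
  have "ln 2 \<le> x" using n by (simp add: x_def)
  then have x: "2 / 3 \<le> x" using ln2_ge_two_thirds by linarith
  define m where "m = nat \<lceil>x\<rceil>"
  have m: "x \<le> real m" "real m \<le> x + 1" using x by (auto simp: m_def)
  have m1: "1 \<le> m" using m(1) x by (cases m) auto
  have \<epsilon>0: "0 < \<epsilon>" using \<epsilon> x by (auto simp: x_def intro: less_le_trans[rotated])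
  have \<beta>: "0 < (1 + \<epsilon>) * \<rho>" using \<epsilon>0 rho_pos by simp
  have "tail_prob n ((1 + \<epsilon>) * \<rho>)
    \<le> real n * (4 * exp 1 * real m * (\<rho> / ((1 + \<epsilon>) * \<rho>))\<^sup>2) ^ m"
    by (rule prob_le_moment[OF n \<beta> m1])
  also have "\<rho> / ((1 + \<epsilon>) * \<rho>) = 1 / (1 + \<epsilon>)" using rho_pos by simp
  also have "4 * exp 1 * real m * (1 / (1 + \<epsilon>))\<^sup>2 \<le> exp (- 2)"
  proof -
    have "(17 * sqrt x)\<^sup>2 \<le> (1 + \<epsilon>)\<^sup>2" using \<epsilon> x \<epsilon>0 by (intro power_mono) (auto simp: x_def)
    then have e: "289 * x \<le> (1 + \<epsilon>)\<^sup>2" using x by (simp add: power_mult_distrib)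
    \<comment> \<open>Here \<open>m\<close> is at most x + 1, hence at most 5 / 2 times
      \<open>x\<close>, as \<open>x\<close> is at least 2 / 3. The constant 17 is chosen so that 9
      times 30 is below 17^2 = 289.\<close>
    have "4 * exp 1 * real m \<le> 4 * 3 * (5 / 2 * x)"
      using m x exp_1_le_3 by (intro mult_mono) auto
    also have "\<dots> \<le> 1 / 9 * (289 * x)" using x by simp
    also have "\<dots> \<le> 1 / 9 * (1 + \<epsilon>)\<^sup>2" using e by simp
    finally have "4 * exp 1 * real m * (1 / (1 + \<epsilon>))\<^sup>2 \<le> 1 / 9"
      using \<epsilon>0 by (simp add: power_divide field_simps)
    also have "1 / 9 \<le> exp (- 2 :: real)"
    proof -
      have "exp (2 :: real) = exp 1 * exp 1" by (simp flip: exp_add)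
      also have "\<dots> \<le> 3 * 3" using exp_1_le_3 by (intro mult_mono) auto
      finally show ?thesis by (simp add: exp_minus field_simps)
    qed
    finally show ?thesis .
  qed
  then have "real n * (4 * exp 1 * real m * (1 / (1 + \<epsilon>))\<^sup>2) ^ m \<le> real n * exp (- 2) ^ m"
    by (intro mult_left_mono power_mono) auto
  also have "exp (- 2) ^ m = exp (- 2 * real m)"
    using exp_of_nat_mult[of m "- 2 :: real"] by (simp add: mult.commute)
  also have "real n * exp (- 2 * real m) \<le> real n * exp (- 2 * x)"
    using m by (intro mult_left_mono) auto
  also have "\<dots> = 1 / real n"
  proof -
    have "exp (- 2 * x) = 1 / (exp x * exp x)" by (simp add: exp_minus inverse_eq_divide flip: exp_add)
    also have "exp x = real n" using n by (simp add: x_def)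
    finally show ?thesis using n by simp
  qed
  finally show ?thesis .
qed

lemma prob_le_cutoff:
  assumes l: "1 \<le> l" and M: "1 \<le> M" and m: "1 \<le> m" and q_def: "q = 2 * l * (M * m)"
    and D_def: "D = q\<^sup>2 + q + 1" and L_def: "L = 8 * (D + 1) ^ 3" and n: "L \<le> n"
    and B_def: "B = (real q ^ 3 + 1) * (real (q + 2) ^ 4 * real (Suc l) ^ 3)
      * ((1 + real (Suc l) ^ 2 * \<rho> ^ (2 * l)) ^ M - 1) ^ m"
    and \<beta>: "0 < \<beta>" "\<beta> \<le> 1"
  shows "tail_prob n \<beta>
    \<le> 2 * real n * (B + B / real n + 32 * real (D + 1) ^ 6 * (real L)\<^sup>2 / (real n)\<^sup>2)
      / (1 - (1 - \<beta> ^ (2 * l)) ^ M) ^ m"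
proof -
  have "8 * 1 \<le> L" unfolding L_def by (intro mult_left_mono one_le_power) auto
  then have n2: "2 \<le> n" using n by simp
  have b: "0 < \<beta> ^ (2 * l)" "\<beta> ^ (2 * l) \<le> 1" using \<beta> by (auto intro: power_le_one)
  have "(1 - \<beta> ^ (2 * l)) ^ M < 1"
    using b M by (intro power_Suc_less_one[of _ "M - 1", simplified] | simp add: power_less_one_iff)+
  then have pos: "0 < poly (cutoff M m) (\<beta> ^ (2 * l))" by (simp add: poly_cutoff)
  have "tail_prob n \<beta>
    \<le> average n r (spectral_sum l (cutoff M m) n) / poly (cutoff M m) (\<beta> ^ (2 * l))"
    using spectral_sum_bounds[OF n2 _ l m] \<beta> pos by (intro prob_le_average) auto
  also have "\<dots> \<le> 2 * real n * (B + B / real n + 32 * real (D + 1) ^ 6 * (real L)\<^sup>2 / (real n)\<^sup>2)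
      / poly (cutoff M m) (\<beta> ^ (2 * l))"
    using pos by (intro divide_right_mono average_spectral_sum_le[OF l M m q_def D_def L_def n B_def]) auto
  finally show ?thesis by (simp only: poly_cutoff)
qed

text \<open>The available \<open>\<delta>\<close> is shared out: \<open>q\<close> is at most
  n^\<open>\<kappa>\<close> and enters the remainder with power 24, using 24 \<open>\<kappa>\<close>
  = 2/5 \<open>\<delta>\<close>; the lower bound of the cutoff uses \<open>\<nu>\<close> =
  \<open>\<delta>\<close> / 4; the remaining 35/100 \<open>\<delta>\<close> absorb the numerical
  constants.\<close>

lemma prob_le_small_r:
  fixes \<delta> c\<^sub>1 :: real
  defines "c \<equiv> \<delta> / 200" and "\<kappa> \<equiv> \<delta> / 60" and "\<nu> \<equiv> \<delta> / 4" and "W \<equiv> 2 * exp (8 / \<delta>)"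
  assumes \<delta>: "0 < \<delta>" "\<delta> < 1" and n: "2 \<le> n" and r: "2 \<le> r"
    and n1: "8 * c * ln (real n) * real n powr c * (\<nu> * ln (real n) + 1) \<le> real n powr \<kappa>"
    and n2: "512 * real n powr (6 * \<kappa>) \<le> real n"
    and n3: "6 * 2 ^ 36 \<le> real n powr (35 / 100 * \<delta>)"
    and rn: "ln (real r) \<le> c * ln (real n)"
    and \<epsilon>: "\<epsilon> = 2 * c\<^sub>1 * ln (real r) / sqrt (ln (real n))"
    and c1: "0 < c\<^sub>1" "4 * W \<le> c * c\<^sub>1" "16 * W \<le> c * c\<^sub>1\<^sup>2"
    and small: "(1 + \<epsilon>) * \<rho> \<le> 1"
  shows "tail_prob n ((1 + \<epsilon>) * \<rho>)
    \<le> real n powr (- (1 - \<delta>))"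
proof -
  define N where "N = real n"
  define x where "x = ln N"
  define y where "y = ln (real r)"
  have N: "2 \<le> N" using n by (simp add: N_def)
  have "ln 2 \<le> x" using N by (simp add: x_def)
  then have x: "2 / 3 \<le> x" using ln2_ge_two_thirds by linarith
  have "ln 2 \<le> y" using r by (simp add: y_def)
  then have y: "2 / 3 \<le> y" using ln2_ge_two_thirds by linarith
  have c: "0 < c" using \<delta> by (simp add: c_def)
  have yx: "y \<le> c * x" using rn by (simp add: x_def y_def N_def)
  have \<epsilon>0: "0 < \<epsilon>" unfolding \<epsilon> using c1 x y by (simp add: x_def y_def N_def)
  define \<beta> where "\<beta> = (1 + \<epsilon>) * \<rho>"
  have \<beta>: "0 < \<beta>" "\<beta> \<le> 1" using \<epsilon>0 rho_pos small by (auto simp: \<beta>_def)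
  \<comment> \<open>The largest \<open>l\<close> for which r^l is at most n^c. It is at least 1, so
    rounding loses no more than a factor 2.\<close>
  define l where "l = nat \<lfloor>c * x / y\<rfloor>"
  have l_le: "real l \<le> c * x / y" and l_ge: "c * x / y < real l + 1"
    using c x y by (auto simp: l_def)
  have "1 \<le> c * x / y" using yx y by simp
  then have l: "1 \<le> l" unfolding l_def by (simp add: le_nat_floor)
  have ly: "real l * y \<le> c * x" using l_le y by (simp add: field_simps)
  have l2: "c * x \<le> 2 * real l * y"
  proof -
    have "c * x / y \<le> 2 * real l" using l_ge l by linarith
    then show ?thesis using y by (simp add: field_simps)
  qed
  have l_x: "real l \<le> 2 * c * x"
  proof -
    have "real l * (1 / 2) \<le> real l * y" using y by (intro mult_left_mono) auto
    then show ?thesis using ly by linarith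
  qed

  define b where "b = \<beta> ^ (2 * l)"
  have b: "0 < b" "b \<le> 1" using \<beta> by (auto simp: b_def intro: power_le_one)
  define M where "M = nat \<lceil>1 / b\<rceil>"
  have M: "1 / b \<le> real M" "real M \<le> 1 / b + 1" using b by (auto simp: M_def)
  have b1: "1 \<le> 1 / b" using b by simp
  have M1: "1 \<le> M" using M(1) b1 by linarith
  have M2: "real M \<le> 2 / b" using M(2) b1 by simp
  \<comment> \<open>The threshold is at least \<open>\<rho>\<close>, and rho^2 is at least 1 / r;
    hence the choice of \<open>l\<close> keeps the degree \<open>M\<close> a small power of
    n.\<close>
  have inv_b: "1 / b \<le> N powr c"
  proof -
    have "1 / b \<le> 1 / \<rho> ^ (2 * l)"
    proof (rule divide_left_mono)
      show "\<rho> ^ (2 * l) \<le> b"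
        unfolding b_def \<beta>_def using \<epsilon>0 rho_pos by (intro power_mono) auto
    qed (use b rho_pos in auto)
    also have "\<dots> = (1 / \<rho>\<^sup>2) ^ l" by (simp add: power_mult power_one_over)
    also have "\<dots> \<le> real r ^ l"
      using rho_sq_ge rho_pos r_pos by (intro power_mono) (auto simp: field_simps)
    also have "\<dots> = exp (real l * y)"
      using r by (simp add: y_def exp_of_nat_mult)
    also have "\<dots> \<le> exp (c * x)" using ly by simp
    also have "\<dots> = N powr c" using N by (simp add: powr_def x_def)
    finally show ?thesis .
  qed

  define a where "a = real (Suc l) ^ 2 * \<rho> ^ (2 * l)"
  have a0: "0 \<le> a" using rho_nonneg by (simp add: a_def)
  \<comment> \<open>The gain in the threshold must beat the Haagerup factor. For
    \<open>l = 1\<close> the linear term does so. For larger \<open>l\<close> the quadratic term is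
    of order (l eps)^2, at least a multiple of ln n, while \<open>l\<close> is at most a multiple of
    ln n.\<close>
  have ratio: "W * real (Suc l) \<le> (1 + \<epsilon>) ^ l"
  proof -
    define X where "X = real l * \<epsilon>"
    have X: "c * c\<^sub>1 * sqrt x \<le> X"
    proof -
      have "c * c\<^sub>1 * sqrt x = c\<^sub>1 * (c * x) / sqrt x"
        using x by (simp add: field_simps)
      also have "\<dots> \<le> c\<^sub>1 * (2 * real l * y) / sqrt x"
        using l2 c1 x by (intro divide_right_mono mult_left_mono) auto
      also have "\<dots> = X" by (simp add: X_def \<epsilon> x_def y_def N_def)
      finally show ?thesis .
    qed
    have sx: "1 / 2 \<le> sqrt x" using x by (intro real_le_rsqrt) (auto simp: power2_eq_square)
    have quad: "1 + X + real l * (real l - 1) / 2 * \<epsilon>\<^sup>2 \<le> (1 + \<epsilon>) ^ l"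
      using power_ge_quadratic[of \<epsilon> l] \<epsilon>0 by (simp add: X_def)
    show ?thesis
    proof (cases "l = 1")
      case True
      have "(4 * W) * (1 / 2) \<le> (c * c\<^sub>1) * sqrt x"
        by (rule mult_mono[OF c1(2) sx]) (use c c1 in auto)
      then have "W * real (Suc l) \<le> X" using X True by simp
      then show ?thesis using quad True by simp
    next
      case False
      then have l2': "2 \<le> real l" using l by simp
      have "W * real (Suc l) \<le> W * (4 * c * x)"
        using l_x l2' by (intro mult_left_mono) (auto simp: W_def)
      also have "\<dots> = 16 * W * (c * x) / 4" by simp
      also have "\<dots> \<le> c * c\<^sub>1\<^sup>2 * (c * x) / 4"
        using c1 c x by (intro divide_right_mono mult_right_mono) auto
      also have "\<dots> = (c * c\<^sub>1 * sqrt x)\<^sup>2 / 4"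
        using x by (simp add: power_mult_distrib power2_eq_square[of c] ac_simps)
      also have "\<dots> \<le> X\<^sup>2 / 4"
        using X c c1 x by (intro divide_right_mono power_mono) auto
      also have "\<dots> \<le> real l * (real l - 1) / 2 * \<epsilon>\<^sup>2"
      proof -
        have "real l * (real l / 2) \<le> real l * (real l - 1)" using l2' by (intro mult_left_mono) auto
        then have "real l * (real l / 2) / 2 * \<epsilon>\<^sup>2 \<le> real l * (real l - 1) / 2 * \<epsilon>\<^sup>2"
          by (intro mult_right_mono divide_right_mono) auto
        then show ?thesis by (simp add: X_def power_mult_distrib power2_eq_square)
      qed
      also have "\<dots> \<le> (1 + \<epsilon>) ^ l"
      proof -
        have "0 \<le> X" using \<epsilon>0 by (simp add: X_def)
        then show ?thesis using quad by linarith
      qed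
      finally show ?thesis .
    qed
  qed
  have W: "1 \<le> exp (8 / \<delta>)" "0 < W" using \<delta> by (auto simp: W_def)
  have aM: "a * real M \<le> 2 / W\<^sup>2"
  proof -
    have "a * real M \<le> a * (2 / b)" using M2 a0 by (intro mult_left_mono)
    also have "\<dots> = 2 * real (Suc l) ^ 2 / ((1 + \<epsilon>) ^ l)\<^sup>2"
    proof -
      have "b = ((1 + \<epsilon>) ^ l)\<^sup>2 * \<rho> ^ (2 * l)"
        by (simp add: b_def \<beta>_def power_mult_distrib power_even_eq)
      then show ?thesis using rho_pos \<epsilon>0 by (simp add: a_def field_simps)
    qed
    also have "\<dots> \<le> 2 * real (Suc l) ^ 2 / (W * real (Suc l))\<^sup>2"
      using ratio W \<epsilon>0 by (intro divide_left_mono power_mono mult_pos_pos zero_less_power) auto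
    also have "\<dots> = 2 / W\<^sup>2" using W by (simp add: power_mult_distrib)
    finally show ?thesis .
  qed
  have W2: "2 / W\<^sup>2 = exp (- 16 / \<delta>) / 2"
  proof -
    have "W\<^sup>2 = 4 * exp (16 / \<delta>)"
      by (simp add: W_def power_mult_distrib power2_eq_square flip: exp_add)
    then show ?thesis by (simp add: exp_minus field_simps)
  qed
  \<comment> \<open>\<open>W\<close> is chosen for this bound: its m-th power, with \<open>m\<close>
    at least \<open>\<delta>\<close> / 4 times ln n, is at most n^(-4), which outweighs the
    polynomial factors of \<open>B\<close>.\<close>
  have growth: "(1 + a) ^ M - 1 \<le> exp (- 16 / \<delta>)"
  proof -
    have "exp (- 16 / \<delta>) \<le> 1" using \<delta> by simp
    then have aM1: "a * real M \<le> 1" using aM W2 by linarith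
    have aM0: "0 \<le> a * real M" using a0 by simp
    have "(1 + a) ^ M \<le> exp a ^ M" using a0 by (intro power_mono exp_ge_add_one_self) auto
    also have "\<dots> = exp (a * real M)" by (simp add: exp_of_nat2_mult)
    also have "\<dots> \<le> 1 + a * real M + (a * real M)\<^sup>2" using exp_bound[OF aM0 aM1] .
    also have "(a * real M)\<^sup>2 \<le> a * real M * 1"
      unfolding power2_eq_square using aM0 aM1 by (intro mult_left_mono)
    finally show ?thesis using aM W2 by linarith
  qed

  define m where "m = nat \<lceil>\<nu> * x\<rceil>"
  have \<nu>x: "0 < \<nu> * x" using \<delta> x by (simp add: \<nu>_def)
  then have m: "\<nu> * x \<le> real m" "real m \<le> \<nu> * x + 1" by (auto simp: m_def)
  have m1: "1 \<le> m" using m(1) \<nu>x by (cases m) auto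
  define q where "q = 2 * l * (M * m)"
  have "0 < q" using l M1 m1 by (simp add: q_def)
  then have q1: "1 \<le> real q" by simp
  have lq: "real (Suc l) \<le> 2 * real q"
  proof -
    have "l * 1 \<le> l * (M * m)" using M1 m1 by (intro mult_left_mono) auto
    then have "l \<le> q" by (simp add: q_def)
    then have "Suc l \<le> 2 * q" using \<open>0 < q\<close> by linarith
    from of_nat_mono[OF this, where 'a = real] show ?thesis by simp
  qed
  have q: "real q \<le> N powr \<kappa>"
  proof -
    have "real q = 2 * real l * (real M * real m)" by (simp add: q_def)
    also have "\<dots> \<le> 2 * (2 * c * x) * ((2 * N powr c) * (\<nu> * x + 1))"
    proof (intro mult_mono l_x m(2))
      show "real M \<le> 2 * N powr c" using M2 inv_b by simp
    qed (use c x in auto)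
    also have "\<dots> = 8 * c * ln N * N powr c * (\<nu> * ln N + 1)" by (simp add: x_def)
    also have "\<dots> \<le> N powr \<kappa>" using n1 by (simp add: N_def)
    finally show ?thesis .
  qed
  have q_pow: "real q ^ k \<le> N powr (real k * \<kappa>)" for k
  proof -
    have "real q ^ k \<le> (N powr \<kappa>) ^ k" using q by (intro power_mono) auto
    also have "\<dots> = N powr (real k * \<kappa>)" using N by (simp add: powr_power mult.commute)
    finally show ?thesis .
  qed
  define D where "D = q\<^sup>2 + q + 1"
  define L where "L = 8 * (D + 1) ^ 3"
  have D: "real (D + 1) \<le> 4 * real q ^ 2"
  proof -
    have "real q \<le> real q ^ 2" "1 \<le> real q ^ 2" using q1 by (auto intro!: self_le_power one_le_power)
    moreover have "real (D + 1) = real q ^ 2 + real q + 2" by (simp add: D_def)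
    ultimately show ?thesis by linarith
  qed
  have D_pow: "real (D + 1) ^ k \<le> 4 ^ k * real q ^ (2 * k)" for k
  proof -
    have "real (D + 1) ^ k \<le> (4 * real q ^ 2) ^ k" using D by (intro power_mono) auto
    then show ?thesis by (simp add: power_mult_distrib power_mult)
  qed
  have Ln: "L \<le> n"
  proof -
    have "real L = 8 * real (D + 1) ^ 3" by (simp add: L_def)
    also have "\<dots> \<le> 8 * (4 ^ 3 * real q ^ (2 * 3))" by (intro mult_left_mono D_pow) auto
    also have "\<dots> \<le> 512 * N powr (6 * \<kappa>)" using q_pow[of 6] by simp
    also have "\<dots> \<le> real n" using n2 by (simp add: N_def)
    finally show ?thesis by simp
  qed
  define B where "B = (real q ^ 3 + 1) * (real (q + 2) ^ 4 * real (Suc l) ^ 3)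
      * ((1 + real (Suc l) ^ 2 * \<rho> ^ (2 * l)) ^ M - 1) ^ m"
  have nn: "0 \<le> (1 + a) ^ M - 1" using a0 by (simp add: one_le_power)
  have B_growth: "0 \<le> ((1 + a) ^ M - 1) ^ m" "((1 + a) ^ M - 1) ^ m \<le> N powr (- 4)"
  proof -
    show "0 \<le> ((1 + a) ^ M - 1) ^ m" using nn by simp
    have "((1 + a) ^ M - 1) ^ m \<le> exp (- 16 / \<delta>) ^ m" using nn growth by (intro power_mono)
    also have "\<dots> = exp (- (16 / \<delta> * real m))" by (simp add: exp_of_nat2_mult[symmetric])
    also have "\<dots> \<le> exp (- (16 / \<delta> * (\<nu> * x)))" using m(1) \<delta> by (simp add: divide_right_mono)
    also have "\<dots> = N powr (- 4)" using \<delta> N by (simp add: \<nu>_def powr_def x_def)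
    finally show "((1 + a) ^ M - 1) ^ m \<le> N powr (- 4)" .
  qed
  have B: "0 \<le> B" "B \<le> 1296 * N powr (24 * \<kappa> - 2)"
  proof -
    have "1 \<le> real q ^ 3" using q1 by (rule one_le_power)
    then have "real q ^ 3 + 1 \<le> 2 * real q ^ 3" by simp
    moreover have "real (q + 2) ^ 4 \<le> (3 * real q) ^ 4" using q1 by (intro power_mono) auto
    moreover have "real (Suc l) ^ 3 \<le> (2 * real q) ^ 3" using lq by (intro power_mono) auto
    ultimately have "B \<le> (2 * real q ^ 3) * ((3 * real q) ^ 4 * (2 * real q) ^ 3) * N powr (- 4)"
      unfolding B_def a_def[symmetric] using B_growth by (intro mult_mono) auto
    also have "\<dots> = 1296 * real q ^ 10 * N powr (- 4)"
      by (simp add: power_mult_distrib flip: power_add)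
    also have "\<dots> \<le> 1296 * N powr (real 10 * \<kappa>) * N powr (- 4)"
      by (intro mult_right_mono mult_left_mono q_pow) auto
    also have "\<dots> = 1296 * N powr (10 * \<kappa> - 4)" by (simp add: powr_diff powr_minus divide_inverse)
    also have "\<dots> \<le> 1296 * N powr (24 * \<kappa> - 2)"
      using N \<delta> by (intro mult_left_mono powr_mono) (auto simp: \<kappa>_def)
    finally show "B \<le> 1296 * N powr (24 * \<kappa> - 2)" .
    show "0 \<le> B" unfolding B_def a_def[symmetric] using B_growth by simp
  qed
  have Taylor: "32 * real (D + 1) ^ 6 * (real L)\<^sup>2 / N\<^sup>2 \<le> 2 ^ 35 * N powr (24 * \<kappa> - 2)"
  proof -
    have "32 * real (D + 1) ^ 6 * (real L)\<^sup>2 = 2048 * real (D + 1) ^ 12"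
      by (simp add: L_def power_mult_distrib flip: power_add power_mult)
    also have "\<dots> \<le> 2048 * (4 ^ 12 * real q ^ (2 * 12))" by (intro mult_left_mono D_pow) auto
    also have "\<dots> \<le> 2048 * (4 ^ 12 * N powr (real 24 * \<kappa>))"
      using q_pow[of 24] by (intro mult_left_mono) auto
    finally have "32 * real (D + 1) ^ 6 * (real L)\<^sup>2 / N\<^sup>2 \<le> 2 ^ 35 * N powr (24 * \<kappa>) / N\<^sup>2"
      using N by (intro divide_right_mono) auto
    also have "\<dots> = 2 ^ 35 * N powr (24 * \<kappa> - 2)" using N by (simp add: powr_diff)
    finally show ?thesis .
  qed
  have T: "B + B / N + 32 * real (D + 1) ^ 6 * (real L)\<^sup>2 / N\<^sup>2 \<le> 2 ^ 36 * N powr (24 * \<kappa> - 2)"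
  proof -
    have "B / N \<le> B / 1" using B N by (intro divide_left_mono) auto
    then show ?thesis using B Taylor by simp
  qed
  have denom: "(1 / 2) ^ m \<le> (1 - (1 - b) ^ M) ^ m"
  proof (rule power_mono)
    have "(1 - b) ^ M \<le> exp (- b) ^ M"
      using b exp_ge_add_one_self[of "- b"] by (intro power_mono) auto
    also have "\<dots> = exp (- (b * real M))" by (simp add: exp_of_nat2_mult[symmetric])
    also have "\<dots> \<le> exp (- 1)" using M(1) b by (simp add: field_simps)
    also have "\<dots> \<le> 1 / 2"
      using exp_ge_add_one_self[of "1 :: real"] by (simp add: exp_minus field_simps)
    finally show "1 / 2 \<le> 1 - (1 - b) ^ M" by simp
  qed simp
  have two_m: "2 ^ m \<le> 3 * N powr \<nu>"
  proof -
    have "(2 :: real) ^ m \<le> exp 1 ^ m" using exp_ge_add_one_self[of "1 :: real"] by (intro power_mono) auto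
    also have "\<dots> = exp (real m)" using exp_of_nat_mult[of m "1 :: real"] by simp
    also have "\<dots> \<le> exp (\<nu> * x + 1)" using m(2) by simp
    also have "\<dots> = N powr \<nu> * exp 1" using N by (simp add: exp_add powr_def x_def)
    also have "\<dots> \<le> N powr \<nu> * 3" using exp_1_le_3 by (intro mult_left_mono) auto
    finally show ?thesis by simp
  qed
  have "tail_prob n \<beta>
    \<le> 2 * N * (B + B / N + 32 * real (D + 1) ^ 6 * (real L)\<^sup>2 / N\<^sup>2) / (1 - (1 - b) ^ M) ^ m"
    unfolding N_def b_def by (rule prob_le_cutoff[OF l M1 m1 q_def D_def L_def Ln B_def \<beta>])
  also have "\<dots> \<le> 2 * N * (2 ^ 36 * N powr (24 * \<kappa> - 2)) / (1 / 2) ^ m"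
    using N T denom B by (intro frac_le mult_left_mono mult_nonneg_nonneg) auto
  also have "\<dots> = 2 * N * (2 ^ 36 * N powr (24 * \<kappa> - 2)) * 2 ^ m"
    by (simp add: power_one_over)
  also have "\<dots> \<le> 2 * N * (2 ^ 36 * N powr (24 * \<kappa> - 2)) * (3 * N powr \<nu>)"
    using two_m N by (intro mult_left_mono) auto
  also have "\<dots> = (6 * 2 ^ 36) * (N powr 1 * N powr (24 * \<kappa> - 2) * N powr \<nu>)"
    using N by simp
  also have "N powr 1 * N powr (24 * \<kappa> - 2) * N powr \<nu> = N powr (1 + (24 * \<kappa> - 2) + \<nu>)"
    by (simp only: powr_add)
  also have "(6 * 2 ^ 36) * N powr (1 + (24 * \<kappa> - 2) + \<nu>)
      \<le> N powr (35 / 100 * \<delta>) * N powr (1 + (24 * \<kappa> - 2) + \<nu>)"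
    using n3 by (intro mult_right_mono) (auto simp: N_def)
  also have "\<dots> = N powr (- (1 - \<delta>))"
    by (simp add: \<kappa>_def \<nu>_def flip: powr_add)
  finally show ?thesis by (simp only: \<beta>_def N_def)
qed

end

lemma eventually_large:
  fixes \<delta> :: real
  assumes "0 < \<delta>" "\<delta> < 1"
  shows "\<forall>\<^sub>F n :: nat in sequentially.
      8 * (\<delta> / 200) * ln (real n) * real n powr (\<delta> / 200) * (\<delta> / 4 * ln (real n) + 1) \<le> real n powr (\<delta> / 60)
    \<and> 512 * real n powr (6 * (\<delta> / 60)) \<le> real n
    \<and> 6 * 2 ^ 36 \<le> real n powr (35 / 100 * \<delta>)"
proof -
  have 1: "\<forall>\<^sub>F n :: nat in sequentially.
      8 * (\<delta> / 200) * ln (real n) * real n powr (\<delta> / 200) * (\<delta> / 4 * ln (real n) + 1) \<le> real n powr (\<delta> / 60)"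
    using assms by real_asymp
  have 2: "\<forall>\<^sub>F n :: nat in sequentially. 512 * real n powr (6 * (\<delta> / 60)) \<le> real n"
    using assms by real_asymp
  have 3: "\<forall>\<^sub>F n :: nat in sequentially. 6 * 2 ^ 36 \<le> real n powr (35 / 100 * \<delta>)"
    using assms by real_asymp
  show ?thesis using 1 2 3 by eventually_elim simp
qed

theorem corollary2:
  fixes c\<^sub>0 :: real
  assumes "0 < c\<^sub>0" and "c\<^sub>0 < 1"
  shows "\<exists>c\<^sub>1>0. \<forall>n\<ge>2. \<forall>r\<ge>2. \<forall>p::nat \<Rightarrow> real. probability_vector r p \<longrightarrow>
    (let \<rho> = sqrt (\<Sum>i<r. (p i)\<^sup>2);
         d = r\<^sup>2;
         \<epsilon> = c\<^sub>1 * ln (real d) / sqrt (ln (real n))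
     in measure_pmf.prob (random_permutations n r)
          {\<sigma>. eigenvalue_modulus (weighted_permutation_matrix n r p \<sigma>) 2 \<ge> (1 + \<epsilon>) * \<rho>}
        \<le> real n powr (- c\<^sub>0))"
proof -
  define \<delta> where "\<delta> = 1 - c\<^sub>0"
  have \<delta>: "0 < \<delta>" "\<delta> < 1" using assms by (auto simp: \<delta>_def)
  define c where "c = \<delta> / 200"
  have c: "0 < c" using \<delta> by (simp add: c_def)
  define W where "W = 2 * exp (8 / \<delta>)"
  have W: "0 < W" by (simp add: W_def)
  obtain n\<^sub>0 where n\<^sub>0: "\<And>n. n\<^sub>0 \<le> n \<Longrightarrow>
      8 * (\<delta> / 200) * ln (real n) * real n powr (\<delta> / 200) * (\<delta> / 4 * ln (real n) + 1) \<le> real n powr (\<delta> / 60)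
    \<and> 512 * real n powr (6 * (\<delta> / 60)) \<le> real n
    \<and> 6 * 2 ^ 36 \<le> real n powr (35 / 100 * \<delta>)"
    using eventually_large[OF \<delta>] unfolding eventually_sequentially by blast
  \<comment> \<open>One summand for each demand: the multiple of \<open>W / c\<close> for the
    polynomial method, 17 / \<open>c\<close> for \<open>r\<close> above n^c, and the logarithm for
    the finitely many n below the threshold \<open>n\<^sub>0\<close>. The summand 1 ensures that
    \<open>c\<^sub>1\<close> is at most its square.\<close>
  define c\<^sub>1 where "c\<^sub>1 = 1 + 16 * (W / c) + 17 * (1 / c) + 17 * ln (real (n\<^sub>0 + 2))"
  have ln0: "0 < ln (real (n\<^sub>0 + 2))" by simp
  have pos: "0 < W / c" "0 < 1 / c" using W c by auto
  have c1_ge: "1 \<le> c\<^sub>1" "4 * (W / c) \<le> c\<^sub>1" "16 * (W / c) \<le> c\<^sub>1" "17 * (1 / c) \<le> c\<^sub>1"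
      "17 * ln (real (n\<^sub>0 + 2)) \<le> c\<^sub>1"
    unfolding c\<^sub>1_def using pos ln0 by linarith+
  show ?thesis
  proof (intro exI[of _ c\<^sub>1] conjI allI impI)
    show "0 < c\<^sub>1" using c1_ge by simp
    fix n r :: nat and p :: "nat \<Rightarrow> real"
    assume n: "2 \<le> n" and r: "2 \<le> r" and "probability_vector r p"
    then interpret weights p r by unfold_locales
    define x where "x = ln (real n)"
    define y where "y = ln (real r)"
    have "ln 2 \<le> x" "ln 2 \<le> y" using n r by (auto simp: x_def y_def)
    then have x: "2 / 3 \<le> x" and y: "2 / 3 \<le> y" using ln2_ge_two_thirds by linarith+
    define \<epsilon> where "\<epsilon> = 2 * c\<^sub>1 * ln (real r) / sqrt (ln (real n))"
    have \<epsilon>': "c\<^sub>1 * ln (real (r\<^sup>2)) / sqrt (ln (real n)) = \<epsilon>"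
      using r by (simp add: \<epsilon>_def ln_realpow)
    have "tail_prob n ((1 + \<epsilon>) * \<rho>) \<le> real n powr (- c\<^sub>0)"
    proof (cases "n\<^sub>0 \<le> n \<and> y \<le> c * x")
      case True
      show ?thesis
      proof (cases "(1 + \<epsilon>) * \<rho> \<le> 1")
        case small: True
        have "4 * W \<le> c * c\<^sub>1" "16 * W \<le> c * c\<^sub>1"
          using c1_ge c by (simp_all add: field_simps)
        moreover have "c * c\<^sub>1 \<le> c * c\<^sub>1\<^sup>2" using c c1_ge(1) by (simp add: power2_eq_square)
        ultimately have "tail_prob n ((1 + \<epsilon>) * \<rho>)
            \<le> real n powr (- (1 - \<delta>))"
          using n\<^sub>0[of n] True small c1_ge(1)
          by (intro prob_le_small_r[OF \<delta> n r _ _ _ _ \<epsilon>_def]) (auto simp: c_def W_def x_def y_def)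
        then show ?thesis by (simp add: \<delta>_def)
      next
        case False
        then show ?thesis using prob_eq_0[OF n, of "(1 + \<epsilon>) * \<rho>"] by simp
      qed
    next
      case False
      \<comment> \<open>After division by sqrt \<open>x\<close> this says that
        \<open>\<epsilon>\<close> is large enough for the plain moment bound.\<close>
      have "17 * x \<le> 2 * c\<^sub>1 * y"
      proof (cases "y \<le> c * x")
        case True
        with False have "n < n\<^sub>0" by simp
        then have "x \<le> ln (real (n\<^sub>0 + 2))" using n by (simp add: x_def)
        then have "17 * x \<le> c\<^sub>1 * 1" using c1_ge(5) by simp
        also have "\<dots> \<le> c\<^sub>1 * (2 * y)" using y c1_ge(1) by (intro mult_left_mono) auto
        finally show ?thesis by simp
      next
        case False
        then have "17 * (1 / c) * (c * x) \<le> c\<^sub>1 * y" using c1_ge c x y by (intro mult_mono) auto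
        moreover have "0 \<le> c\<^sub>1 * y" using c1_ge y by simp
        ultimately show ?thesis using c by simp
      qed
      then have "17 * x / sqrt x \<le> \<epsilon>" using x by (simp add: \<epsilon>_def x_def y_def divide_right_mono)
      moreover have "x / sqrt x = sqrt x" using x by (simp add: real_div_sqrt)
      ultimately have "17 * sqrt (ln (real n)) \<le> \<epsilon>" by (simp add: x_def)
      then have "tail_prob n ((1 + \<epsilon>) * \<rho>) \<le> 1 / real n"
        by (rule prob_le_large_deviation[OF n])
      also have "\<dots> = real n powr (- 1)" using n by (simp add: powr_minus divide_inverse)
      also have "\<dots> \<le> real n powr (- c\<^sub>0)" using n assms by (intro powr_mono) auto
      finally show ?thesis .
    qed
    then show "let \<rho> = sqrt (\<Sum>i<r. (p i)\<^sup>2); d = r\<^sup>2; \<epsilon> = c\<^sub>1 * ln (real d) / sqrt (ln (real n))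
      in measure_pmf.prob (random_permutations n r)
          {\<sigma>. eigenvalue_modulus (weighted_permutation_matrix n r p \<sigma>) 2 \<ge> (1 + \<epsilon>) * \<rho>}
        \<le> real n powr (- c\<^sub>0)"
      unfolding Let_def \<epsilon>' \<rho>_def .
  qed
qed

end
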